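(* Assume $X_t\in\mathcal{L}^p$ with some $p>4$, $\mathbb{E}X_t=0$, and $\Theta_p(m)=O(m^{-\alpha})$, $\Delta_p(m)=O(m^{-\alpha'})$ for some $\alpha\ge\alpha'>0$. If $$\alpha>1/2\qquad\text{or}\qquad \alpha'p>2,$$ then $$\lambda(\hat\Gamma_{T,A_T}-\Sigma_T)=O_P\left[\left(\frac{\log T}{T}\right)^{\frac{\alpha}{2(1+\alpha)}}\right],$$ where $A_T=2c_p'\sqrt{\log T/T}$ with $c_p'=6(p+4)e^{p/4}\|X_0\|_4\Theta_4$.
   Context: Let $\varepsilon_t$, $t\in\mathbb{Z}$, be i.i.d. random variables and let $g$ be a measurable real-valued function such that $X_t = g(\varepsilon_t,\varepsilon_{t-1},\ldots)$ is well defined; $(X_t)_{t\in\mathbb{Z}}$ is then a stationary process. Write $\|X\|_p = (\mathbb{E}|X|^p)^{1/p}$ and $X\in\mathcal{L}^p$ if $\|X\|_p<\infty$. Let $(\varepsilon_t')_{t\in\mathbb{Z}}$ be an independent i.i.d. copy of $(\varepsilon_t)_{t\in\mathbb{Z}}$. For $t\ge 0$ let $X_t' = g(\varepsilon_t,\ldots,\varepsilon_1,\varepsilon_0',\varepsilon_{-1},\ldots)$, i.e. $\varepsilon_0$ is replaced by $\varepsilon_0'$. For $p>0$ define $\delta_p(t) = \|X_t-X_t'\|_p$ for $t\ge 0$, and $\Theta_p(m) = \sum_{t=m}^\infty \delta_p(t)$ for $m\ge 0$, $\Theta_p = \Theta_p(0)$. Standing assumption: $\Theta_p<\infty$. For $p>2$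 define further $$\Psi_p(m)=\left(\sum_{t=m}^\infty\delta_p(t)^2\right)^{1/2},\qquad \Delta_p(m)=\sum_{t=0}^\infty\min\{\mathcal{C}_p\Psi_p(m),\delta_p(t)\},\qquad \mathcal{C}_p=\sqrt{p-1}.$$ Autocovariances (mean zero): $\gamma_k = \mathbb{E}(X_0X_k)$; $\Sigma_T=(\gamma_{s-t})_{1\le s,t\le T}$. Sample autocovariances from $X_1,\ldots,X_T$: $\hat\gamma_k = \frac1T\sum_{t=|k|+1}^{T} X_{t-|k|}X_t$ for $|k|\le T-1$. The thresholded sample autocovariance matrix is $$\hat\Gamma_{T,A_T}=\left(\hat\gamma_{s-t}\mathbf{1}_{|\hat\gamma_{s-t}|\ge A_T}\right)_{1\le s,t\le T},$$ with the convention that the diagonal elements are never thresholded (the diagonal entries are always $\hat\gamma_0$). For a symmetric real matrix $A$, $\lambda(A) = \max_{|\mathbf{x}|=1}|A\mathbf{x}|$ is the operator norm (spectral radius), $|\cdot|$ being the Euclidean norm. $O_P$ is as $T\to\infty$. *)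

theory Defs
  imports
    "HOL-Probability.Probability"
    "HOL-Library.Landau_Symbols"
    "Jordan_Normal_Form.Matrix"
begin

(* Independent copy: all variables eps t, eps' t (t an integer) are jointly independent and
   identically distributed. *)
definition iid_with_copy ::
  "'a measure \<Rightarrow> (int \<Rightarrow> 'a \<Rightarrow> real) \<Rightarrow> (int \<Rightarrow> 'a \<Rightarrow> real) \<Rightarrow> bool" where
  "iid_with_copy M eps eps' \<longleftrightarrow>
     prob_space.indep_vars M (\<lambda>_. borel) (case_sum eps eps') (UNIV :: (int + int) set) \<and>
     (\<forall>t. distr M borel (eps t) = distr M borel (eps 0)) \<and>
     (\<forall>t. distr M borel (eps' t) = distr M borel (eps 0))"

(* X_t = g (eps_t, eps_(t-1), ...); coordinate i of the argument of g is eps_(t-i). *)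
definition causal_process ::
  "((nat \<Rightarrow> real) \<Rightarrow> real) \<Rightarrow> (int \<Rightarrow> 'a \<Rightarrow> real) \<Rightarrow> int \<Rightarrow> 'a \<Rightarrow> real" where
  "causal_process g eps t \<omega> = g (\<lambda>i. eps (t - int i) \<omega>)"

definition coupled_process ::
  "((nat \<Rightarrow> real) \<Rightarrow> real) \<Rightarrow> (int \<Rightarrow> 'a \<Rightarrow> real) \<Rightarrow> (int \<Rightarrow> 'a \<Rightarrow> real) \<Rightarrow> int \<Rightarrow> 'a \<Rightarrow> real" where
  "coupled_process g eps eps' = causal_process g (eps(0 := eps' 0))"

definition in_Lp :: "'a measure \<Rightarrow> real \<Rightarrow> ('a \<Rightarrow> real) \<Rightarrow> bool" where
  "in_Lp M p X \<longleftrightarrow> X \<in> borel_measurable M \<and> integrable M (\<lambda>\<omega>. \<bar>X \<omega>\<bar> powr p)"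

(* Only meaningful for X in L^p: the Bochner integral of a non-integrable function is 0. *)
definition Lp_norm :: "'a measure \<Rightarrow> real \<Rightarrow> ('a \<Rightarrow> real) \<Rightarrow> real" where
  "Lp_norm M p X = (\<integral>\<omega>. \<bar>X \<omega>\<bar> powr p \<partial>M) powr (1 / p)"

definition dep_delta ::
  "'a measure \<Rightarrow> ((nat \<Rightarrow> real) \<Rightarrow> real) \<Rightarrow> (int \<Rightarrow> 'a \<Rightarrow> real) \<Rightarrow> (int \<Rightarrow> 'a \<Rightarrow> real) \<Rightarrow>
   real \<Rightarrow> nat \<Rightarrow> real" where
  "dep_delta M g eps eps' p t =
     Lp_norm M p (\<lambda>\<omega>. causal_process g eps (int t) \<omega> - coupled_process g eps eps' (int t) \<omega>)"

(* The three tail sums below are real-valued series; they have their intended meaning when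
   dep_delta M g eps eps' p is summable. *)
definition dep_Theta ::
  "'a measure \<Rightarrow> ((nat \<Rightarrow> real) \<Rightarrow> real) \<Rightarrow> (int \<Rightarrow> 'a \<Rightarrow> real) \<Rightarrow> (int \<Rightarrow> 'a \<Rightarrow> real) \<Rightarrow>
   real \<Rightarrow> nat \<Rightarrow> real" where
  "dep_Theta M g eps eps' p m = (\<Sum>t. dep_delta M g eps eps' p (m + t))"

definition dep_Psi ::
  "'a measure \<Rightarrow> ((nat \<Rightarrow> real) \<Rightarrow> real) \<Rightarrow> (int \<Rightarrow> 'a \<Rightarrow> real) \<Rightarrow> (int \<Rightarrow> 'a \<Rightarrow> real) \<Rightarrow>
   real \<Rightarrow> nat \<Rightarrow> real" where
  "dep_Psi M g eps eps' p m = sqrt (\<Sum>t. (dep_delta M g eps eps' p (m + t))\<^sup>2)"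

definition dep_Delta ::
  "'a measure \<Rightarrow> ((nat \<Rightarrow> real) \<Rightarrow> real) \<Rightarrow> (int \<Rightarrow> 'a \<Rightarrow> real) \<Rightarrow> (int \<Rightarrow> 'a \<Rightarrow> real) \<Rightarrow>
   real \<Rightarrow> nat \<Rightarrow> real" where
  "dep_Delta M g eps eps' p m =
     (\<Sum>t. min (sqrt (p - 1) * dep_Psi M g eps eps' p m) (dep_delta M g eps eps' p t))"

(* No centering: used for mean-zero processes. *)
definition autocov :: "'a measure \<Rightarrow> (int \<Rightarrow> 'a \<Rightarrow> real) \<Rightarrow> int \<Rightarrow> real" where
  "autocov M X k = (\<integral>\<omega>. X 0 \<omega> * X k \<omega> \<partial>M)"

definition sample_autocov :: "(int \<Rightarrow> 'a \<Rightarrow> real) \<Rightarrow> nat \<Rightarrow> int \<Rightarrow> 'a \<Rightarrow> real" where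
  "sample_autocov X T k \<omega> = (1 / real T) * (\<Sum>t = \<bar>k\<bar> + 1..int T. X (t - \<bar>k\<bar>) \<omega> * X t \<omega>)"

(* Row and column indices run over 0..T-1 instead of 1..T; the entries depend only on s - t. *)
definition autocov_mat :: "'a measure \<Rightarrow> (int \<Rightarrow> 'a \<Rightarrow> real) \<Rightarrow> nat \<Rightarrow> real mat" where
  "autocov_mat M X T = Matrix.mat T T (\<lambda>(s, t). autocov M X (int s - int t))"

definition thresholded_autocov_mat ::
  "(int \<Rightarrow> 'a \<Rightarrow> real) \<Rightarrow> nat \<Rightarrow> real \<Rightarrow> 'a \<Rightarrow> real mat" where
  "thresholded_autocov_mat X T A \<omega> = Matrix.mat T T (\<lambda>(s, t).
     let c = sample_autocov X T (int s - int t) \<omega> in if s = t \<or> \<bar>c\<bar> \<ge> A then c else 0)"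

definition euclidean_norm :: "real Matrix.vec \<Rightarrow> real" where
  "euclidean_norm v = sqrt (scalar_prod v v)"

(* The supremum is a maximum, by compactness of the unit sphere, if A has a column. *)
definition operator_norm :: "real mat \<Rightarrow> real" where
  "operator_norm A =
     (SUP x\<in>{x \<in> carrier_vec (dim_col A). euclidean_norm x = 1}. euclidean_norm (A *\<^sub>v x))"

(* Y n = O_P (r n) as n tends to infinity. Measurability is required because the measure of a
   non-measurable set is 0 by convention. *)
definition bounded_in_prob :: "'a measure \<Rightarrow> (nat \<Rightarrow> 'a \<Rightarrow> real) \<Rightarrow> (nat \<Rightarrow> real) \<Rightarrow> bool" where
  "bounded_in_prob M Y r \<longleftrightarrow>
     (\<forall>n. Y n \<in> borel_measurable M) \<and>
     (\<forall>\<eta>>0. \<exists>C>0. eventually (\<lambda>n. measure M {\<omega> \<in> space M. \<bar>Y n \<omega>\<bar> > C * r n} \<le> \<eta>) sequentially)"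

end

theory Submission
  imports Defs "HOL-Real_Asymp.Real_Asymp"
begin

text \<open>The entries of the error matrix only depend on the lag, so its operator norm is at most twice the
sum over \<open>k < T\<close> of the errors of the thresholded sample autocovariances (Schur's test,
\<open>operator_norm_le_Schur\<close>). If every sample autocovariance is within \<open>A T / 2\<close> of its mean
\<open>(1 - k / T) * \<gamma> k\<close>, the error at lag \<open>k\<close> is at most \<open>3 / 2 * A T\<close> plus the bias, and
off the diagonal it is also at most \<open>2 * \<bar>\<gamma> k\<bar>\<close>: what is kept has a large mean, what is killed
has a small one. Using the first bound up to a cutoff \<open>m\<close> and the second beyond it gives an error of
order \<open>m * A T + m powr (- \<alpha>)\<close>, because the tail sums of \<open>\<bar>\<gamma> k\<bar>\<close> decay like the tail sums of the
dependence coefficients; \<open>m \<sim> (T / ln T) powr (1 / (2 * (1 + \<alpha>)))\<close> balances the two terms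
(\<open>thresholded_Toeplitz_error\<close>).

The probabilistic part is that all lags deviate by at most \<open>c * sqrt (ln T / T)\<close> simultaneously
(\<open>uniform_lag_deviation\<close>). Everything is computed on the space of sequences of innovations
(most recent first), where the process is \<open>g\<close> evaluated along the shift and where conditioning on the
past is integration over the first coordinates (\<open>avg\<close>). Write
\<open>X\<^sub>t = E[X\<^sub>t | F\<^sub>t\<^sub>-\<^sub>k] + \<Sum>\<^sub>i\<^sub><\<^sub>k (increment of the prediction of X\<^sub>t at time t - i)\<close>
in the sum of the products \<open>X\<^sub>t\<^sub>-\<^sub>k * X\<^sub>t\<close>. Two parts arise.

The increments give a martingale whose differences are weighted sums of increments with weights
\<open>X\<^sub>t\<^sub>-\<^sub>k\<close> from the past. A self-normalized exponential inequality
(\<open>self_normalized_tail_abs\<close>) bounds such a martingale on the event that its quadratic variation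
(realised plus predictable) is small, and applies to unbounded differences. By weighted
Cauchy-Schwarz and Young inequalities the quadratic variation at every lag \<open>k\<close> is below one and the
same ergodic sum \<open>\<Sum>t<T. h (shift t e)\<close> with mean at most \<open>2 * (\<Theta> * G)\<^sup>2\<close> per summand
(\<open>quadratic_variation_majorant\<close>), and the weak law of large numbers controls it. The
exponent obtained is a large multiple of \<open>ln T\<close>, so the union bound over \<open>T\<close> lags is harmless.

The predictions give the sum of \<open>X\<^sub>t * E[X\<^sub>t\<^sub>+\<^sub>k | F\<^sub>t]\<close>, centred. A moment inequality of order
\<open>p / 2 > 2\<close> (\<open>Lq_le_lag_remainder\<close>) bounds its norm by a multiple of \<open>sqrt T\<close> times the tail sum
of the dependence coefficients beyond \<open>k\<close>, and the resulting probabilities are summable over \<open>k\<close> as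
soon as \<open>\<alpha> * p > 2\<close>. Both alternatives of the hypothesis imply this: \<open>\<alpha> > 1 / 2\<close> because \<open>p > 4\<close>, and
\<open>\<alpha>' * p > 2\<close> because \<open>\<alpha> \<ge> \<alpha>'\<close>.\<close>

section \<open>Bounds on norms of order q\<close>

text \<open>Norm bounds are handled as a predicate: it includes measurability, and as the integral is the
nonnegative one, no integrability has to be checked before a bound is stated.\<close>

definition Lq_le :: "'b measure \<Rightarrow> real \<Rightarrow> ('b \<Rightarrow> real) \<Rightarrow> real \<Rightarrow> bool" where
  "Lq_le \<mu> q f A \<longleftrightarrow> f \<in> borel_measurable \<mu> \<and> 0 \<le> A \<and>
     (\<integral>\<^sup>+x. ennreal (\<bar>f x\<bar> powr q) \<partial>\<mu>) \<le> ennreal (A powr q)"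

lemma Lq_le_mono:
  assumes "Lq_le \<mu> q f A" "A \<le> B" "0 \<le> q"
  shows "Lq_le \<mu> q f B"
proof -
  have "A powr q \<le> B powr q" using assms by (intro powr_mono2) (auto simp: Lq_le_def)
  then show ?thesis using assms unfolding Lq_le_def
    by (auto intro: order_trans ennreal_leI)
qed

text \<open>Allows to assume that bounds are positive, so that functions can be normalised by them.\<close>

lemma Lq_le_limit:
  assumes "\<And>e. 0 < e \<Longrightarrow> Lq_le \<mu> q f (A + e)" "0 \<le> A" "0 < q"
  shows "Lq_le \<mu> q f A"
proof -
  have "((\<lambda>e. ennreal ((A + e) powr q)) \<longlongrightarrow> ennreal ((A + 0) powr q)) (at_right 0)"
    using assms by (intro tendsto_ennrealI tendsto_intros tendsto_powr2)
      (auto simp: eventually_at_right_less intro!: eventually_at_rightI[of 0 1])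
  moreover have "eventually (\<lambda>e. (\<integral>\<^sup>+x. ennreal (\<bar>f x\<bar> powr q) \<partial>\<mu>) \<le> ennreal ((A + e) powr q)) (at_right 0)"
    using assms(1) by (intro eventually_at_rightI[of 0 1]) (auto simp: Lq_le_def)
  ultimately have "(\<integral>\<^sup>+x. ennreal (\<bar>f x\<bar> powr q) \<partial>\<mu>) \<le> ennreal ((A + 0) powr q)"
    by (intro tendsto_lowerbound) auto
  then show ?thesis using assms(1)[of 1] assms(2) by (auto simp: Lq_le_def)
qed

lemma nn_integral_le_combination:
  fixes F G h :: "'b \<Rightarrow> real"
  assumes [measurable]: "F \<in> borel_measurable \<mu>" "G \<in> borel_measurable \<mu>"
    and F: "\<And>x. 0 \<le> F x" "(\<integral>\<^sup>+x. ennreal (F x) \<partial>\<mu>) \<le> ennreal a"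
    and G: "\<And>x. 0 \<le> G x" "(\<integral>\<^sup>+x. ennreal (G x) \<partial>\<mu>) \<le> ennreal b"
    and c: "0 \<le> c" "0 \<le> d" "0 \<le> a" "0 \<le> b"
    and h: "\<And>x. h x \<le> c * F x + d * G x"
  shows "(\<integral>\<^sup>+x. ennreal (h x) \<partial>\<mu>) \<le> ennreal (c * a + d * b)"
proof -
  have "(\<integral>\<^sup>+x. ennreal (h x) \<partial>\<mu>) \<le> (\<integral>\<^sup>+x. ennreal c * ennreal (F x) + ennreal d * ennreal (G x) \<partial>\<mu>)"
    using c F(1) G(1) h
    by (intro nn_integral_mono) (simp add: ennreal_mult[symmetric] ennreal_plus[symmetric] ennreal_leI del: ennreal_plus)
  also have "\<dots> = ennreal c * (\<integral>\<^sup>+x. ennreal (F x) \<partial>\<mu>) + ennreal d * (\<integral>\<^sup>+x. ennreal (G x) \<partial>\<mu>)"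
    by (simp add: nn_integral_add nn_integral_cmult)
  also have "\<dots> \<le> ennreal c * ennreal a + ennreal d * ennreal b"
    using F G by (intro add_mono mult_left_mono) auto
  also have "\<dots> = ennreal (c * a + d * b)"
    using c by (simp add: ennreal_mult ennreal_plus)
  finally show ?thesis .
qed

lemma powr_convex_combination:
  fixes x y t q :: real
  assumes "0 \<le> x" "0 \<le> y" "0 \<le> t" "t \<le> 1" "1 \<le> q"
  shows "(t * x + (1 - t) * y) powr q \<le> t * x powr q + (1 - t) * y powr q"
proof -
  have *: "(s * z) powr q \<le> s * z powr q" if "0 \<le> s" "s \<le> 1" "0 \<le> z" for s z :: real
  proof -
    have "s powr q \<le> s" using powr_mono'[of 1 q s] that assms by simp
    then show ?thesis using that by (simp add: powr_mult mult_right_mono)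
  qed
  consider "x = 0" | "y = 0" | "x > 0" "y > 0" using assms by linarith
  then show ?thesis
  proof cases
    case 3
    then show ?thesis
      using convex_onD[OF powr_convex[OF assms(5)], of "1 - t" x y] assms by simp
  qed (use *[of "1 - t" y] *[of t x] assms in auto)
qed

lemma Young_powr:
  fixes x y \<theta> :: real
  assumes "0 \<le> x" "0 \<le> y" "0 < \<theta>" "\<theta> < 1"
  shows "x powr \<theta> * y powr (1 - \<theta>) \<le> \<theta> * x + (1 - \<theta>) * y"
proof (cases "x = 0 \<or> y = 0")
  case False
  then show ?thesis using assms by (intro Youngs_inequality_0) auto
qed (use assms in auto)

text \<open>Minkowski's inequality: after normalisation both functions enter through one convex combination.\<close>

lemma Lq_le_add:
  assumes f: "Lq_le \<mu> q f A" and g: "Lq_le \<mu> q g B" and q: "1 \<le> q"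
  shows "Lq_le \<mu> q (\<lambda>x. f x + g x) (A + B)"
proof (rule Lq_le_limit)
  fix e :: real assume e: "0 < e"
  define a b where "a = A + e / 2" and "b = B + e / 2"
  have ab: "a > 0" "b > 0" using e f g by (auto simp: a_def b_def Lq_le_def)
  note f' = Lq_le_mono[OF f, of a] and g' = Lq_le_mono[OF g, of b]
  define t where "t = a / (a + b)"
  have t: "0 \<le> t" "t \<le> 1" "1 - t = b / (a + b)" using ab by (auto simp: t_def field_simps)
  have [measurable]: "f \<in> borel_measurable \<mu>" "g \<in> borel_measurable \<mu>"
    using f g by (auto simp: Lq_le_def)
  have key: "\<bar>f x + g x\<bar> powr q \<le>
     ((a + b) powr q * t / a powr q) * \<bar>f x\<bar> powr q + ((a + b) powr q * (1 - t) / b powr q) * \<bar>g x\<bar> powr q" for x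
  proof -
    have eq: "\<bar>f x\<bar> + \<bar>g x\<bar> = (a + b) * (t * (\<bar>f x\<bar> / a) + (1 - t) * (\<bar>g x\<bar> / b))"
    proof -
      have "t * (\<bar>f x\<bar> / a) = \<bar>f x\<bar> / (a + b)" "(1 - t) * (\<bar>g x\<bar> / b) = \<bar>g x\<bar> / (a + b)"
        using ab unfolding t(3) by (simp_all add: t_def)
      then show ?thesis using ab by (simp add: distrib_left)
    qed
    have "\<bar>f x + g x\<bar> powr q \<le> (\<bar>f x\<bar> + \<bar>g x\<bar>) powr q"
      using q by (intro powr_mono2) auto
    also have "\<dots> = (a + b) powr q * (t * (\<bar>f x\<bar> / a) + (1 - t) * (\<bar>g x\<bar> / b)) powr q"
      unfolding eq using ab t by (intro powr_mult)
    also have "\<dots> \<le> (a + b) powr q * (t * (\<bar>f x\<bar> / a) powr q + (1 - t) * (\<bar>g x\<bar> / b) powr q)"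
      using ab t q by (intro mult_left_mono powr_convex_combination) auto
    also have "\<dots> = ((a + b) powr q * t / a powr q) * \<bar>f x\<bar> powr q + ((a + b) powr q * (1 - t) / b powr q) * \<bar>g x\<bar> powr q"
      using ab by (simp add: powr_divide field_simps)
    finally show ?thesis .
  qed
  have "(\<integral>\<^sup>+x. ennreal (\<bar>f x + g x\<bar> powr q) \<partial>\<mu>) \<le>
     ennreal (((a + b) powr q * t / a powr q) * a powr q + ((a + b) powr q * (1 - t) / b powr q) * b powr q)"
    using f' g' q e ab t key
    by (intro nn_integral_le_combination[of "\<lambda>x. \<bar>f x\<bar> powr q" \<mu> "\<lambda>x. \<bar>g x\<bar> powr q"])
       (auto simp: a_def b_def Lq_le_def)
  also have "((a + b) powr q * t / a powr q) * a powr q + ((a + b) powr q * (1 - t) / b powr q) * b powr q = (a + b) powr q"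
    using ab by (simp add: field_simps)
  also have "a + b = A + B + e" by (simp add: a_def b_def)
  finally show "Lq_le \<mu> q (\<lambda>x. f x + g x) (A + B + e)"
    using e f g by (auto simp: Lq_le_def)
qed (use f g q in \<open>auto simp: Lq_le_def\<close>)

lemma Lq_le_uminus: "Lq_le \<mu> q f A \<Longrightarrow> Lq_le \<mu> q (\<lambda>x. - f x) A"
  by (auto simp: Lq_le_def)

lemma Lq_le_diff:
  assumes "Lq_le \<mu> q f A" "Lq_le \<mu> q g B" "1 \<le> q"
  shows "Lq_le \<mu> q (\<lambda>x. f x - g x) (A + B)"
  using Lq_le_add[OF assms(1) Lq_le_uminus[OF assms(2)] assms(3)] by simp

lemma Lq_le_sum:
  assumes "\<And>i. i \<in> I \<Longrightarrow> Lq_le \<mu> q (f i) (A i)" "1 \<le> q"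
  shows "Lq_le \<mu> q (\<lambda>x. \<Sum>i\<in>I. f i x) (\<Sum>i\<in>I. A i)"
proof -
  have zero: "Lq_le \<mu> q (\<lambda>x. 0) 0" using assms(2) by (simp add: Lq_le_def)
  show ?thesis
  proof (cases "finite I")
    case True
    then show ?thesis using assms
      by (induction I rule: finite_induct) (auto intro: zero Lq_le_add)
  qed (simp add: zero)
qed

text \<open>The Cauchy-Schwarz inequality, as the arithmetic-geometric mean inequality for the normalised
functions.\<close>

lemma Lq_le_mult:
  assumes f: "Lq_le \<mu> (2 * q) f A" and g: "Lq_le \<mu> (2 * q) g B" and q: "0 < q"
  shows "Lq_le \<mu> q (\<lambda>x. f x * g x) (A * B)"
proof -
  have [measurable]: "f \<in> borel_measurable \<mu>" "g \<in> borel_measurable \<mu>"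
    using f g by (auto simp: Lq_le_def)
  have *: "(\<integral>\<^sup>+x. ennreal (\<bar>f x * g x\<bar> powr q) \<partial>\<mu>) \<le> ennreal ((a * b) powr q)"
    if a: "A < a" and b: "B < b" for a b
  proof -
    have ab: "a > 0" "b > 0" using a b f g by (auto simp: Lq_le_def)
    note f' = Lq_le_mono[OF f, of a] and g' = Lq_le_mono[OF g, of b]
    have key: "\<bar>f x * g x\<bar> powr q \<le>
      ((a * b) powr q / (2 * a powr (2 * q))) * \<bar>f x\<bar> powr (2 * q) + ((a * b) powr q / (2 * b powr (2 * q))) * \<bar>g x\<bar> powr (2 * q)" for x
    proof -
      define u v where "u = (\<bar>f x\<bar> / a) powr q" and "v = (\<bar>g x\<bar> / b) powr q"
      have uv: "u * v \<le> (u\<^sup>2 + v\<^sup>2) / 2" using sum_squares_bound[of u v] by simp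
      have sq: "u\<^sup>2 = \<bar>f x\<bar> powr (2 * q) / a powr (2 * q)" "v\<^sup>2 = \<bar>g x\<bar> powr (2 * q) / b powr (2 * q)"
        using ab by (auto simp: u_def v_def powr_divide powr_power powr_realpow[symmetric] powr_powr power2_eq_square powr_add[symmetric])
      have "\<bar>f x * g x\<bar> powr q = (a * b) powr q * (u * v)"
        using ab by (simp add: u_def v_def powr_mult powr_divide abs_mult)
      also have "\<dots> \<le> (a * b) powr q * ((u\<^sup>2 + v\<^sup>2) / 2)"
        using uv by (intro mult_left_mono) auto
      finally show ?thesis unfolding sq by (simp add: field_simps)
    qed
    have "(\<integral>\<^sup>+x. ennreal (\<bar>f x * g x\<bar> powr q) \<partial>\<mu>) \<le>
       ennreal (((a * b) powr q / (2 * a powr (2 * q))) * a powr (2 * q) + ((a * b) powr q / (2 * b powr (2 * q))) * b powr (2 * q))"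
      using f' g' q a b ab key
      by (intro nn_integral_le_combination[of "\<lambda>x. \<bar>f x\<bar> powr (2 * q)" \<mu> "\<lambda>x. \<bar>g x\<bar> powr (2 * q)"])
         (auto simp: Lq_le_def)
    also have "((a * b) powr q / (2 * a powr (2 * q))) * a powr (2 * q) + ((a * b) powr q / (2 * b powr (2 * q))) * b powr (2 * q) = (a * b) powr q"
      using ab by (simp add: field_simps)
    finally show ?thesis .
  qed
  have nn: "0 \<le> A" "0 \<le> B" using f g by (auto simp: Lq_le_def)
  have "((\<lambda>e. ennreal (((A + e) * (B + e)) powr q)) \<longlongrightarrow> ennreal (((A + 0) * (B + 0)) powr q)) (at_right 0)"
    using q nn by (intro tendsto_ennrealI tendsto_intros tendsto_powr2)
      (auto simp: eventually_at_right_less intro!: eventually_at_rightI[of 0 1])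
  moreover have "eventually (\<lambda>e. (\<integral>\<^sup>+x. ennreal (\<bar>f x * g x\<bar> powr q) \<partial>\<mu>) \<le> ennreal (((A + e) * (B + e)) powr q)) (at_right 0)"
    using * by (intro eventually_at_rightI[of 0 1]) auto
  ultimately have "(\<integral>\<^sup>+x. ennreal (\<bar>f x * g x\<bar> powr q) \<partial>\<mu>) \<le> ennreal (((A + 0) * (B + 0)) powr q)"
    by (intro tendsto_lowerbound) auto
  then show ?thesis using nn by (auto simp: Lq_le_def)
qed

text \<open>Lyapunov's inequality, as Young's inequality against the constant function 1.\<close>

lemma Lq_le_exponent:
  assumes "prob_space \<mu>" and f: "Lq_le \<mu> p f A" and q: "0 < q" "q \<le> p"
  shows "Lq_le \<mu> q f A"
proof (cases "q = p")
  case False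
  then have qp: "0 < q / p" "q / p < 1" "0 < p" using q by auto
  interpret prob_space \<mu> by fact
  have [measurable]: "f \<in> borel_measurable \<mu>" using f by (auto simp: Lq_le_def)
  show ?thesis
  proof (rule Lq_le_limit)
    fix e :: real assume e: "0 < e"
    define a where "a = A + e"
    have a: "a > 0" using e f by (auto simp: a_def Lq_le_def)
    have f': "Lq_le \<mu> p f a" by (rule Lq_le_mono[OF f]) (use e q in \<open>auto simp: a_def\<close>)
    have key: "\<bar>f x\<bar> powr q \<le> (a powr q * (q / p) / a powr p) * \<bar>f x\<bar> powr p + (a powr q * (1 - q / p)) * 1" for x
    proof -
      have "((\<bar>f x\<bar> / a) powr p) powr (q / p) * 1 powr (1 - q / p) \<le> (q / p) * (\<bar>f x\<bar> / a) powr p + (1 - q / p) * 1"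
        using a qp by (intro Young_powr) auto
      also have "((\<bar>f x\<bar> / a) powr p) powr (q / p) = \<bar>f x\<bar> powr q / a powr q"
        using a q by (simp add: powr_powr powr_divide)
      finally have "\<bar>f x\<bar> powr q / a powr q \<le> (q / p) * (\<bar>f x\<bar> / a) powr p + (1 - q / p) * 1" by simp
      then have "\<bar>f x\<bar> powr q \<le> a powr q * ((q / p) * (\<bar>f x\<bar> / a) powr p + (1 - q / p) * 1)"
        using a by (simp add: field_simps)
      then show ?thesis using a by (simp add: powr_divide field_simps)
    qed
    have "(\<integral>\<^sup>+x. ennreal (\<bar>f x\<bar> powr q) \<partial>\<mu>) \<le> ennreal ((a powr q * (q / p) / a powr p) * a powr p + (a powr q * (1 - q / p)) * 1)"
      using f' qp a key
      by (intro nn_integral_le_combination[of "\<lambda>x. \<bar>f x\<bar> powr p" \<mu> "\<lambda>x. 1"])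
         (use q in \<open>auto simp: Lq_le_def emeasure_space_1 intro!: divide_nonneg_nonneg mult_nonneg_nonneg\<close>)
    also have "(a powr q * (q / p) / a powr p) * a powr p + (a powr q * (1 - q / p)) * 1 = a powr q"
      using a by (simp add: field_simps)
    finally show "Lq_le \<mu> q f (A + e)" using e f by (auto simp: Lq_le_def a_def)
  qed (use f q in \<open>auto simp: Lq_le_def\<close>)
qed (use f in simp)

lemma Lq_le_integrable:
  assumes "prob_space \<mu>" and f: "Lq_le \<mu> p f A" and "1 \<le> p"
  shows "integrable \<mu> f" "(\<integral>x. \<bar>f x\<bar> \<partial>\<mu>) \<le> A"
proof -
  have 1: "Lq_le \<mu> 1 f A" by (rule Lq_le_exponent) (use assms in auto)
  then have b: "(\<integral>\<^sup>+x. ennreal (norm (f x)) \<partial>\<mu>) \<le> ennreal A" and [measurable]: "f \<in> borel_measurable \<mu>"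
    and A: "0 \<le> A"
    by (auto simp: Lq_le_def)
  show i: "integrable \<mu> f"
    using b by (intro integrableI_bounded) (auto intro: order.strict_trans1 simp: ennreal_less_top)
  have "ennreal (\<integral>x. \<bar>f x\<bar> \<partial>\<mu>) = (\<integral>\<^sup>+x. ennreal \<bar>f x\<bar> \<partial>\<mu>)"
    using i by (intro nn_integral_eq_integral[symmetric]) auto
  with b have "ennreal (\<integral>x. \<bar>f x\<bar> \<partial>\<mu>) \<le> ennreal A" by simp
  then show "(\<integral>x. \<bar>f x\<bar> \<partial>\<mu>) \<le> A" using A ennreal_le_iff by blast
qed

lemma Lq_le_AE_cong:
  assumes "Lq_le \<mu> q f A" "AE x in \<mu>. f x = g x" "g \<in> borel_measurable \<mu>"
  shows "Lq_le \<mu> q g A"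
proof -
  have "(\<integral>\<^sup>+x. ennreal (\<bar>g x\<bar> powr q) \<partial>\<mu>) = (\<integral>\<^sup>+x. ennreal (\<bar>f x\<bar> powr q) \<partial>\<mu>)"
    by (intro nn_integral_cong_AE) (use assms(2) in eventually_elim, simp)
  then show ?thesis using assms by (simp add: Lq_le_def)
qed

lemma Lq_le_distr:
  assumes T: "T \<in> measurable \<mu> \<nu>" "distr \<mu> \<nu> T = \<nu>" and f: "Lq_le \<nu> q f A"
  shows "Lq_le \<mu> q (\<lambda>x. f (T x)) A"
proof -
  have [measurable]: "f \<in> borel_measurable \<nu>" using f by (simp add: Lq_le_def)
  have "(\<integral>\<^sup>+x. ennreal (\<bar>f (T x)\<bar> powr q) \<partial>\<mu>) = (\<integral>\<^sup>+x. ennreal (\<bar>f x\<bar> powr q) \<partial>distr \<mu> \<nu> T)"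
    using T(1) by (subst nn_integral_distr) auto
  then show ?thesis using T f by (auto simp: Lq_le_def)
qed

text \<open>Jensen's inequality for a partial integral; the bound also covers the points where the inner
integral does not exist and is 0 by convention.\<close>

lemma Lq_le_integral_snd:
  assumes "prob_space \<nu>" "sigma_finite_measure \<mu>" and f: "Lq_le (\<mu> \<Otimes>\<^sub>M \<nu>) q (\<lambda>(x, y). f x y) A" and q: "1 \<le> q"
  shows "Lq_le \<mu> q (\<lambda>x. \<integral>y. f x y \<partial>\<nu>) A"
proof -
  interpret prob_space \<nu> by fact
  interpret pair_sigma_finite \<mu> \<nu> using assms(2) by (simp add: pair_sigma_finite_def sigma_finite_measure_axioms)
  have m[measurable]: "(\<lambda>(x, y). f x y) \<in> borel_measurable (\<mu> \<Otimes>\<^sub>M \<nu>)" using f by (simp add: Lq_le_def)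
  have "(\<lambda>x. \<integral>y. f x y \<partial>\<nu>) \<in> borel_measurable \<mu>" by measurable
  have J: "ennreal (\<bar>\<integral>y. f x y \<partial>\<nu>\<bar> powr q) \<le> (\<integral>\<^sup>+y. ennreal (\<bar>f x y\<bar> powr q) \<partial>\<nu>)" if x: "x \<in> space \<mu>" for x
  proof (cases "(\<integral>\<^sup>+y. ennreal (\<bar>f x y\<bar> powr q) \<partial>\<nu>) = \<infinity>")
    case False
    then obtain B where B: "0 \<le> B" "(\<integral>\<^sup>+y. ennreal (\<bar>f x y\<bar> powr q) \<partial>\<nu>) = ennreal B"
      by (auto elim: ennreal_cases)
    have [measurable]: "f x \<in> borel_measurable \<nu>" using measurable_Pair2[OF m x] by simp
    define b where "b = B powr (1 / q)"
    have b: "b powr q = B" using B q by (simp add: b_def powr_powr)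
    have L: "Lq_le \<nu> q (f x) b" using B b by (simp add: Lq_le_def) (simp add: b_def)
    have "\<bar>\<integral>y. f x y \<partial>\<nu>\<bar> \<le> (\<integral>y. \<bar>f x y\<bar> \<partial>\<nu>)" by (rule integral_abs_bound)
    also have "\<dots> \<le> b" by (rule Lq_le_integrable(2)) (use L q prob_space_axioms in auto)
    finally have "\<bar>\<integral>y. f x y \<partial>\<nu>\<bar> powr q \<le> b powr q" using q by (intro powr_mono2) auto
    then show ?thesis using B b by (simp add: ennreal_leI)
  qed simp
  have "(\<integral>\<^sup>+x. ennreal (\<bar>\<integral>y. f x y \<partial>\<nu>\<bar> powr q) \<partial>\<mu>) \<le> (\<integral>\<^sup>+x. \<integral>\<^sup>+y. ennreal (\<bar>f x y\<bar> powr q) \<partial>\<nu> \<partial>\<mu>)"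
    by (intro nn_integral_mono J)
  also have "\<dots> = (\<integral>\<^sup>+z. ennreal (\<bar>case z of (x, y) \<Rightarrow> f x y\<bar> powr q) \<partial>(\<mu> \<Otimes>\<^sub>M \<nu>))"
    using sigma_finite_measure.nn_integral_fst[OF prob_space_imp_sigma_finite[OF \<open>prob_space \<nu>\<close>], of "\<lambda>z. ennreal (\<bar>case z of (x, y) \<Rightarrow> f x y\<bar> powr q)" \<mu>] by simp
  finally show ?thesis using f \<open>(\<lambda>x. \<integral>y. f x y \<partial>\<nu>) \<in> borel_measurable \<mu>\<close> by (auto simp: Lq_le_def)
qed

text \<open>Fatou's lemma along an almost surely convergent subsequence: a uniform norm bound survives
approximation in the mean.\<close>

lemma Lq_le_L1_limit:
  assumes f: "f \<in> borel_measurable \<mu>" and g: "\<And>n. Lq_le \<mu> q (g n) A"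
    and int: "\<And>n. integrable \<mu> (\<lambda>x. f x - g n x)"
    and lim: "(\<lambda>n. \<integral>x. \<bar>f x - g n x\<bar> \<partial>\<mu>) \<longlonglongrightarrow> 0" and q: "0 < q"
  shows "Lq_le \<mu> q f A"
proof -
  have m[measurable]: "f \<in> borel_measurable \<mu>" "\<And>n. g n \<in> borel_measurable \<mu>"
    using f g by (auto simp: Lq_le_def)
  have "\<exists>r::nat\<Rightarrow>nat. strict_mono r \<and> (AE x in \<mu>. (\<lambda>n. f x - g (r n) x) \<longlonglongrightarrow> 0)"
    using tendsto_L1_AE_subseq[of \<mu> "\<lambda>n x. f x - g n x"] int lim by auto
  then obtain r :: "nat \<Rightarrow> nat" where r: "AE x in \<mu>. (\<lambda>n. f x - g (r n) x) \<longlonglongrightarrow> 0" by blast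
  have "(\<integral>\<^sup>+x. ennreal (\<bar>f x\<bar> powr q) \<partial>\<mu>) = (\<integral>\<^sup>+x. liminf (\<lambda>n. ennreal (\<bar>g (r n) x\<bar> powr q)) \<partial>\<mu>)"
  proof (rule nn_integral_cong_AE, use r in eventually_elim)
    fix x assume "(\<lambda>n. f x - g (r n) x) \<longlonglongrightarrow> 0"
    from tendsto_diff[OF tendsto_const this, of "f x"] have "(\<lambda>n. g (r n) x) \<longlonglongrightarrow> f x" by simp
    then have "(\<lambda>n. ennreal (\<bar>g (r n) x\<bar> powr q)) \<longlonglongrightarrow> ennreal (\<bar>f x\<bar> powr q)"
      using q by (intro tendsto_ennrealI tendsto_powr2 tendsto_rabs tendsto_const) auto
    then show "ennreal (\<bar>f x\<bar> powr q) = liminf (\<lambda>n. ennreal (\<bar>g (r n) x\<bar> powr q))"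
      using lim_imp_Liminf[OF sequentially_bot, symmetric] by blast
  qed
  also have "\<dots> \<le> liminf (\<lambda>n. \<integral>\<^sup>+x. ennreal (\<bar>g (r n) x\<bar> powr q) \<partial>\<mu>)"
    by (rule nn_integral_liminf) auto
  also have "\<dots> \<le> ennreal (A powr q)"
    using g by (intro Liminf_le) (auto simp: Lq_le_def)
  finally show ?thesis using g[of 0] by (auto simp: Lq_le_def)
qed

lemma Lq_le_iff_integral:
  assumes [measurable]: "f \<in> borel_measurable \<mu>" and A: "0 \<le> A"
  shows "Lq_le \<mu> q f A \<longleftrightarrow> integrable \<mu> (\<lambda>x. \<bar>f x\<bar> powr q) \<and> (\<integral>x. \<bar>f x\<bar> powr q \<partial>\<mu>) \<le> A powr q"
proof
  assume L: "Lq_le \<mu> q f A"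
  then have b: "(\<integral>\<^sup>+x. ennreal (\<bar>f x\<bar> powr q) \<partial>\<mu>) \<le> ennreal (A powr q)" by (simp add: Lq_le_def)
  have i: "integrable \<mu> (\<lambda>x. \<bar>f x\<bar> powr q)"
    using b by (intro integrableI_bounded) (auto intro: order.strict_trans1 simp: ennreal_less_top)
  then have "ennreal (\<integral>x. \<bar>f x\<bar> powr q \<partial>\<mu>) = (\<integral>\<^sup>+x. ennreal (\<bar>f x\<bar> powr q) \<partial>\<mu>)"
    by (intro nn_integral_eq_integral[symmetric]) auto
  with b have "ennreal (\<integral>x. \<bar>f x\<bar> powr q \<partial>\<mu>) \<le> ennreal (A powr q)" by simp
  then have "(\<integral>x. \<bar>f x\<bar> powr q \<partial>\<mu>) \<le> A powr q" by (subst (asm) ennreal_le_iff) auto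
  with i show "integrable \<mu> (\<lambda>x. \<bar>f x\<bar> powr q) \<and> (\<integral>x. \<bar>f x\<bar> powr q \<partial>\<mu>) \<le> A powr q" by simp
next
  assume *: "integrable \<mu> (\<lambda>x. \<bar>f x\<bar> powr q) \<and> (\<integral>x. \<bar>f x\<bar> powr q \<partial>\<mu>) \<le> A powr q"
  then have "(\<integral>\<^sup>+x. ennreal (\<bar>f x\<bar> powr q) \<partial>\<mu>) = ennreal (\<integral>x. \<bar>f x\<bar> powr q \<partial>\<mu>)"
    by (intro nn_integral_eq_integral) auto
  with * A show "Lq_le \<mu> q f A" by (auto simp: Lq_le_def ennreal_leI)
qed

lemma Lq_le_integrable_powr:
  assumes "Lq_le \<mu> q f A"
  shows "integrable \<mu> (\<lambda>x. \<bar>f x\<bar> powr q)"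
proof -
  have m: "f \<in> borel_measurable \<mu>" "0 \<le> A" using assms by (auto simp: Lq_le_def)
  show ?thesis using assms unfolding Lq_le_iff_integral[OF m] by blast
qed

lemma Lq_le_Lp_norm:
  assumes "f \<in> borel_measurable \<mu>" "integrable \<mu> (\<lambda>x. \<bar>f x\<bar> powr q)" "0 < q"
  shows "Lq_le \<mu> q f (Lp_norm \<mu> q f)"
  using assms by (simp add: Lq_le_iff_integral Lp_norm_def powr_powr)

lemma Lp_norm_le:
  assumes "Lq_le \<mu> q f B" "0 < q"
  shows "Lp_norm \<mu> q f \<le> B"
proof -
  have m: "f \<in> borel_measurable \<mu>" "0 \<le> B" using assms by (auto simp: Lq_le_def)
  have "(\<integral>x. \<bar>f x\<bar> powr q \<partial>\<mu>) \<le> B powr q" using assms Lq_le_iff_integral[OF m] by simp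
  then have "(\<integral>x. \<bar>f x\<bar> powr q \<partial>\<mu>) powr (1 / q) \<le> (B powr q) powr (1 / q)"
    using assms(2) by (intro powr_mono2) auto
  then show ?thesis using m assms(2) by (simp add: Lp_norm_def powr_powr)
qed

lemma Lq_le_Markov:
  assumes "prob_space \<mu>" and f: "Lq_le \<mu> q f A" and y: "0 < y" and q: "0 < q"
  shows "measure \<mu> {x \<in> space \<mu>. y \<le> \<bar>f x\<bar>} \<le> (A / y) powr q"
proof -
  interpret prob_space \<mu> by fact
  have [measurable]: "f \<in> borel_measurable \<mu>" and A: "0 \<le> A" using f by (auto simp: Lq_le_def)
  let ?E = "{x \<in> space \<mu>. y \<le> \<bar>f x\<bar>}"
  have "emeasure \<mu> ?E = (\<integral>\<^sup>+x. indicator ?E x \<partial>\<mu>)" by simp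
  also have "\<dots> \<le> (\<integral>\<^sup>+x. ennreal (1 / y powr q) * ennreal (\<bar>f x\<bar> powr q) \<partial>\<mu>)"
  proof (rule nn_integral_mono)
    fix x
    show "indicator ?E x \<le> ennreal (1 / y powr q) * ennreal (\<bar>f x\<bar> powr q)"
    proof (cases "x \<in> ?E")
      case True
      then have "y powr q \<le> \<bar>f x\<bar> powr q" using y q by (intro powr_mono2) auto
      then have "1 \<le> 1 / y powr q * \<bar>f x\<bar> powr q" using y by (simp add: field_simps)
      then have "ennreal 1 \<le> ennreal (1 / y powr q * \<bar>f x\<bar> powr q)" by (rule ennreal_leI)
      with True show ?thesis by (simp add: ennreal_mult'[symmetric])
    qed simp
  qed
  also have "\<dots> = ennreal (1 / y powr q) * (\<integral>\<^sup>+x. ennreal (\<bar>f x\<bar> powr q) \<partial>\<mu>)" by (rule nn_integral_cmult) measurable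
  also have "\<dots> \<le> ennreal (1 / y powr q) * ennreal (A powr q)"
    using f by (intro mult_left_mono) (auto simp: Lq_le_def)
  also have "\<dots> = ennreal ((A / y) powr q)" using A y by (simp add: ennreal_mult'[symmetric] powr_divide)
  finally show ?thesis by (simp add: emeasure_eq_measure)
qed

lemma Lq_le_0_AE:
  assumes "Lq_le \<mu> q f 0" "0 < q"
  shows "AE x in \<mu>. f x = 0"
proof -
  have [measurable]: "f \<in> borel_measurable \<mu>" using assms by (simp add: Lq_le_def)
  have "(\<integral>\<^sup>+x. ennreal (\<bar>f x\<bar> powr q) \<partial>\<mu>) = 0" using assms by (simp add: Lq_le_def)
  then have "AE x in \<mu>. ennreal (\<bar>f x\<bar> powr q) = 0" by (subst (asm) nn_integral_0_iff_AE) auto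
  then show ?thesis by eventually_elim simp
qed

lemma abs_powr_4: "\<bar>x\<bar> powr 4 = (x :: real) ^ 4"
  by (cases "x = 0") (simp_all add: powr_numeral power_even_abs)

lemma Lq_le_4:
  assumes "Lq_le \<mu> 4 f A"
  shows "integrable \<mu> (\<lambda>x. f x ^ 4)" "(\<integral>x. f x ^ 4 \<partial>\<mu>) \<le> A ^ 4"
proof -
  have m: "f \<in> borel_measurable \<mu>" "0 \<le> A" using assms by (auto simp: Lq_le_def)
  have A: "A powr 4 = A ^ 4" using m by (cases "A = 0") (simp_all add: powr_numeral)
  from assms[unfolded Lq_le_iff_integral[OF m]]
  show "integrable \<mu> (\<lambda>x. f x ^ 4)" "(\<integral>x. f x ^ 4 \<partial>\<mu>) \<le> A ^ 4"
    by (simp_all add: abs_powr_4 A)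
qed

section \<open>Convergence of functionals on integrable functions\<close>

lemma tendsto_0_squeeze:
  fixes f g :: "nat \<Rightarrow> real"
  assumes "\<And>n. 0 \<le> f n" "\<And>n. f n \<le> g n" "g \<longlonglongrightarrow> 0"
  shows "f \<longlonglongrightarrow> 0"
  by (rule tendsto_sandwich[OF _ _ tendsto_const assms(3)]) (use assms in auto)

text \<open>The distance to the mean of a conditional expectation given the remote past, and of a time average,
are both subadditive and dominated by the mean of the absolute value. For such functionals vanishing is
closed under limits in the mean, so it only has to be checked on indicators.\<close>

lemma L1_limit_vanishing:
  fixes D :: "('b \<Rightarrow> real) \<Rightarrow> nat \<Rightarrow> real"
  assumes f: "integrable \<mu> f" and s: "\<And>i. integrable \<mu> (s i)" "\<And>i. (\<lambda>r. D (s i) r) \<longlonglongrightarrow> 0"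
    and lim: "(\<lambda>i. \<integral>x. \<bar>f x - s i x\<bar> \<partial>\<mu>) \<longlonglongrightarrow> 0"
    and add: "\<And>h1 h2 r. integrable \<mu> h1 \<Longrightarrow> integrable \<mu> h2 \<Longrightarrow> D (\<lambda>x. h1 x + h2 x) r \<le> D h1 r + D h2 r"
    and nonneg: "\<And>h r. 0 \<le> D h r"
    and bound: "\<And>h r. integrable \<mu> h \<Longrightarrow> D h r \<le> C * (\<integral>x. \<bar>h x\<bar> \<partial>\<mu>)"
  shows "(\<lambda>r. D f r) \<longlonglongrightarrow> 0"
proof (rule LIMSEQ_I)
  fix \<epsilon> :: real assume \<epsilon>: "0 < \<epsilon>"
  have "(\<lambda>i. C * (\<integral>x. \<bar>f x - s i x\<bar> \<partial>\<mu>)) \<longlonglongrightarrow> C * 0" by (rule tendsto_mult[OF tendsto_const lim])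
  then have "eventually (\<lambda>i. C * (\<integral>x. \<bar>f x - s i x\<bar> \<partial>\<mu>) < \<epsilon> / 2) sequentially"
    using \<epsilon> by (intro order_tendstoD) auto
  then obtain i where i: "C * (\<integral>x. \<bar>f x - s i x\<bar> \<partial>\<mu>) < \<epsilon> / 2"
    by (auto simp: eventually_sequentially)
  have "eventually (\<lambda>r. D (s i) r < \<epsilon> / 2) sequentially"
    using s(2)[of i] \<epsilon> by (intro order_tendstoD) auto
  then obtain R where R: "\<And>r. r \<ge> R \<Longrightarrow> D (s i) r < \<epsilon> / 2" by (auto simp: eventually_sequentially)
  have "norm (D f r - 0) < \<epsilon>" if "r \<ge> R" for r
  proof -
    have "D f r \<le> D (s i) r + D (\<lambda>x. f x - s i x) r"
      using add[of "s i" "\<lambda>x. f x - s i x"] s f by simp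
    also have "D (\<lambda>x. f x - s i x) r \<le> C * (\<integral>x. \<bar>f x - s i x\<bar> \<partial>\<mu>)" using s f by (intro bound) auto
    finally show ?thesis using i R[OF that] nonneg[of f r] by simp
  qed
  then show "\<exists>no. \<forall>r\<ge>no. norm (D f r - 0) < \<epsilon>" by blast
qed

lemma L1_density_principle:
  fixes D :: "('b \<Rightarrow> real) \<Rightarrow> nat \<Rightarrow> real"
  assumes "integrable \<mu> h"
    and add: "\<And>h1 h2 r. integrable \<mu> h1 \<Longrightarrow> integrable \<mu> h2 \<Longrightarrow> D (\<lambda>x. h1 x + h2 x) r \<le> D h1 r + D h2 r"
    and nonneg: "\<And>h r. 0 \<le> D h r"
    and bound: "\<And>h r. integrable \<mu> h \<Longrightarrow> D h r \<le> C * (\<integral>x. \<bar>h x\<bar> \<partial>\<mu>)"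
    and ind: "\<And>A c. A \<in> sets \<mu> \<Longrightarrow> emeasure \<mu> A < \<infinity> \<Longrightarrow> (\<lambda>r. D (\<lambda>x. indicator A x * c) r) \<longlonglongrightarrow> 0"
  shows "(\<lambda>r. D h r) \<longlonglongrightarrow> 0"
proof -
  show ?thesis
    using \<open>integrable \<mu> h\<close>
  proof (induction h rule: integrable_induct)
    case (base A c)
    then show ?case using ind by simp
  next
    case (add f g)
    note fg = add
    have "(\<lambda>r. D f r + D g r) \<longlonglongrightarrow> 0 + 0" using fg by (intro tendsto_add)
    then show ?case
      using tendsto_0_squeeze[of "D (\<lambda>x. f x + g x)" "\<lambda>r. D f r + D g r"] nonneg assms(2)[OF fg(1) fg(2)] by simp
  next
    case (lim f s)
    have "(\<lambda>i. \<integral>x. \<bar>f x - s i x\<bar> \<partial>\<mu>) \<longlonglongrightarrow> (\<integral>x. 0 \<partial>\<mu>)"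
    proof (rule integral_dominated_convergence[where w = "\<lambda>x. 3 * \<bar>f x\<bar>"])
      show "AE x in \<mu>. (\<lambda>i. \<bar>f x - s i x\<bar>) \<longlonglongrightarrow> 0"
      proof (rule AE_I2)
        fix x assume "x \<in> space \<mu>"
        from tendsto_rabs[OF tendsto_diff[OF tendsto_const lim.hyps(2)[OF this]], of "f x"]
        show "(\<lambda>i. \<bar>f x - s i x\<bar>) \<longlonglongrightarrow> 0" by simp
      qed
      show "AE x in \<mu>. norm \<bar>f x - s i x\<bar> \<le> 3 * \<bar>f x\<bar>" for i
      proof (rule AE_I2)
        fix x assume "x \<in> space \<mu>"
        from lim.hyps(3)[OF this, of i] show "norm \<bar>f x - s i x\<bar> \<le> 3 * \<bar>f x\<bar>" by (simp; linarith)
      qed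
    qed (use lim in auto)
    then have "(\<lambda>i. \<integral>x. \<bar>f x - s i x\<bar> \<partial>\<mu>) \<longlonglongrightarrow> 0" by simp
    then show ?case
      by (rule L1_limit_vanishing[OF lim.hyps(4) lim.hyps(1) lim.IH _ assms(2) nonneg bound])
  qed
qed

lemma cesaro_null:
  fixes m :: "nat \<Rightarrow> real"
  assumes "m \<longlonglongrightarrow> 0" "\<And>n. 0 \<le> m n"
  shows "(\<lambda>n. (\<Sum>r<n. m r) / real n) \<longlonglongrightarrow> 0"
proof (rule LIMSEQ_I)
  fix \<epsilon> :: real assume \<epsilon>: "0 < \<epsilon>"
  then have "eventually (\<lambda>r. m r < \<epsilon> / 2) sequentially"
    using assms(1) by (intro order_tendstoD) auto
  then obtain R where R: "\<And>r. r \<ge> R \<Longrightarrow> m r < \<epsilon> / 2" by (auto simp: eventually_sequentially)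
  define B where "B = (\<Sum>r<R. m r)"
  have B: "0 \<le> B" using assms(2) by (auto simp: B_def intro: sum_nonneg)
  obtain N where N: "real N > 2 * B / \<epsilon>" using reals_Archimedean2 by blast
  have "norm ((\<Sum>r<n. m r) / real n - 0) < \<epsilon>" if n: "n \<ge> max N 1" for n
  proof -
    have "(\<Sum>r<n. m r) \<le> (\<Sum>r\<in>{..<R} \<union> {R..<n}. m r)"
      using assms(2) by (intro sum_mono2) auto
    also have "\<dots> = B + (\<Sum>r\<in>{R..<n}. m r)" unfolding B_def by (intro sum.union_disjoint) auto
    also have "(\<Sum>r\<in>{R..<n}. m r) \<le> (\<Sum>r\<in>{R..<n}. \<epsilon> / 2)"
      using R by (intro sum_mono) (auto intro: less_imp_le)
    also have "\<dots> \<le> real n * (\<epsilon> / 2)" using \<epsilon> by (simp add: mult_right_mono)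
    finally have le: "(\<Sum>r<n. m r) \<le> B + real n * (\<epsilon> / 2)" by simp
    have "2 * B / \<epsilon> < real n" using N n by linarith
    then have "B < real n * (\<epsilon> / 2)" using \<epsilon> by (simp add: field_simps)
    with le have "(\<Sum>r<n. m r) < real n * \<epsilon>" by linarith
    moreover have "0 \<le> (\<Sum>r<n. m r)" using assms(2) by (intro sum_nonneg) auto
    ultimately show ?thesis using n by (simp add: field_simps)
  qed
  then show "\<exists>no. \<forall>n\<ge>no. norm ((\<Sum>r<n. m r) / real n - 0) < \<epsilon>" by blast
qed

lemma abs_le_half_plus_square:
  fixes z \<delta> :: real
  assumes "0 < \<delta>"
  shows "\<bar>z\<bar> \<le> \<delta> / 2 + z\<^sup>2 / (2 * \<delta>)"
proof -
  have "0 \<le> (\<bar>z\<bar> - \<delta>)\<^sup>2 / (2 * \<delta>)" using assms by simp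
  also have "\<dots> = z\<^sup>2 / (2 * \<delta>) - \<bar>z\<bar> + \<delta> / 2"
    using assms by (simp add: power2_diff field_simps) (simp add: power2_eq_square)
  finally show ?thesis by simp
qed

lemma tail_suminf_tendsto_0:
  fixes b :: "nat \<Rightarrow> real"
  assumes "summable b"
  shows "(\<lambda>I. \<Sum>j. b (j + I)) \<longlonglongrightarrow> 0"
proof -
  have "(\<lambda>I. suminf b - (\<Sum>j<I. b j)) \<longlonglongrightarrow> suminf b - suminf b"
    by (rule tendsto_diff[OF tendsto_const summable_LIMSEQ[OF assms]])
  then show ?thesis by (simp add: suminf_minus_initial_segment[OF assms])
qed

text \<open>A series of nonnegative functions with summable integrals may diverge on a null set; the majorant
replaces its sum there by a finite value.\<close>

lemma nonneg_series_majorant: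
  fixes w :: "nat \<Rightarrow> 'b \<Rightarrow> real"
  assumes w: "\<And>i. integrable \<mu> (w i)" "\<And>i x. 0 \<le> w i x" and b: "\<And>i. (\<integral>x. w i x \<partial>\<mu>) \<le> b i" "summable b"
  obtains u where "integrable \<mu> u" "(\<integral>x. u x \<partial>\<mu>) \<le> suminf b" "\<And>x. 0 \<le> u x"
    "AE x in \<mu>. \<forall>k. (\<Sum>i<k. w i x) \<le> u x"
proof -
  have b0: "0 \<le> b i" for i by (rule order_trans[OF Bochner_Integration.integral_nonneg b(1)]) (rule w(2))
  have [measurable]: "w i \<in> borel_measurable \<mu>" for i using w(1)[of i] by auto
  define W where "W x = (\<Sum>i. ennreal (w i x))" for x
  have [measurable]: "W \<in> borel_measurable \<mu>" unfolding W_def by measurable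
  have Wint: "(\<integral>\<^sup>+x. W x \<partial>\<mu>) \<le> ennreal (suminf b)"
  proof -
    have "(\<integral>\<^sup>+x. W x \<partial>\<mu>) = (\<Sum>i. \<integral>\<^sup>+x. ennreal (w i x) \<partial>\<mu>)"
      unfolding W_def by (rule nn_integral_suminf) measurable
    also have "\<dots> = (\<Sum>i. ennreal (\<integral>x. w i x \<partial>\<mu>))"
      by (intro suminf_cong nn_integral_eq_integral w(1)) (simp add: w(2))
    also have "\<dots> \<le> (\<Sum>i. ennreal (b i))" by (intro suminf_le ennreal_leI b(1)) auto
    also have "\<dots> = ennreal (suminf b)" by (rule suminf_ennreal2[OF b0 b(2)])
    finally show ?thesis .
  qed
  define u where "u x = enn2real (W x)" for x
  have Wfin: "AE x in \<mu>. W x \<noteq> \<infinity>"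
    using Wint by (intro nn_integral_PInf_AE) (auto simp: top_unique)
  have uW: "(\<integral>\<^sup>+x. ennreal (u x) \<partial>\<mu>) = (\<integral>\<^sup>+x. W x \<partial>\<mu>)"
    by (rule nn_integral_cong_AE) (use Wfin in eventually_elim, auto simp: u_def less_top)
  have [measurable]: "u \<in> borel_measurable \<mu>" unfolding u_def by measurable
  have ui: "integrable \<mu> u"
    using uW Wint by (intro integrableI_bounded) (auto simp: u_def intro: order.strict_trans1)
  have "ennreal (\<integral>x. u x \<partial>\<mu>) = (\<integral>\<^sup>+x. ennreal (u x) \<partial>\<mu>)"
    by (rule nn_integral_eq_integral[OF ui, symmetric]) (simp add: u_def)
  with uW Wint have "ennreal (\<integral>x. u x \<partial>\<mu>) \<le> ennreal (suminf b)" by simp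
  then have uint: "(\<integral>x. u x \<partial>\<mu>) \<le> suminf b"
    using suminf_nonneg[OF b(2) b0] by (subst (asm) ennreal_le_iff) auto
  have "AE x in \<mu>. \<forall>k. (\<Sum>i<k. w i x) \<le> u x"
    using Wfin
  proof eventually_elim
    case (elim x)
    show ?case
    proof
      fix k
      have "ennreal (\<Sum>i<k. w i x) = (\<Sum>i<k. ennreal (w i x))" by (simp add: w(2))
      also have "\<dots> \<le> W x" unfolding W_def by (rule sum_le_suminf) auto
      also have "W x = ennreal (u x)" using elim by (simp add: u_def less_top)
      finally show "(\<Sum>i<k. w i x) \<le> u x" by (subst (asm) ennreal_le_iff) (auto simp: u_def)
    qed
  qed
  then show ?thesis using that[OF ui uint] by (simp add: u_def)
qed

section \<open>The shift on sequences of innovations\<close>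

text \<open>A sequence lists the innovations from the present into the past, so \<open>shift n\<close> goes back by \<open>n\<close> time
steps and \<open>comb_seq r \<omega> e\<close> continues the history \<open>e\<close> by the \<open>r\<close> newer innovations \<open>\<omega> (r - 1), ..., \<omega> 0\<close>.\<close>

definition shift :: "nat \<Rightarrow> (nat \<Rightarrow> 'a) \<Rightarrow> nat \<Rightarrow> 'a" where
  "shift n e = (\<lambda>i. e (n + i))"

lemma shift_0 [simp]: "shift 0 e = e"
  by (simp add: shift_def)

lemma shift_shift [simp]: "shift m (shift n e) = shift (n + m) e"
  by (simp add: shift_def add.assoc)

lemma shift_comb_seq_same [simp]: "shift r (comb_seq r \<omega> e) = e"
  by (auto simp: shift_def comb_seq_def fun_eq_iff)

lemma shift_comb_seq_ge: "r \<le> i \<Longrightarrow> shift i (comb_seq r \<omega> e) = shift (i - r) e"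
  by (auto simp: shift_def comb_seq_def fun_eq_iff)

lemma comb_seq_comb_seq: "comb_seq k \<omega>' (comb_seq r \<omega> e) = comb_seq (k + r) (comb_seq k \<omega>' \<omega>) e"
  by (auto simp: comb_seq_def fun_eq_iff)

context sequence_space
begin

interpretation SS: pair_sigma_finite S S ..

lemma measurable_shift [measurable]: "shift n \<in> S \<rightarrow>\<^sub>M S"
  unfolding shift_def
  by (rule measurable_PiM_single')
     (auto simp: space_PiM PiE_iff extensional_def intro!: measurable_component_singleton)

lemma measurable_comb [measurable]: "(\<lambda>(e, \<omega>). comb_seq r \<omega> e) \<in> S \<Otimes>\<^sub>M S \<rightarrow>\<^sub>M S"
  by measurable

lemma distr_comb: "distr (S \<Otimes>\<^sub>M S) S (\<lambda>(e, \<omega>). comb_seq r \<omega> e) = S"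
proof -
  have "distr (S \<Otimes>\<^sub>M S) S (\<lambda>(e, \<omega>). comb_seq r \<omega> e) =
    distr (distr (S \<Otimes>\<^sub>M S) (S \<Otimes>\<^sub>M S) (\<lambda>(x, y). (y, x))) S (\<lambda>(e, \<omega>). comb_seq r \<omega> e)"
    by (subst SS.distr_pair_swap[symmetric]) simp
  also have "\<dots> = distr (S \<Otimes>\<^sub>M S) S (\<lambda>(\<omega>, e). comb_seq r \<omega> e)"
    by (subst distr_distr) (auto simp: comp_def case_prod_beta')
  finally show ?thesis by (simp add: PiM_comb_seq)
qed

lemma distr_fst_S: "distr (S \<Otimes>\<^sub>M S) S fst = S"
proof (rule measure_eqI)
  fix A assume A: "A \<in> sets (distr (S \<Otimes>\<^sub>M S) S fst)"
  then have "fst -` A \<inter> space (S \<Otimes>\<^sub>M S) = A \<times> space S"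
    by (auto simp: space_pair_measure dest: sets.sets_into_space)
  with A show "emeasure (distr (S \<Otimes>\<^sub>M S) S fst) A = emeasure S A"
    by (simp add: emeasure_distr P.emeasure_pair_measure_Times P.emeasure_space_1)
qed simp

lemma distr_shift: "distr S S (shift n) = S"
proof -
  have "distr S S (shift n) = distr (distr (S \<Otimes>\<^sub>M S) S (\<lambda>(e, \<omega>). comb_seq n \<omega> e)) S (shift n)"
    by (simp only: distr_comb)
  also have "\<dots> = distr (S \<Otimes>\<^sub>M S) S fst"
    by (subst distr_distr) (auto simp: comp_def case_prod_beta')
  finally show ?thesis by (simp add: distr_fst_S)
qed

lemma nn_integral_shift:
  assumes [measurable]: "f \<in> borel_measurable S"
  shows "(\<integral>\<^sup>+e. f (shift n e) \<partial>S) = (\<integral>\<^sup>+e. f e \<partial>S)"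
  using nn_integral_distr[OF measurable_shift[of n], of f] by (simp add: distr_shift)

lemma integrable_shift:
  fixes f :: "_ \<Rightarrow> real"
  assumes "integrable S f"
  shows "integrable S (\<lambda>e. f (shift n e))"
proof -
  from assms have "integrable (distr S S (shift n)) f" unfolding distr_shift .
  then show ?thesis by (rule integrable_distr[OF measurable_shift])
qed

lemma integral_shift:
  fixes f :: "_ \<Rightarrow> real"
  assumes [measurable]: "f \<in> borel_measurable S"
  shows "(\<integral>e. f (shift n e) \<partial>S) = (\<integral>e. f e \<partial>S)"
  using integral_distr[OF measurable_shift[of n], of f] by (simp add: distr_shift)

lemma AE_shift:
  assumes "AE e in S. Q e"
  shows "AE e in S. Q (shift n e)"
proof -
  from assms have "AE e in distr S S (shift n). Q e" unfolding distr_shift .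
  then show ?thesis by (rule AE_distrD[rotated]) simp
qed

lemma Lq_le_shift: "Lq_le S q f A \<Longrightarrow> Lq_le S q (\<lambda>e. f (shift n e)) A"
  by (rule Lq_le_distr[OF measurable_shift distr_shift])

lemma nn_integral_comb:
  assumes [measurable]: "f \<in> borel_measurable S"
  shows "(\<integral>\<^sup>+e. \<integral>\<^sup>+\<omega>. f (comb_seq r \<omega> e) \<partial>S \<partial>S) = (\<integral>\<^sup>+e. f e \<partial>S)"
proof -
  have "(\<integral>\<^sup>+e. \<integral>\<^sup>+\<omega>. f (comb_seq r \<omega> e) \<partial>S \<partial>S) = (\<integral>\<^sup>+z. f (case z of (e, \<omega>) \<Rightarrow> comb_seq r \<omega> e) \<partial>(S \<Otimes>\<^sub>M S))"
    using P.nn_integral_fst[of "\<lambda>z. f (case z of (e, \<omega>) \<Rightarrow> comb_seq r \<omega> e)" S] by simp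
  also have "\<dots> = (\<integral>\<^sup>+e. f e \<partial>distr (S \<Otimes>\<^sub>M S) S (\<lambda>(e, \<omega>). comb_seq r \<omega> e))"
    by (subst nn_integral_distr) auto
  finally show ?thesis by (simp add: distr_comb)
qed

text \<open>The conditional expectation of \<open>h\<close> at time \<open>r\<close> given the history \<open>e\<close> up to time 0. Being an integral,
it is a function of the history and not only a class of functions, so identities between predictions at
different times hold pointwise or follow from Fubini's theorem.\<close>

definition avg :: "nat \<Rightarrow> ((nat \<Rightarrow> 'a) \<Rightarrow> real) \<Rightarrow> (nat \<Rightarrow> 'a) \<Rightarrow> real" where
  "avg r h e = (\<integral>\<omega>. h (comb_seq r \<omega> e) \<partial>S)"

lemma avg_0 [simp]: "avg 0 h e = h e"
  by (simp add: avg_def comb_seq_0 P.prob_space)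

lemma borel_measurable_avg [measurable]:
  assumes [measurable]: "h \<in> borel_measurable S"
  shows "avg r h \<in> borel_measurable S"
  unfolding avg_def by measurable

lemma integrable_comb:
  fixes h :: "_ \<Rightarrow> real"
  assumes "integrable S h"
  shows "integrable (S \<Otimes>\<^sub>M S) (\<lambda>(e, \<omega>). h (comb_seq r \<omega> e))"
proof -
  from assms have "integrable (distr (S \<Otimes>\<^sub>M S) S (\<lambda>(e, \<omega>). comb_seq r \<omega> e)) h" unfolding distr_comb .
  from integrable_distr[OF measurable_comb this] show ?thesis by (simp add: case_prod_beta')
qed

lemma AE_integrable_comb:
  fixes h :: "_ \<Rightarrow> real"
  assumes "integrable S h"
  shows "AE e in S. integrable S (\<lambda>\<omega>. h (comb_seq r \<omega> e))"
  using SS.AE_integrable_fst'[OF integrable_comb[OF assms]] by simp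

lemma integrable_avg: "integrable S h \<Longrightarrow> integrable S (avg r h)"
  using SS.integrable_fst'[OF integrable_comb[of h r]] by (simp add: avg_def[abs_def])

lemma integral_avg:
  assumes "integrable S h"
  shows "(\<integral>e. avg r h e \<partial>S) = (\<integral>e. h e \<partial>S)"
proof -
  have [measurable]: "h \<in> borel_measurable S" using assms by auto
  have "(\<integral>e. avg r h e \<partial>S) = (\<integral>z. h (case z of (e, \<omega>) \<Rightarrow> comb_seq r \<omega> e) \<partial>(S \<Otimes>\<^sub>M S))"
    using SS.integral_fst'[OF integrable_comb[OF assms, of r]]
    by (simp add: avg_def case_prod_beta')
  also have "\<dots> = (\<integral>e. h e \<partial>distr (S \<Otimes>\<^sub>M S) S (\<lambda>(e, \<omega>). comb_seq r \<omega> e))"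
    by (subst integral_distr) auto
  finally show ?thesis by (simp add: distr_comb)
qed

lemma Lq_le_S_integrable: "Lq_le S q f A \<Longrightarrow> 1 \<le> q \<Longrightarrow> integrable S f"
  by (rule Lq_le_integrable(1)[OF P.prob_space_axioms])

lemma Lq_le_comb: "Lq_le S q h A \<Longrightarrow> Lq_le (S \<Otimes>\<^sub>M S) q (\<lambda>(e, \<omega>). h (comb_seq r \<omega> e)) A"
  using Lq_le_distr[OF measurable_comb[of r] distr_comb, of q h A] by (simp add: case_prod_beta')

lemma Lq_le_avg:
  assumes "Lq_le S q h A" "1 \<le> q"
  shows "Lq_le S q (avg r h) A"
  using Lq_le_integral_snd[OF P.prob_space_axioms P.sigma_finite_measure_axioms Lq_le_comb[OF assms(1), of r] assms(2)]
  by (simp add: avg_def[abs_def])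

lemma avg_add:
  assumes "integrable S h1" "integrable S h2"
  shows "AE e in S. avg r (\<lambda>e. h1 e + h2 e) e = avg r h1 e + avg r h2 e"
  using AE_integrable_comb[OF assms(1), of r] AE_integrable_comb[OF assms(2), of r]
  by eventually_elim (simp add: avg_def)

lemma avg_diff:
  assumes "integrable S h1" "integrable S h2"
  shows "AE e in S. avg r (\<lambda>e. h1 e - h2 e) e = avg r h1 e - avg r h2 e"
  using AE_integrable_comb[OF assms(1), of r] AE_integrable_comb[OF assms(2), of r]
  by eventually_elim (simp add: avg_def)

lemma avg_cmult: "avg r (\<lambda>e. c * h e) e = c * avg r h e"
  by (simp add: avg_def)

lemma avg_uminus: "avg r (\<lambda>e. - h e) e = - avg r h e"
  by (simp add: avg_def)

lemma avg_sum:
  assumes "\<And>i. i \<in> I \<Longrightarrow> integrable S (h i)"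
  shows "AE e in S. avg r (\<lambda>e. \<Sum>i\<in>I. h i e) e = (\<Sum>i\<in>I. avg r (h i) e)"
proof (cases "finite I")
  case True
  have "AE e in S. \<forall>i\<in>I. integrable S (\<lambda>\<omega>. h i (comb_seq r \<omega> e))"
    using True assms by (intro AE_finite_allI AE_integrable_comb)
  then show ?thesis by eventually_elim (simp add: avg_def)
qed (simp add: avg_def)

text \<open>Known factors can be taken out of a conditional expectation.\<close>

lemma avg_mult_shift: "avg r (\<lambda>e. u (shift r e) * h e) e = u e * avg r h e"
  by (simp add: avg_def)

text \<open>The tower property: the \<open>k\<close> newest and the \<open>r\<close> next innovations together are again an independent
sequence.\<close>

lemma avg_avg:
  assumes "integrable S h"
  shows "AE e in S. avg r (avg k h) e = avg (k + r) h e"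
  using AE_integrable_comb[OF assms, of "k + r"]
proof eventually_elim
  case (elim e)
  let ?H = "\<lambda>\<omega>. h (comb_seq (k + r) \<omega> e)"
  have [measurable]: "?H \<in> borel_measurable S" using elim by auto
  have I: "integrable (S \<Otimes>\<^sub>M S) (\<lambda>(\<omega>, \<omega>'). ?H (comb_seq k \<omega>' \<omega>))" by (rule integrable_comb[OF elim])
  have "avg r (avg k h) e = (\<integral>\<omega>. \<integral>\<omega>'. ?H (comb_seq k \<omega>' \<omega>) \<partial>S \<partial>S)"
    by (simp add: avg_def comb_seq_comb_seq)
  also have "\<dots> = (\<integral>z. ?H (case z of (\<omega>, \<omega>') \<Rightarrow> comb_seq k \<omega>' \<omega>) \<partial>(S \<Otimes>\<^sub>M S))"
    using SS.integral_fst'[OF I] by (simp add: case_prod_beta')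
  also have "\<dots> = (\<integral>\<omega>. ?H \<omega> \<partial>distr (S \<Otimes>\<^sub>M S) S (\<lambda>(\<omega>, \<omega>'). comb_seq k \<omega>' \<omega>))"
    by (subst integral_distr) auto
  also have "\<dots> = avg (k + r) h e" by (simp add: distr_comb avg_def)
  finally show ?case .
qed

lemma integral_abs_avg_le:
  assumes "integrable S h"
  shows "(\<integral>e. \<bar>avg r h e\<bar> \<partial>S) \<le> (\<integral>e. \<bar>h e\<bar> \<partial>S)"
proof -
  have "(\<integral>e. \<bar>avg r h e\<bar> \<partial>S) \<le> (\<integral>e. avg r (\<lambda>e. \<bar>h e\<bar>) e \<partial>S)"
    by (intro integral_mono integrable_avg integrable_abs assms)
       (auto simp: avg_def intro!: integral_abs_bound)
  also have "\<dots> = (\<integral>e. \<bar>h e\<bar> \<partial>S)" by (intro integral_avg integrable_abs assms)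
  finally show ?thesis .
qed

lemma integral_mult_shift:
  assumes [measurable]: "u \<in> borel_measurable S" and h: "integrable S (\<lambda>e. u (shift r e) * h e)"
  shows "(\<integral>e. u (shift r e) * h e \<partial>S) = (\<integral>e. u e * avg r h e \<partial>S)"
  using integral_avg[OF h, of r] by (simp add: avg_mult_shift)

end

section \<open>Mixing and the weak law of large numbers\<close>

context sequence_space
begin

definition mixdev :: "((nat \<Rightarrow> 'a) \<Rightarrow> real) \<Rightarrow> nat \<Rightarrow> real" where
  "mixdev h r = (\<integral>e. \<bar>avg r h e - (\<integral>e. h e \<partial>S)\<bar> \<partial>S)"

lemma mixdev_nonneg: "0 \<le> mixdev h r"
  by (simp add: mixdev_def)

lemma mixdev_add:
  assumes "integrable S h1" "integrable S h2"
  shows "mixdev (\<lambda>x. h1 x + h2 x) r \<le> mixdev h1 r + mixdev h2 r"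
proof -
  note [simp, intro] = integrable_avg[OF assms(1), of r] integrable_avg[OF assms(2), of r]
    integrable_avg[OF Bochner_Integration.integrable_add[OF assms], of r]
  have "mixdev (\<lambda>x. h1 x + h2 x) r \<le>
    (\<integral>e. \<bar>avg r h1 e - (\<integral>e. h1 e \<partial>S)\<bar> + \<bar>avg r h2 e - (\<integral>e. h2 e \<partial>S)\<bar> \<partial>S)"
    unfolding mixdev_def
  proof (rule integral_mono_AE)
    show "AE e in S. \<bar>avg r (\<lambda>x. h1 x + h2 x) e - (\<integral>e. h1 e + h2 e \<partial>S)\<bar> \<le>
      \<bar>avg r h1 e - (\<integral>e. h1 e \<partial>S)\<bar> + \<bar>avg r h2 e - (\<integral>e. h2 e \<partial>S)\<bar>"
      using avg_add[OF assms, of r]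
      by eventually_elim (simp add: Bochner_Integration.integral_add[OF assms])
  qed auto
  also have "\<dots> = mixdev h1 r + mixdev h2 r"
    unfolding mixdev_def by (intro Bochner_Integration.integral_add) auto
  finally show ?thesis .
qed

lemma mixdev_le:
  assumes "integrable S h"
  shows "mixdev h r \<le> 2 * (\<integral>x. \<bar>h x\<bar> \<partial>S)"
proof -
  note [simp, intro] = integrable_avg[OF assms, of r]
  have "mixdev h r \<le> (\<integral>e. \<bar>avg r h e\<bar> + \<bar>\<integral>e. h e \<partial>S\<bar> \<partial>S)"
    unfolding mixdev_def by (intro integral_mono) auto
  also have "\<dots> = (\<integral>e. \<bar>avg r h e\<bar> \<partial>S) + \<bar>\<integral>e. h e \<partial>S\<bar>"
    by (simp add: P.prob_space)
  also have "\<dots> \<le> (\<integral>x. \<bar>h x\<bar> \<partial>S) + (\<integral>x. \<bar>h x\<bar> \<partial>S)"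
    by (intro add_mono integral_abs_avg_le assms integral_abs_bound)
  finally show ?thesis by simp
qed

lemma mixdev_cmult: "mixdev (\<lambda>e. c * h e) r = \<bar>c\<bar> * mixdev h r"
  by (simp add: mixdev_def avg_cmult right_diff_distrib[symmetric] abs_mult)

lemma mixdev_const: "mixdev (\<lambda>e. c) r = 0"
  by (simp add: mixdev_def avg_def P.prob_space)

lemma mixdev_cong: "(\<And>e. e \<in> space S \<Longrightarrow> h e = h' e) \<Longrightarrow> mixdev h r = mixdev h' r"
proof -
  assume eq: "\<And>e. e \<in> space S \<Longrightarrow> h e = h' e"
  have "avg r h e = avg r h' e" if "e \<in> space S" for e
    unfolding avg_def using that
    by (intro Bochner_Integration.integral_cong eq) (auto simp: space_PiM PiE_iff comb_seq_def)
  moreover have "(\<integral>e. h e \<partial>S) = (\<integral>e. h' e \<partial>S)" by (intro Bochner_Integration.integral_cong eq) auto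
  ultimately show ?thesis unfolding mixdev_def by (intro Bochner_Integration.integral_cong) auto
qed

text \<open>A cylinder set depends on finitely many of the newest coordinates, so conditioning on a history that
is older than these leaves the constant probability. Cylinder sets are stable under intersection and
the property passes to complements and countable disjoint unions.\<close>

lemma mixdev_indicator_tendsto_0:
  assumes "A \<in> sets S"
  shows "mixdev (indicator A) \<longlonglongrightarrow> 0"
proof -
  let ?\<Omega> = "\<Pi>\<^sub>E i\<in>(UNIV :: nat set). space M"
  have "A \<in> sigma_sets ?\<Omega> (prod_algebra UNIV (\<lambda>_. M))" using assms by (simp add: sets_PiM)
  then show ?thesis
  proof (induction rule: sigma_sets_induct_disjoint[OF Int_stable_prod_algebra prod_algebra_sets_into_space, consumes 1])
    case (1 A)
    then obtain J E where A: "A = prod_emb UNIV (\<lambda>_. M) J (\<Pi>\<^sub>E j\<in>J. E j)"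
      and J: "finite J" and E: "\<And>i. i \<in> J \<Longrightarrow> E i \<in> sets M"
      by (rule prod_algebraE) blast
    from J obtain R where R: "\<And>j. j \<in> J \<Longrightarrow> j < R"
      using finite_nat_set_iff_bounded by auto
    have Am: "A \<in> sets S" unfolding A using J E by (auto intro!: sets_PiM_I)
    have "mixdev (indicator A) r = 0" if "r \<ge> R" for r
    proof -
      have "avg r (indicator A) e = (\<integral>e. indicator A e \<partial>S)" if "e \<in> space S" for e
        unfolding avg_def
      proof (intro Bochner_Integration.integral_cong refl)
        fix \<omega> assume "\<omega> \<in> space S"
        have "comb_seq r \<omega> e j = \<omega> j" if "j \<in> J" for j
          using R[OF that] \<open>r \<ge> R\<close> by (simp add: comb_seq_def)
        moreover have "comb_seq r \<omega> e \<in> space S" using \<open>\<omega> \<in> space S\<close> \<open>e \<in> space S\<close>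
          by (auto simp: space_PiM PiE_iff comb_seq_def)
        ultimately have "comb_seq r \<omega> e \<in> A \<longleftrightarrow> \<omega> \<in> A"
          using \<open>\<omega> \<in> space S\<close> unfolding A prod_emb_def by (auto simp: PiE_iff space_PiM)
        then show "indicator A (comb_seq r \<omega> e) = (indicator A \<omega> :: real)"
          by (auto simp: indicator_def)
      qed
      then show ?thesis unfolding mixdev_def
        by (simp cong: Bochner_Integration.integral_cong)
    qed
    then have "eventually (\<lambda>r. mixdev (indicator A) r = 0) sequentially"
      by (auto simp: eventually_sequentially)
    then show ?case by (rule tendsto_eventually)
  next
    case 2
    then show ?case using mixdev_const[of 0] by simp
  next
    case (3 A)
    then have Am: "A \<in> sets S" by (simp add: sets_PiM)
    have "mixdev (indicator (?\<Omega> - A)) r \<le> mixdev (indicator A) r" for r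
    proof -
      have "mixdev (indicator (?\<Omega> - A)) r = mixdev (\<lambda>e. 1 + (- 1) * indicator A e) r"
        by (rule mixdev_cong) (auto simp: indicator_def space_PiM)
      also have "\<dots> \<le> mixdev (\<lambda>e. 1) r + mixdev (\<lambda>e. (- 1) * indicator A e) r"
        using Am by (intro mixdev_add) (auto simp: P.emeasure_eq_measure)
      finally show ?thesis unfolding mixdev_cmult mixdev_const by simp
    qed
    then show ?case
      by (rule tendsto_0_squeeze[OF mixdev_nonneg _ 3(2)])
  next
    case (4 A)
    then have Am: "\<And>i. A i \<in> sets S" by (auto simp: sets_PiM)
    have int: "integrable S (indicator B :: _ \<Rightarrow> real)" if "B \<in> sets S" for B
      using that by (intro integrable_real_indicator) (auto simp: P.emeasure_eq_measure)
    have fin: "mixdev (\<lambda>e. \<Sum>i<n. indicator (A i) e) \<longlonglongrightarrow> 0" for n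
    proof (induction n)
      case (Suc n)
      have "(\<lambda>r. mixdev (\<lambda>e. \<Sum>i<n. indicator (A i) e) r + mixdev (indicator (A n)) r) \<longlonglongrightarrow> 0 + 0"
        by (intro tendsto_add Suc 4)
      then show ?case
        using tendsto_0_squeeze[OF mixdev_nonneg mixdev_add[OF Bochner_Integration.integrable_sum[OF int[OF Am]] int[OF Am]]] by simp
    qed (simp add: mixdev_const)
    let ?s = "\<lambda>n e. \<Sum>i<n. indicator (A i) e :: real" and ?U = "indicator (\<Union>i. A i) :: _ \<Rightarrow> real"
    have U: "integrable S ?U" "integrable S (?s n)" for n using Am by (auto intro!: int)
    have le: "?s n e \<le> ?U e" for n e
    proof -
      have "?s n e = indicator (\<Union>i<n. A i) e"
        using 4(1) by (subst indicator_UN_disjoint) (auto simp: disjoint_family_on_def)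
      also have "\<dots> \<le> ?U e" by (auto simp: indicator_def)
      finally show ?thesis .
    qed
    have diff: "(\<integral>e. \<bar>?U e - ?s n e\<bar> \<partial>S) = measure S (\<Union>i. A i) - (\<Sum>i<n. measure S (A i))" for n
    proof -
      have "(\<integral>e. \<bar>?U e - ?s n e\<bar> \<partial>S) = (\<integral>e. ?U e - ?s n e \<partial>S)" using le by simp
      then show ?thesis using U Am int by (simp add: Bochner_Integration.integral_diff)
    qed
    have "(\<lambda>i. measure S (A i)) sums measure S (\<Union>i. A i)"
      using Am 4 by (intro P.finite_measure_UNION) auto
    then have "(\<lambda>n. measure S (\<Union>i. A i) - (\<Sum>i<n. measure S (A i))) \<longlonglongrightarrow> measure S (\<Union>i. A i) - measure S (\<Union>i. A i)"
      unfolding sums_def by (intro tendsto_diff tendsto_const)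
    then have "(\<lambda>n. \<integral>e. \<bar>?U e - ?s n e\<bar> \<partial>S) \<longlonglongrightarrow> 0" unfolding diff by simp
    then show ?case
      by (rule L1_limit_vanishing[OF U fin _ mixdev_add mixdev_nonneg mixdev_le])
  qed
qed

lemma mixdev_tendsto_0:
  assumes "integrable S h"
  shows "mixdev h \<longlonglongrightarrow> 0"
proof (rule L1_density_principle[OF assms, where C = 2])
  fix A and c :: real assume "A \<in> sets S"
  then have "(\<lambda>r. \<bar>c\<bar> * mixdev (indicator A) r) \<longlonglongrightarrow> \<bar>c\<bar> * 0"
    by (intro tendsto_mult[OF tendsto_const] mixdev_indicator_tendsto_0)
  moreover have eq: "(\<lambda>x. indicator A x * c) = (\<lambda>x. c * indicator A x)"
    by (rule ext) (rule mult.commute)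
  ultimately show "(\<lambda>r. mixdev (\<lambda>x. indicator A x * c) r) \<longlonglongrightarrow> 0"
    unfolding eq mixdev_cmult by simp
qed (auto intro: mixdev_add mixdev_nonneg mixdev_le)

text \<open>The correlation of \<open>y\<close> with its shift by \<open>r\<close> is the integral of \<open>y * avg r y\<close>, hence at most \<open>b\<close> times the
deviation \<open>mixdev y r\<close>; adding one summand at a time avoids a double sum over the correlations.\<close>

lemma integral_square_sum_shift_le:
  assumes y[measurable]: "y \<in> borel_measurable S" and b: "\<And>e. \<bar>y e\<bar> \<le> b" and mean: "(\<integral>e. y e \<partial>S) = 0"
  shows "(\<integral>e. (\<Sum>s<T. y (shift s e))\<^sup>2 \<partial>S) \<le> real T * (2 * b * (\<Sum>r<T. mixdev y r))"
proof (induction T)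
  case (Suc T)
  have b0: "0 \<le> b" using b[of undefined] by linarith
  have bd: "integrable S F" if [measurable]: "F \<in> borel_measurable S" and "\<And>e. \<bar>F e\<bar> \<le> c" for F :: "(nat \<Rightarrow> 'a) \<Rightarrow> real" and c
    using that by (intro P.integrable_const_bound[where B = c]) auto
  have int: "integrable S y" by (rule bd[OF y b])
  have prod_b: "\<bar>y e * y e'\<bar> \<le> b * b" for e e'
    unfolding abs_mult by (intro mult_mono b b0) auto
  have i2: "integrable S (\<lambda>e. y (shift s e) * y e)" for s
    by (rule bd[OF _ prod_b]) measurable
  have i3: "integrable S (\<lambda>e. y e * y e)"
    using i2[of 0] by simp
  have cov: "\<bar>\<integral>e. y (shift r e) * y e \<partial>S\<bar> \<le> b * mixdev y r" for r
  proof -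
    have "(\<integral>e. y (shift r e) * y e \<partial>S) = (\<integral>e. y e * avg r y e \<partial>S)"
      by (intro integral_mult_shift i2) auto
    also have "\<bar>\<dots>\<bar> \<le> (\<integral>e. \<bar>y e * avg r y e\<bar> \<partial>S)" by (rule integral_abs_bound)
    also have "\<dots> \<le> (\<integral>e. b * \<bar>avg r y e\<bar> \<partial>S)"
    proof (rule integral_mono')
      show "integrable S (\<lambda>e. b * \<bar>avg r y e\<bar>)" using integrable_avg[OF int] by auto
      show "\<bar>y e * avg r y e\<bar> \<le> b * \<bar>avg r y e\<bar>" for e
        using b[of e] by (simp add: abs_mult mult_right_mono)
    qed (use b0 in auto)
    also have "\<dots> = b * mixdev y r" by (simp add: mixdev_def mean)
    finally show ?thesis .
  qed
  let ?Y = "\<lambda>e. \<Sum>s<T. y (shift s e)"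
  have Yb: "\<bar>?Y e\<bar> \<le> real T * b" for e
  proof -
    have "\<bar>?Y e\<bar> \<le> (\<Sum>s<T. \<bar>y (shift s e)\<bar>)" by (rule sum_abs)
    also have "\<dots> \<le> (\<Sum>s<T. b)" by (intro sum_mono b)
    finally show ?thesis by simp
  qed
  have Y2: "\<bar>(?Y e)\<^sup>2\<bar> \<le> (real T * b)\<^sup>2" for e
    using power_mono[OF Yb[of e], of 2] by simp
  have "(\<lambda>e. (?Y (shift 1 e))\<^sup>2) \<in> borel_measurable S" by measurable
  then have i1: "integrable S (\<lambda>e. (?Y (shift 1 e))\<^sup>2)"
    using Y2 by (rule bd)
  have "(\<integral>e. (\<Sum>s<Suc T. y (shift s e))\<^sup>2 \<partial>S) =
      (\<integral>e. (?Y (shift 1 e))\<^sup>2 + 2 * (\<Sum>s<T. y (shift (Suc s) e) * y e) + y e * y e \<partial>S)"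
    by (intro Bochner_Integration.integral_cong refl)
       (simp add: sum.lessThan_Suc_shift power2_eq_square algebra_simps sum_distrib_left sum_distrib_right del: sum.lessThan_Suc)
  also have "\<dots> = (\<integral>e. (?Y (shift 1 e))\<^sup>2 \<partial>S) + 2 * (\<Sum>s<T. (\<integral>e. y (shift (Suc s) e) * y e \<partial>S)) + (\<integral>e. y e * y e \<partial>S)"
    using i1 i2 i3 by (simp del: shift_shift)
  also have "(\<integral>e. (?Y (shift 1 e))\<^sup>2 \<partial>S) = (\<integral>e. (?Y e)\<^sup>2 \<partial>S)"
    by (rule integral_shift) simp
  also have "(\<Sum>s<T. (\<integral>e. y (shift (Suc s) e) * y e \<partial>S)) \<le> (\<Sum>s<T. b * mixdev y (Suc s))"
    by (intro sum_mono) (use cov abs_le_D1 in blast)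
  also have "(\<integral>e. y e * y e \<partial>S) \<le> 2 * (b * mixdev y 0)"
  proof -
    have "(\<integral>e. y e * y e \<partial>S) \<le> b * mixdev y 0" using cov[of 0] by simp
    then show ?thesis using mult_nonneg_nonneg[OF b0 mixdev_nonneg[of y 0]] by linarith
  qed
  finally have "(\<integral>e. (\<Sum>s<Suc T. y (shift s e))\<^sup>2 \<partial>S) \<le>
     (\<integral>e. (?Y e)\<^sup>2 \<partial>S) + 2 * ((\<Sum>s<T. b * mixdev y (Suc s)) + b * mixdev y 0)" by simp
  also have "(\<Sum>s<T. b * mixdev y (Suc s)) + b * mixdev y 0 = b * (\<Sum>r<Suc T. mixdev y r)"
    by (simp add: sum.lessThan_Suc_shift sum_distrib_left distrib_left del: sum.lessThan_Suc)
  also have "(\<integral>e. (?Y e)\<^sup>2 \<partial>S) \<le> real T * (2 * b * (\<Sum>r<T. mixdev y r))" by (rule Suc)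
  also have "real T * (2 * b * (\<Sum>r<T. mixdev y r)) \<le> real T * (2 * b * (\<Sum>r<Suc T. mixdev y r))"
    using b0 by (intro mult_left_mono) (auto simp: mixdev_nonneg)
  finally show ?case by (simp add: algebra_simps)
qed simp

definition meandev :: "((nat \<Rightarrow> 'a) \<Rightarrow> real) \<Rightarrow> nat \<Rightarrow> real" where
  "meandev h T = (\<integral>e. \<bar>(\<Sum>s<T. h (shift s e)) / real T - (\<integral>e. h e \<partial>S)\<bar> \<partial>S)"

text \<open>Chebyshev's inequality; the averaged correlations vanish by Cesaro's lemma.\<close>

lemma meandev_bounded_tendsto_0:
  assumes h[measurable]: "h \<in> borel_measurable S" and b: "\<And>e. \<bar>h e\<bar> \<le> b"
  shows "meandev h \<longlonglongrightarrow> 0"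
proof -
  define \<mu> where "\<mu> = (\<integral>e. h e \<partial>S)"
  define y where "y e = h e - \<mu>" for e
  have int: "integrable S h" using b by (intro P.integrable_const_bound[where B = b]) auto
  have \<mu>b: "\<bar>\<mu>\<bar> \<le> b"
  proof -
    have "\<bar>\<mu>\<bar> \<le> (\<integral>e. \<bar>h e\<bar> \<partial>S)" unfolding \<mu>_def by (rule integral_abs_bound)
    also have "\<dots> \<le> (\<integral>e. b \<partial>S)" using int b by (intro integral_mono) auto
    finally show ?thesis by (simp add: P.prob_space)
  qed
  have [measurable]: "y \<in> borel_measurable S" unfolding y_def by measurable
  have yb: "\<bar>y e\<bar> \<le> 2 * b" for e using b[of e] \<mu>b by (auto simp: y_def)
  have ym: "(\<integral>e. y e \<partial>S) = 0" using int by (simp add: y_def \<mu>_def P.prob_space)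
  have mix: "mixdev y \<longlonglongrightarrow> 0" using int by (intro mixdev_tendsto_0) (auto simp: y_def[abs_def])
  define v where "v T = 2 * (2 * b) * ((\<Sum>r<T. mixdev y r) / real T)" for T
  have v0: "v \<longlonglongrightarrow> 2 * (2 * b) * 0" unfolding v_def[abs_def]
    by (rule tendsto_mult[OF tendsto_const cesaro_null[OF mix mixdev_nonneg]])
  have sq: "(\<integral>e. ((\<Sum>s<T. y (shift s e)) / real T)\<^sup>2 \<partial>S) \<le> v T" if "T > 0" for T
  proof -
    have "(\<integral>e. ((\<Sum>s<T. y (shift s e)) / real T)\<^sup>2 \<partial>S) = (\<integral>e. (\<Sum>s<T. y (shift s e))\<^sup>2 \<partial>S) / (real T)\<^sup>2"
      by (simp add: power_divide)
    also have "\<dots> \<le> (real T * (2 * (2 * b) * (\<Sum>r<T. mixdev y r))) / (real T)\<^sup>2"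
      using yb ym by (intro divide_right_mono integral_square_sum_shift_le) auto
    also have "\<dots> = v T" using that by (simp add: v_def power2_eq_square)
    finally show ?thesis .
  qed
  have Yb: "\<bar>\<Sum>s<T. y (shift s e)\<bar> \<le> real T * (2 * b)" for T e
  proof -
    have "\<bar>\<Sum>s<T. y (shift s e)\<bar> \<le> (\<Sum>s<T. \<bar>y (shift s e)\<bar>)" by (rule sum_abs)
    also have "\<dots> \<le> (\<Sum>s<T. 2 * b)" by (intro sum_mono yb)
    finally show ?thesis by simp
  qed
  have bound: "meandev h T \<le> \<delta> / 2 + v T / (2 * \<delta>)" if T: "T > 0" and \<delta>: "\<delta> > 0" for T \<delta>
  proof -
    let ?Z = "\<lambda>e. (\<Sum>s<T. y (shift s e)) / real T"
    have Z: "(\<Sum>s<T. h (shift s e)) / real T - \<mu> = ?Z e" for e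
      using T by (simp add: y_def sum_subtractf diff_divide_distrib)
    have i1: "integrable S (\<lambda>e. \<bar>?Z e\<bar>)"
      using Yb T by (intro P.integrable_const_bound[where B = "2 * b"]) (auto simp: field_simps)
    have i2: "integrable S (\<lambda>e. (?Z e)\<^sup>2)"
    proof (intro P.integrable_const_bound[where B = "(2 * b)\<^sup>2"] AE_I2)
      fix e
      have "\<bar>?Z e\<bar> \<le> 2 * b" using Yb[of e T] T by (simp add: field_simps)
      from power_mono[OF this, of 2] show "norm ((?Z e)\<^sup>2) \<le> (2 * b)\<^sup>2" by (simp add: power_divide)
    qed measurable
    have "meandev h T = (\<integral>e. \<bar>?Z e\<bar> \<partial>S)" unfolding meandev_def \<mu>_def[symmetric] Z ..
    also have "\<dots> \<le> (\<integral>e. \<delta> / 2 + (?Z e)\<^sup>2 / (2 * \<delta>) \<partial>S)"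
    proof (rule integral_mono)
      fix e
      show "\<bar>?Z e\<bar> \<le> \<delta> / 2 + (?Z e)\<^sup>2 / (2 * \<delta>)" by (rule abs_le_half_plus_square[OF \<delta>])
    qed (use i1 i2 in auto)
    also have "\<dots> = \<delta> / 2 + (\<integral>e. (?Z e)\<^sup>2 \<partial>S) / (2 * \<delta>)"
      using i2 by (simp add: P.prob_space)
    also have "\<dots> \<le> \<delta> / 2 + v T / (2 * \<delta>)"
      using sq[OF T] \<delta> by (intro add_left_mono divide_right_mono) auto
    finally show ?thesis .
  qed
  show ?thesis
  proof (rule LIMSEQ_I)
    fix \<epsilon> :: real assume \<epsilon>: "0 < \<epsilon>"
    then have "eventually (\<lambda>T. v T < \<epsilon>\<^sup>2) sequentially"
      using v0 by (intro order_tendstoD) auto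
    then obtain R where R: "\<And>r. r \<ge> R \<Longrightarrow> v r < \<epsilon>\<^sup>2" by (auto simp: eventually_sequentially)
    have "norm (meandev h T - 0) < \<epsilon>" if "T \<ge> max R 1" for T
    proof -
      have "meandev h T \<le> \<epsilon> / 2 + v T / (2 * \<epsilon>)" using that \<epsilon> by (intro bound) auto
      also have "\<dots> < \<epsilon> / 2 + \<epsilon>\<^sup>2 / (2 * \<epsilon>)"
        using R[of T] that \<epsilon> by (intro add_strict_left_mono divide_strict_right_mono) auto
      also have "\<dots> = \<epsilon>" using \<epsilon> by (simp add: power2_eq_square)
      finally show ?thesis by (simp add: meandev_def)
    qed
    then show "\<exists>no. \<forall>n\<ge>no. norm (meandev h n - 0) < \<epsilon>" by blast
  qed
qed

lemma meandev_tendsto_0: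
  assumes "integrable S h"
  shows "meandev h \<longlonglongrightarrow> 0"
proof (rule L1_density_principle[OF assms, where C = 2 and D = meandev])
  have int: "integrable S (\<lambda>e. (\<Sum>s<T. h (shift s e)) / real T)" if "integrable S h" for h and T :: nat
    using that by (intro integrable_divide Bochner_Integration.integrable_sum integrable_shift) auto
  show "0 \<le> meandev h r" for h r by (simp add: meandev_def)
  show "meandev (\<lambda>x. h1 x + h2 x) r \<le> meandev h1 r + meandev h2 r"
    if h: "integrable S h1" "integrable S h2" for h1 h2 r
  proof -
    have "meandev (\<lambda>x. h1 x + h2 x) r \<le>
      (\<integral>e. \<bar>(\<Sum>s<r. h1 (shift s e)) / real r - (\<integral>e. h1 e \<partial>S)\<bar> + \<bar>(\<Sum>s<r. h2 (shift s e)) / real r - (\<integral>e. h2 e \<partial>S)\<bar> \<partial>S)"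
      unfolding meandev_def
    proof (rule integral_mono)
      show "\<bar>(\<Sum>s<r. h1 (shift s e) + h2 (shift s e)) / real r - (\<integral>e. h1 e + h2 e \<partial>S)\<bar> \<le>
        \<bar>(\<Sum>s<r. h1 (shift s e)) / real r - (\<integral>e. h1 e \<partial>S)\<bar> + \<bar>(\<Sum>s<r. h2 (shift s e)) / real r - (\<integral>e. h2 e \<partial>S)\<bar>" for e
        unfolding Bochner_Integration.integral_add[OF h] by (simp add: sum.distrib add_divide_distrib)
    qed (use int[OF h(1), of r] int[OF h(2), of r] int[OF Bochner_Integration.integrable_add[OF h], of r] in auto)
    also have "\<dots> = meandev h1 r + meandev h2 r"
      unfolding meandev_def using int[OF h(1), of r] int[OF h(2), of r]
      by (intro Bochner_Integration.integral_add) auto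
    finally show ?thesis .
  qed
  show "meandev h r \<le> 2 * (\<integral>x. \<bar>h x\<bar> \<partial>S)" if h: "integrable S h" for h r
  proof -
    have ia: "integrable S (\<lambda>e. \<bar>h (shift s e)\<bar>)" for s
      using integrable_shift[OF h] by (rule integrable_abs)
    have [measurable]: "h \<in> borel_measurable S" using h by auto
    have "meandev h r \<le> (\<integral>e. (\<Sum>s<r. \<bar>h (shift s e)\<bar>) / real r + (\<integral>x. \<bar>h x\<bar> \<partial>S) \<partial>S)"
      unfolding meandev_def
    proof (rule integral_mono)
      fix e
      have "\<bar>(\<Sum>s<r. h (shift s e)) / real r - (\<integral>e. h e \<partial>S)\<bar> \<le> \<bar>\<Sum>s<r. h (shift s e)\<bar> / real r + \<bar>\<integral>e. h e \<partial>S\<bar>"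
        by (rule order_trans[OF abs_triangle_ineq4]) simp
      also have "\<dots> \<le> (\<Sum>s<r. \<bar>h (shift s e)\<bar>) / real r + (\<integral>x. \<bar>h x\<bar> \<partial>S)"
        by (intro add_mono divide_right_mono sum_abs integral_abs_bound) auto
      finally show "\<bar>(\<Sum>s<r. h (shift s e)) / real r - (\<integral>e. h e \<partial>S)\<bar> \<le> (\<Sum>s<r. \<bar>h (shift s e)\<bar>) / real r + (\<integral>x. \<bar>h x\<bar> \<partial>S)" .
    qed (use int[OF h, of r] ia in auto)
    also have "\<dots> = (\<Sum>s<r. (\<integral>e. \<bar>h (shift s e)\<bar> \<partial>S)) / real r + (\<integral>x. \<bar>h x\<bar> \<partial>S)"
      using ia by (simp add: P.prob_space)
    also have "\<dots> = real r * (\<integral>x. \<bar>h x\<bar> \<partial>S) / real r + (\<integral>x. \<bar>h x\<bar> \<partial>S)"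
      using integral_shift[of "\<lambda>e. \<bar>h e\<bar>"] by simp
    also have "\<dots> \<le> 2 * (\<integral>x. \<bar>h x\<bar> \<partial>S)" by (cases "r = 0") auto
    finally show ?thesis .
  qed
  show "(\<lambda>r. meandev (\<lambda>x. indicator A x * c) r) \<longlonglongrightarrow> 0" if [measurable]: "A \<in> sets S" for A and c :: real
  proof (rule meandev_bounded_tendsto_0[where b = "\<bar>c\<bar>"])
    show "(\<lambda>x. indicator A x * c) \<in> borel_measurable S"
      by (rule borel_measurable_times[OF borel_measurable_indicator[OF that] borel_measurable_const])
    fix e :: "nat \<Rightarrow> 'a"
    show "\<bar>indicator A e * c\<bar> \<le> \<bar>c\<bar>" by (cases "e \<in> A") auto
  qed
qed

lemma weak_law_upper:
  assumes h: "integrable S h" and v: "(\<integral>e. h e \<partial>S) < v"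
  shows "(\<lambda>T. measure S {e \<in> space S. real T * v < (\<Sum>s<T. h (shift s e))}) \<longlonglongrightarrow> 0"
proof -
  define \<mu> where "\<mu> = (\<integral>e. h e \<partial>S)"
  have [measurable]: "h \<in> borel_measurable S" using h by auto
  have a: "measure S {e \<in> space S. real T * v < (\<Sum>s<T. h (shift s e))} \<le> meandev h T / (v - \<mu>)" for T
  proof -
    let ?Z = "\<lambda>e. \<bar>(\<Sum>s<T. h (shift s e)) / real T - \<mu>\<bar>"
    have "integrable S (\<lambda>e. (\<Sum>s<T. h (shift s e)) / real T)"
      using h by (intro integrable_divide Bochner_Integration.integrable_sum integrable_shift) auto
    then have int: "integrable S ?Z" by auto
    have a: "measure S {e \<in> space S. real T * v < (\<Sum>s<T. h (shift s e))} \<le> measure S {e \<in> space S. v - \<mu> \<le> ?Z e}"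
    proof (rule P.finite_measure_mono)
      show "{e \<in> space S. real T * v < (\<Sum>s<T. h (shift s e))} \<subseteq> {e \<in> space S. v - \<mu> \<le> ?Z e}"
      proof safe
        fix e assume *: "real T * v < (\<Sum>s<T. h (shift s e))"
        then have "T > 0" by (cases "T = 0") auto
        with * have "v < (\<Sum>s<T. h (shift s e)) / real T" by (simp add: field_simps)
        then show "v - \<mu> \<le> ?Z e" by linarith
      qed
    qed measurable
    also have "\<dots> \<le> (\<integral>e. ?Z e \<partial>S) / (v - \<mu>)"
      using int v by (intro integral_Markov_inequality_measure[where A = "{}"]) (auto simp: \<mu>_def)
    finally show ?thesis by (simp add: meandev_def \<mu>_def)
  qed
  have "(\<lambda>T. meandev h T / (v - \<mu>)) \<longlonglongrightarrow> 0 / (v - \<mu>)"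
    by (rule tendsto_divide[OF meandev_tendsto_0[OF h] tendsto_const]) (use v in \<open>simp add: \<mu>_def\<close>)
  then have "(\<lambda>T. meandev h T / (v - \<mu>)) \<longlonglongrightarrow> 0" by simp
  then show ?thesis by (rule tendsto_0_squeeze[OF measure_nonneg a])
qed

end

section \<open>A self-normalized exponential inequality\<close>

lemma exp_minus_half_square_le:
  fixes x :: real
  shows "exp (x - x\<^sup>2 / 2) \<le> 1 + x + x\<^sup>2 / 2"
proof -
  define G where "G x = (1 + x + x\<^sup>2 / 2) * exp (x\<^sup>2 / 2 - x)" for x :: real
  \<comment> \<open>the derivative has the sign of \<open>y\<close>, so \<open>G\<close> is minimal at 0\<close>
  have D: "(G has_real_derivative y * (1 + y / 2 + y\<^sup>2 / 2) * exp (y\<^sup>2 / 2 - y)) (at y)" for y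
    unfolding G_def by (auto intro!: derivative_eq_intros simp: field_simps power2_eq_square)
  have pos: "0 < 1 + y / 2 + y\<^sup>2 / 2" for y :: real
  proof -
    have "1 + y / 2 + y\<^sup>2 / 2 = (y + 1 / 2)\<^sup>2 / 2 + 7 / 8" by (simp add: power2_eq_square field_simps)
    also have "0 < (y + 1 / 2)\<^sup>2 / 2 + 7 / 8" by (intro add_nonneg_pos) auto
    finally show ?thesis .
  qed
  have "G 0 \<le> G x"
  proof (cases "0 \<le> x")
    case True
    then show ?thesis
    proof (rule DERIV_nonneg_imp_nondecreasing)
      fix y assume "0 \<le> y" "y \<le> x"
      then show "\<exists>d. (G has_real_derivative d) (at y) \<and> d \<ge> 0"
        using D[of y] pos[of y] by (intro exI[of _ "y * (1 + y / 2 + y\<^sup>2 / 2) * exp (y\<^sup>2 / 2 - y)"]) auto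
    qed
  next
    case False
    then have "x \<le> 0" by simp
    then show ?thesis
    proof (rule DERIV_nonpos_imp_nonincreasing)
      fix y assume "x \<le> y" "y \<le> 0"
      then show "\<exists>d. (G has_real_derivative d) (at y) \<and> d \<le> 0"
        using D[of y] pos[of y]
        by (intro exI[of _ "y * (1 + y / 2 + y\<^sup>2 / 2) * exp (y\<^sup>2 / 2 - y)"])
           (auto intro!: mult_nonpos_nonneg)
    qed
  qed
  then have "1 \<le> (1 + x + x\<^sup>2 / 2) * exp (x\<^sup>2 / 2 - x)" by (simp add: G_def)
  then have "1 * exp (x - x\<^sup>2 / 2) \<le> ((1 + x + x\<^sup>2 / 2) * exp (x\<^sup>2 / 2 - x)) * exp (x - x\<^sup>2 / 2)"
    by (intro mult_right_mono) auto
  also have "\<dots> = 1 + x + x\<^sup>2 / 2" by (simp add: mult.assoc exp_add[symmetric])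
  finally show ?thesis by simp
qed

text \<open>Subtracting half the square makes the exponential integrable for every square integrable function and
leaves a quadratic polynomial; its expectation \<open>1 + l\<^sup>2 / 2 * v\<close> is compensated by the variance term.\<close>

lemma (in prob_space) nn_integral_exp_self_normalized_le_1:
  fixes f :: "'a \<Rightarrow> real"
  assumes f: "integrable M f" "integrable M (\<lambda>x. (f x)\<^sup>2)" "(\<integral>x. f x \<partial>M) = 0"
  shows "(\<integral>\<^sup>+x. ennreal (exp (l * f x - l\<^sup>2 / 2 * ((f x)\<^sup>2 + (\<integral>x. (f x)\<^sup>2 \<partial>M)))) \<partial>M) \<le> 1"
proof -
  define v where "v = (\<integral>x. (f x)\<^sup>2 \<partial>M)"
  let ?p = "\<lambda>x. exp (- (l\<^sup>2 / 2 * v)) * (1 + l * f x + l\<^sup>2 / 2 * (f x)\<^sup>2)"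
  have int: "integrable M ?p" using f by auto
  have le: "exp (l * f x - l\<^sup>2 / 2 * ((f x)\<^sup>2 + v)) \<le> ?p x" for x
  proof -
    have "exp (l * f x - l\<^sup>2 / 2 * ((f x)\<^sup>2 + v)) = exp (- (l\<^sup>2 / 2 * v)) * exp (l * f x - (l * f x)\<^sup>2 / 2)"
      unfolding exp_add[symmetric] by (simp add: power_mult_distrib algebra_simps)
    also have "\<dots> \<le> exp (- (l\<^sup>2 / 2 * v)) * (1 + l * f x + (l * f x)\<^sup>2 / 2)"
      by (intro mult_left_mono exp_minus_half_square_le) auto
    also have "\<dots> = ?p x" by (simp add: power_mult_distrib)
    finally show ?thesis .
  qed
  have "(\<integral>\<^sup>+x. ennreal (exp (l * f x - l\<^sup>2 / 2 * ((f x)\<^sup>2 + v))) \<partial>M) \<le> (\<integral>\<^sup>+x. ennreal (?p x) \<partial>M)"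
    using le by (intro nn_integral_mono ennreal_leI)
  also have "\<dots> = ennreal (\<integral>x. ?p x \<partial>M)"
    by (rule nn_integral_eq_integral[OF int]) (use le in \<open>auto intro: order_trans[OF exp_ge_zero]\<close>)
  also have "(\<integral>x. ?p x \<partial>M) = exp (- (l\<^sup>2 / 2 * v)) * (1 + l\<^sup>2 / 2 * v)"
    using f by (simp add: prob_space v_def)
  also have "\<dots> \<le> exp (- (l\<^sup>2 / 2 * v)) * exp (l\<^sup>2 / 2 * v)"
    by (intro mult_left_mono exp_ge_add_one_self) auto
  also have "\<dots> = 1" by (simp add: exp_add[symmetric])
  finally show ?thesis by (simp add: v_def ennreal_leI)
qed

context sequence_space
begin

text \<open>Realised plus predictable quadratic variation of the martingale with differences \<open>f s\<close>, where \<open>f s\<close> is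
evaluated \<open>s\<close> steps before the present.\<close>

definition qvar :: "(nat \<Rightarrow> (nat \<Rightarrow> 'a) \<Rightarrow> real) \<Rightarrow> nat \<Rightarrow> (nat \<Rightarrow> 'a) \<Rightarrow> real" where
  "qvar f T e = (\<Sum>s<T. (f s (shift s e))\<^sup>2 + avg 1 (\<lambda>e. (f s e)\<^sup>2) (shift (Suc s) e))"

lemma borel_measurable_qvar [measurable]:
  assumes [measurable]: "\<And>s. f s \<in> borel_measurable S"
  shows "qvar f T \<in> borel_measurable S"
  unfolding qvar_def by measurable

text \<open>The newest difference is integrated out first: given the history, all other terms of the exponent are
constant.\<close>

lemma nn_integral_exp_self_normalized_sum_le_1:
  assumes "\<And>s. integrable S (f s)" "\<And>s. integrable S (\<lambda>e. (f s e)\<^sup>2)" "\<And>s. AE e in S. avg 1 (f s) e = 0"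
  shows "(\<integral>\<^sup>+e. ennreal (exp (l * (\<Sum>s<T. f s (shift s e)) - l\<^sup>2 / 2 * qvar f T e)) \<partial>S) \<le> 1"
  unfolding qvar_def using assms
proof (induction T arbitrary: f)
  case 0
  then show ?case by (simp add: P.emeasure_space_1)
next
  case (Suc T)
  note f = Suc.prems
  have [measurable]: "f s \<in> borel_measurable S" for s using f(1)[of s] by auto
  let ?R = "\<lambda>e. exp (l * (\<Sum>s<T. f (Suc s) (shift s e)) - l\<^sup>2 / 2 *
     (\<Sum>s<T. (f (Suc s) (shift s e))\<^sup>2 + avg 1 (\<lambda>e. (f (Suc s) e)\<^sup>2) (shift (Suc s) e)))"
  let ?F = "\<lambda>e. ennreal (exp (l * (\<Sum>s<Suc T. f s (shift s e)) - l\<^sup>2 / 2 *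
     (\<Sum>s<Suc T. (f s (shift s e))\<^sup>2 + avg 1 (\<lambda>e. (f s e)\<^sup>2) (shift (Suc s) e))))"
  have split: "?F (comb_seq 1 \<omega> e) = ennreal (?R e) *
      ennreal (exp (l * f 0 (comb_seq 1 \<omega> e) - l\<^sup>2 / 2 * ((f 0 (comb_seq 1 \<omega> e))\<^sup>2 + avg 1 (\<lambda>e. (f 0 e)\<^sup>2) e)))" for \<omega> e
    unfolding sum.lessThan_Suc_shift ennreal_mult'[OF exp_ge_zero, symmetric] exp_add[symmetric]
    by (simp add: shift_comb_seq_ge algebra_simps del: comb_seq_Suc_0)
  have "(\<integral>\<^sup>+e. ?F e \<partial>S) = (\<integral>\<^sup>+e. \<integral>\<^sup>+\<omega>. ?F (comb_seq 1 \<omega> e) \<partial>S \<partial>S)"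
    by (rule nn_integral_comb[symmetric]) measurable
  also have "\<dots> \<le> (\<integral>\<^sup>+e. ennreal (?R e) \<partial>S)"
  proof (rule nn_integral_mono_AE)
    show "AE e in S. (\<integral>\<^sup>+\<omega>. ?F (comb_seq 1 \<omega> e) \<partial>S) \<le> ennreal (?R e)"
      using AE_integrable_comb[OF f(1)[of 0], of 1] AE_integrable_comb[OF f(2)[of 0], of 1] f(3)[of 0] AE_space
    proof eventually_elim
      case (elim e)
      let ?h = "\<lambda>\<omega>. f 0 (comb_seq 1 \<omega> e)"
      have "(\<integral>\<^sup>+\<omega>. ?F (comb_seq 1 \<omega> e) \<partial>S) = ennreal (?R e) *
        (\<integral>\<^sup>+\<omega>. ennreal (exp (l * ?h \<omega> - l\<^sup>2 / 2 * ((?h \<omega>)\<^sup>2 + (\<integral>\<omega>. (?h \<omega>)\<^sup>2 \<partial>S)))) \<partial>S)"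
        unfolding split using elim by (subst nn_integral_cmult[symmetric]) (auto simp: avg_def)
      also have "\<dots> \<le> ennreal (?R e) * 1"
        using elim by (intro mult_left_mono P.nn_integral_exp_self_normalized_le_1) (auto simp: avg_def)
      finally show ?case by simp
    qed
  qed
  also have "\<dots> \<le> 1" by (rule Suc.IH) (rule f)+
  finally show ?case .
qed

lemma self_normalized_tail:
  assumes f: "\<And>s. integrable S (f s)" "\<And>s. integrable S (\<lambda>e. (f s e)\<^sup>2)" "\<And>s. AE e in S. avg 1 (f s) e = 0"
    and v: "0 < v" and y: "0 \<le> y"
  shows "measure S {e \<in> space S. y \<le> (\<Sum>s<T. f s (shift s e)) \<and> qvar f T e \<le> v} \<le> exp (- (y\<^sup>2 / (2 * v)))"
proof -
  have [measurable]: "f s \<in> borel_measurable S" for s using f(1)[of s] by auto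
  let ?D = "\<lambda>e. \<Sum>s<T. f s (shift s e)"
  let ?V = "qvar f T"
  let ?A = "{e \<in> space S. y \<le> ?D e \<and> ?V e \<le> v}"
  \<comment> \<open>minimises the exponent \<open>- l * y + l\<^sup>2 / 2 * v\<close> of the Chernoff bound\<close>
  define l where "l = y / v"
  have l: "0 \<le> l" using v y by (simp add: l_def)
  have A: "?A \<in> sets S" by measurable
  have "emeasure S ?A = (\<integral>\<^sup>+e. indicator ?A e \<partial>S)" using A by simp
  also have "\<dots> \<le> (\<integral>\<^sup>+e. ennreal (exp (- (y\<^sup>2 / (2 * v)))) * ennreal (exp (l * ?D e - l\<^sup>2 / 2 * ?V e)) \<partial>S)"
  proof (rule nn_integral_mono)
    fix e
    show "indicator ?A e \<le> ennreal (exp (- (y\<^sup>2 / (2 * v)))) * ennreal (exp (l * ?D e - l\<^sup>2 / 2 * ?V e))"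
    proof (cases "e \<in> ?A")
      case True
      have "l * y \<le> l * ?D e" "l\<^sup>2 / 2 * ?V e \<le> l\<^sup>2 / 2 * v" using True l by (auto intro!: mult_left_mono)
      moreover have "y\<^sup>2 / (2 * v) = l * y - l\<^sup>2 / 2 * v" using v by (simp add: l_def field_simps power2_eq_square)
      ultimately have "0 \<le> - (y\<^sup>2 / (2 * v)) + (l * ?D e - l\<^sup>2 / 2 * ?V e)" by linarith
      then have "1 \<le> exp (- (y\<^sup>2 / (2 * v)) + (l * ?D e - l\<^sup>2 / 2 * ?V e))" by simp
      then have "ennreal 1 \<le> ennreal (exp (- (y\<^sup>2 / (2 * v))) * exp (l * ?D e - l\<^sup>2 / 2 * ?V e))"
        unfolding exp_add by (rule ennreal_leI)
      with True show ?thesis by (simp add: ennreal_mult')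
    qed simp
  qed
  also have "\<dots> = ennreal (exp (- (y\<^sup>2 / (2 * v)))) * (\<integral>\<^sup>+e. ennreal (exp (l * ?D e - l\<^sup>2 / 2 * ?V e)) \<partial>S)"
    by (rule nn_integral_cmult) measurable
  also have "\<dots> \<le> ennreal (exp (- (y\<^sup>2 / (2 * v)))) * 1"
    by (intro mult_left_mono nn_integral_exp_self_normalized_sum_le_1 f) auto
  finally show ?thesis by (simp add: P.emeasure_eq_measure)
qed

lemma self_normalized_tail_abs:
  assumes f: "\<And>s. integrable S (f s)" "\<And>s. integrable S (\<lambda>e. (f s e)\<^sup>2)" "\<And>s. AE e in S. avg 1 (f s) e = 0"
    and v: "0 < v" and y: "0 \<le> y"
  shows "measure S {e \<in> space S. y \<le> \<bar>\<Sum>s<T. f s (shift s e)\<bar> \<and> qvar f T e \<le> v} \<le> 2 * exp (- (y\<^sup>2 / (2 * v)))"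
proof -
  have [measurable]: "f s \<in> borel_measurable S" for s using f(1)[of s] by auto
  let ?V = "qvar f T"
  let ?A = "{e \<in> space S. y \<le> (\<Sum>s<T. f s (shift s e)) \<and> ?V e \<le> v}"
  let ?B = "{e \<in> space S. y \<le> (\<Sum>s<T. - f s (shift s e)) \<and> ?V e \<le> v}"
  have AB: "?A \<in> sets S" "?B \<in> sets S" by measurable
  have "measure S {e \<in> space S. y \<le> \<bar>\<Sum>s<T. f s (shift s e)\<bar> \<and> ?V e \<le> v} \<le> measure S (?A \<union> ?B)"
    by (rule P.finite_measure_mono) (use AB in \<open>auto simp: sum_negf\<close>)
  also have "\<dots> \<le> measure S ?A + measure S ?B" by (rule measure_Un_le[OF AB])
  also have "measure S ?A \<le> exp (- (y\<^sup>2 / (2 * v)))" by (rule self_normalized_tail[OF f v y])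
  also have "measure S ?B \<le> exp (- (y\<^sup>2 / (2 * v)))"
    using self_normalized_tail[of "\<lambda>s e. - f s e", OF _ _ _ v y, of T] f by (simp add: avg_uminus qvar_def)
  finally show ?thesis by simp
qed

end

section \<open>Moments of sums of martingale differences\<close>

lemma exp_le_quadratic:
  fixes x :: real
  assumes "\<bar>x\<bar> \<le> 1"
  shows "exp x \<le> 1 + x + x\<^sup>2"
proof (cases "0 \<le> x")
  case True
  then show ?thesis using assms exp_bound[of x] by simp
next
  case False
  define y where "y = - x"
  have y: "0 \<le> y" using False by (simp add: y_def)
  have p: "0 < 1 + y + y\<^sup>2 / 2" using y by (simp add: add_pos_nonneg)
  have "1 \<le> 1 + y ^ 4 / 4 + 0" by simp
  also have "\<dots> = (1 - y + y\<^sup>2 / 2) * (1 + y + y\<^sup>2 / 2)"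
    by (simp add: algebra_simps power2_eq_square power4_eq_xxxx)
  finally have "1 / (1 + y + y\<^sup>2 / 2) \<le> 1 - y + y\<^sup>2 / 2" using p by (simp add: field_simps)
  moreover have "exp x \<le> 1 / (1 + y + y\<^sup>2 / 2)"
    using exp_lower_Taylor_quadratic[OF y] p by (simp add: y_def exp_minus field_simps)
  moreover have "1 - y + y\<^sup>2 / 2 \<le> 1 + x + x\<^sup>2" by (simp add: y_def)
  ultimately show ?thesis by linarith
qed

lemma abs_powr_add_le_one:
  fixes t q :: real
  assumes q: "2 \<le> q"
  shows "\<bar>1 + t\<bar> powr q \<le> 1 + q * t + ((q + 1) powr q + q\<^sup>2) * (t\<^sup>2 + \<bar>t\<bar> powr q)"
proof (cases "\<bar>q * t\<bar> \<le> 1")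
  case True
  have "\<bar>t\<bar> \<le> 1 / q" using True q by (simp add: abs_mult field_simps)
  also have "\<dots> \<le> 1 / 2" using q by (simp add: field_simps)
  finally have "0 < 1 + t" by linarith
  then have "\<bar>1 + t\<bar> powr q \<le> exp t powr q"
    using q by (intro powr_mono2) auto
  also have "\<dots> = exp (q * t)" by (simp add: powr_def)
  also have "\<dots> \<le> 1 + q * t + (q * t)\<^sup>2" by (rule exp_le_quadratic[OF True])
  also have "(q * t)\<^sup>2 = q\<^sup>2 * t\<^sup>2" by (simp add: power_mult_distrib)
  also have "\<dots> \<le> ((q + 1) powr q + q\<^sup>2) * (t\<^sup>2 + \<bar>t\<bar> powr q)"
    by (intro mult_mono) auto
  finally show ?thesis by simp
next
  case False
  then have t: "1 < q * \<bar>t\<bar>" using q by (simp add: abs_mult)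
  have "\<bar>1 + t\<bar> \<le> 1 + \<bar>t\<bar>" by linarith
  also have "\<dots> \<le> (q + 1) * \<bar>t\<bar>" using t by (simp add: algebra_simps)
  finally have "\<bar>1 + t\<bar> powr q \<le> ((q + 1) * \<bar>t\<bar>) powr q" using q by (intro powr_mono2) auto
  also have "\<dots> = (q + 1) powr q * \<bar>t\<bar> powr q" using q by (simp add: powr_mult)
  finally have 1: "\<bar>1 + t\<bar> powr q \<le> (q + 1) powr q * \<bar>t\<bar> powr q" .
  have "q * \<bar>t\<bar> * 1 \<le> q * \<bar>t\<bar> * (q * \<bar>t\<bar>)" using t q by (intro mult_left_mono) auto
  also have "\<dots> = q\<^sup>2 * t\<^sup>2" by (simp add: power2_eq_square)
  finally have "- (q * t) \<le> q\<^sup>2 * t\<^sup>2" using q by (cases "t \<ge> 0") (auto simp: abs_if intro: order_trans[of _ 0])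
  then have 2: "0 \<le> 1 + q * t + q\<^sup>2 * t\<^sup>2" by linarith
  have "0 \<le> (q + 1) powr q * t\<^sup>2" "0 \<le> q\<^sup>2 * \<bar>t\<bar> powr q" by auto
  moreover have "((q + 1) powr q + q\<^sup>2) * (t\<^sup>2 + \<bar>t\<bar> powr q) =
      (q + 1) powr q * t\<^sup>2 + (q + 1) powr q * \<bar>t\<bar> powr q + q\<^sup>2 * t\<^sup>2 + q\<^sup>2 * \<bar>t\<bar> powr q"
    by (simp add: distrib_left distrib_right)
  ultimately show ?thesis using 1 2 by linarith
qed

text \<open>A second order expansion of the power: the first order term is odd in \<open>x\<close> and linear in \<open>y\<close>, so it
vanishes when \<open>y\<close> is a martingale difference and \<open>x\<close> depends on the past.\<close>

lemma abs_powr_add_le: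
  fixes x y q :: real
  assumes q: "2 \<le> q"
  shows "\<bar>x + y\<bar> powr q \<le> \<bar>x\<bar> powr q + q * sgn x * \<bar>x\<bar> powr (q - 1) * y +
     ((q + 1) powr q + q\<^sup>2) * (\<bar>x\<bar> powr (q - 2) * y\<^sup>2 + \<bar>y\<bar> powr q)"
proof (cases "x = 0")
  case True
  have "1 * \<bar>y\<bar> powr q \<le> ((q + 1) powr q + q\<^sup>2) * \<bar>y\<bar> powr q"
    using q by (intro mult_right_mono) (auto intro: add_increasing ge_one_powr_ge_zero)
  then show ?thesis using True by simp
next
  case False
  define t where "t = y / x"
  have y: "y = x * t" using False by (simp add: t_def)
  have x2: "\<bar>x\<bar> powr 2 = x\<^sup>2" using False by (simp add: powr_numeral)
  have e1: "\<bar>x\<bar> powr (q - 1) = \<bar>x\<bar> powr q / \<bar>x\<bar>" and e2: "\<bar>x\<bar> powr (q - 2) = \<bar>x\<bar> powr q / x\<^sup>2"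
    using False by (simp_all add: powr_diff x2)
  have "\<bar>x + y\<bar> powr q = \<bar>x\<bar> powr q * \<bar>1 + t\<bar> powr q"
    unfolding y by (subst powr_mult[symmetric]) (auto simp: abs_mult[symmetric] algebra_simps)
  also have "\<dots> \<le> \<bar>x\<bar> powr q * (1 + q * t + ((q + 1) powr q + q\<^sup>2) * (t\<^sup>2 + \<bar>t\<bar> powr q))"
    by (intro mult_left_mono abs_powr_add_le_one q) auto
  also have "\<dots> = \<bar>x\<bar> powr q + \<bar>x\<bar> powr q * q * t + ((q + 1) powr q + q\<^sup>2) * (\<bar>x\<bar> powr q * t\<^sup>2 + \<bar>x\<bar> powr q * \<bar>t\<bar> powr q)"
    by (simp add: algebra_simps)
  also have "\<bar>x\<bar> powr q * q * t = q * sgn x * \<bar>x\<bar> powr (q - 1) * y"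
    unfolding e1 y using False by (simp add: sgn_if field_simps)
  also have "\<bar>x\<bar> powr q * t\<^sup>2 = \<bar>x\<bar> powr (q - 2) * y\<^sup>2"
    unfolding e2 y using False by (simp add: power_mult_distrib)
  also have "\<bar>x\<bar> powr q * \<bar>t\<bar> powr q = \<bar>y\<bar> powr q"
    unfolding y by (simp add: abs_mult powr_mult)
  finally show ?thesis .
qed

text \<open>The growth of \<open>(L * n) powr (q / 2)\<close> in one step pays for the second order term of the expansion.\<close>

lemma powr_step_le:
  fixes L C q :: real
  assumes q: "2 \<le> q" and L: "1 \<le> L" "2 * C \<le> L" and C: "0 \<le> C" and n: "1 \<le> n"
  shows "(L * real n) powr (q / 2) + C * ((L * real n) powr (q / 2 - 1) + 1) \<le> (L * real (Suc n)) powr (q / 2)"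
proof -
  let ?m = "L * real n"
  have m: "1 \<le> ?m" using L n by (metis mult_mono' mult_1 of_nat_1_eq_iff of_nat_le_iff of_nat_1 zero_le_one)
  let ?a = "?m powr (q / 2 - 1)"
  have a: "1 \<le> ?a" using m q by (intro ge_one_powr_ge_zero) auto
  have "C * (?a + 1) \<le> C * (2 * ?a)" using a C by (intro mult_left_mono) auto
  also have "\<dots> \<le> L * ?a" using mult_right_mono[OF L(2), of ?a] a by (simp add: mult_ac)
  finally have 1: "C * (?a + 1) \<le> L * ?a" .
  have 2: "?m powr (q / 2) = ?m * ?a" using m by (simp add: powr_diff)
  have "(?m + L) powr (q / 2) = (?m + L) * (?m + L) powr (q / 2 - 1)" using m L by (simp add: powr_diff)
  also have "\<dots> \<ge> (?m + L) * ?a" using m L q by (intro mult_left_mono powr_mono2) auto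
  finally have 3: "(?m + L) * ?a \<le> (?m + L) powr (q / 2)" .
  have 4: "L * real (Suc n) = ?m + L" by (simp add: algebra_simps)
  have "(?m + L) * ?a = ?m * ?a + L * ?a" by (rule distrib_right)
  with 1 2 3 show ?thesis unfolding 4 by linarith
qed

definition mart_const :: "real \<Rightarrow> real" where
  "mart_const q = 1 + 2 * ((q + 1) powr q + q\<^sup>2)"

lemma mart_const_ge_1: "1 \<le> mart_const q"
  by (simp add: mart_const_def)

context sequence_space
begin

text \<open>Induction on the number of summands: adding one raises the \<open>q\<close>-th moment by the expected second order
term of the expansion, which Hoelder's inequality bounds by the growth of \<open>n powr (q / 2)\<close>.\<close>

lemma Lq_le_sum_martingale_difference:
  assumes q: "2 \<le> q" and f: "Lq_le S q f A" and mart: "AE e in S. avg 1 f e = 0"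
  shows "Lq_le S q (\<lambda>e. \<Sum>s<n. f (shift s e)) (sqrt (mart_const q * real n) * A)"
proof (rule Lq_le_limit)
  fix \<epsilon> :: real assume "0 < \<epsilon>"
  have A0: "0 \<le> A" using f by (simp add: Lq_le_def)
  let ?L = "mart_const q"
  have L: "1 \<le> ?L" by (rule mart_const_ge_1)
  \<comment> \<open>a positive norm to normalise by, at the expense of at most \<open>\<epsilon>\<close> in the result\<close>
  define d where "d = \<epsilon> / (sqrt (?L * real n) + 1)"
  have sp: "0 \<le> sqrt (?L * real n)" using L by simp
  have d: "0 < d" using \<open>0 < \<epsilon>\<close> sp by (simp add: d_def add_nonneg_pos)
  define a where "a = A + d"
  have a: "0 < a" using A0 d by (simp add: a_def)
  have fa: "Lq_le S q f a" by (rule Lq_le_mono[OF f]) (use d q in \<open>auto simp: a_def\<close>)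
  have [measurable]: "f \<in> borel_measurable S" using f by (simp add: Lq_le_def)
  have fi: "integrable S (\<lambda>e. \<bar>f e\<bar> powr q)" "(\<integral>e. \<bar>f e\<bar> powr q \<partial>S) \<le> a powr q"
    using fa a by (auto simp: Lq_le_iff_integral)
  define C where "C = (q + 1) powr q + q\<^sup>2"
  have C: "0 \<le> C" by (simp add: C_def)
  have main: "Lq_le S q (\<lambda>e. \<Sum>s<n. f (shift s e)) (sqrt (?L * real n) * a)" for n
  proof (induction n)
    case 0
    then show ?case using q by (simp add: Lq_le_def)
  next
    case (Suc n)
    show ?case
    proof (cases "n = 0")
      case True
      have "Lq_le S q f (sqrt ?L * a)"
      proof (rule Lq_le_mono[OF fa])
        have "1 * a \<le> sqrt ?L * a" using L a by (intro mult_right_mono) auto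
        then show "a \<le> sqrt ?L * a" by simp
      qed (use q in simp)
      then show ?thesis using True by simp
    next
      case False
      define U where "U e = (\<Sum>s<n. f (shift s e))" for e
      define B where "B = sqrt (?L * real n) * a"
      have [measurable]: "U \<in> borel_measurable S" unfolding U_def by measurable
      have B: "0 < B" using L a False by (simp add: B_def)
      have U: "Lq_le S q U B" using Suc.IH by (simp add: U_def[abs_def] B_def)
      have Ui: "integrable S (\<lambda>e. \<bar>U e\<bar> powr q)" "(\<integral>e. \<bar>U e\<bar> powr q \<partial>S) \<le> B powr q"
        using U B by (auto simp: Lq_le_iff_integral)
      define V where "V e = U (shift 1 e)" for e
      have [measurable]: "V \<in> borel_measurable S" unfolding V_def by measurable
      have Vi: "integrable S (\<lambda>e. \<bar>V e\<bar> powr q)" "(\<integral>e. \<bar>V e\<bar> powr q \<partial>S) \<le> B powr q"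
        using integrable_shift[OF Ui(1), of 1] integral_shift[of "\<lambda>e. \<bar>U e\<bar> powr q" 1] Ui(2) by (auto simp: V_def)
      have sumSuc: "(\<Sum>s<Suc n. f (shift s e)) = V e + f e" for e
        unfolding sum.lessThan_Suc_shift by (simp add: V_def U_def)
      \<comment> \<open>makes the first order term integrable\<close>
      have Young1: "\<bar>x\<bar> powr (q - 1) * \<bar>y\<bar> \<le> \<bar>x\<bar> powr q + \<bar>y\<bar> powr q" for x y :: real
      proof (cases "x = 0 \<or> y = 0")
        case False
        let ?M = "max \<bar>x\<bar> \<bar>y\<bar>"
        have "\<bar>x\<bar> powr (q - 1) * \<bar>y\<bar> \<le> ?M powr (q - 1) * ?M powr 1"
          using q by (intro mult_mono powr_mono2) auto
        also have "\<dots> = ?M powr q" unfolding powr_add[symmetric] by simp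
        also have "\<dots> \<le> \<bar>x\<bar> powr q + \<bar>y\<bar> powr q" by (auto simp: max_def)
        finally show ?thesis .
      qed auto
      \<comment> \<open>Hoelder inequality for the second order term, normalised so that the bracket has mean at most 1\<close>
      have Young2: "\<bar>x\<bar> powr (q - 2) * y\<^sup>2 \<le> B powr (q - 2) * a\<^sup>2 * ((1 - 2 / q) * (\<bar>x\<bar> powr q / B powr q) + (2 / q) * (\<bar>y\<bar> powr q / a powr q))" for x y :: real
      proof (cases "q = 2")
        case True
        then show ?thesis using a B by (simp add: powr_numeral)
      next
        case False
        with q have q2: "2 < q" by simp
        have "((\<bar>y\<bar> / a) powr q) powr (2 / q) * ((\<bar>x\<bar> / B) powr q) powr (1 - 2 / q) \<le>
           (2 / q) * (\<bar>y\<bar> / a) powr q + (1 - 2 / q) * (\<bar>x\<bar> / B) powr q"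
          using q2 by (intro Young_powr) auto
        also have "((\<bar>y\<bar> / a) powr q) powr (2 / q) = y\<^sup>2 / a\<^sup>2"
          using q2 a by (simp add: powr_powr power_divide)
        also have "((\<bar>x\<bar> / B) powr q) powr (1 - 2 / q) = \<bar>x\<bar> powr (q - 2) / B powr (q - 2)"
          using q2 B by (simp add: powr_powr powr_divide right_diff_distrib)
        finally have "(y\<^sup>2 / a\<^sup>2) * (\<bar>x\<bar> powr (q - 2) / B powr (q - 2)) \<le> (1 - 2 / q) * (\<bar>x\<bar> powr q / B powr q) + (2 / q) * (\<bar>y\<bar> powr q / a powr q)"
          using a B by (simp add: powr_divide)
        from mult_left_mono[OF this, of "B powr (q - 2) * a\<^sup>2"] show ?thesis
          using a B by (simp add: field_simps)
      qed
      have cross: "integrable S (\<lambda>e. (q * sgn (V e) * \<bar>V e\<bar> powr (q - 1)) * f e)"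
      proof (rule Bochner_Integration.integrable_bound)
        show "integrable S (\<lambda>e. q * (\<bar>V e\<bar> powr q + \<bar>f e\<bar> powr q))" using Vi fi by auto
        show "AE e in S. norm ((q * sgn (V e) * \<bar>V e\<bar> powr (q - 1)) * f e) \<le> norm (q * (\<bar>V e\<bar> powr q + \<bar>f e\<bar> powr q))"
        proof (rule AE_I2)
          fix e
          have "norm ((q * sgn (V e) * \<bar>V e\<bar> powr (q - 1)) * f e) = q * \<bar>sgn (V e)\<bar> * (\<bar>V e\<bar> powr (q - 1) * \<bar>f e\<bar>)"
            using q by (simp add: abs_mult)
          also have "\<dots> \<le> q * 1 * (\<bar>V e\<bar> powr q + \<bar>f e\<bar> powr q)"
            using q by (intro mult_mono Young1) (auto simp: sgn_if)
          also have "\<dots> \<le> norm (q * (\<bar>V e\<bar> powr q + \<bar>f e\<bar> powr q))" by simp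
          finally show "norm ((q * sgn (V e) * \<bar>V e\<bar> powr (q - 1)) * f e) \<le> norm (q * (\<bar>V e\<bar> powr q + \<bar>f e\<bar> powr q))" .
        qed
      qed measurable
      \<comment> \<open>the first order term vanishes, as \<open>f\<close> is a martingale difference\<close>
      have cross0: "(\<integral>e. (q * sgn (V e) * \<bar>V e\<bar> powr (q - 1)) * f e \<partial>S) = 0"
      proof -
        have "(\<integral>e. (q * sgn (V e) * \<bar>V e\<bar> powr (q - 1)) * f e \<partial>S) = (\<integral>e. (q * sgn (U e) * \<bar>U e\<bar> powr (q - 1)) * avg 1 f e \<partial>S)"
          using integral_mult_shift[of "\<lambda>e. q * sgn (U e) * \<bar>U e\<bar> powr (q - 1)" 1 f] cross by (simp add: V_def)
        also have "\<dots> = (\<integral>e. 0 \<partial>S)"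
        proof (rule integral_cong_AE)
          show "AE e in S. (q * sgn (U e) * \<bar>U e\<bar> powr (q - 1)) * avg 1 f e = 0"
            using mart by eventually_elim simp
        qed measurable
        finally show ?thesis by simp
      qed
      define H where "H e = \<bar>V e\<bar> powr q + (q * sgn (V e) * \<bar>V e\<bar> powr (q - 1)) * f e +
         C * (B powr (q - 2) * a\<^sup>2 * ((1 - 2 / q) * (\<bar>V e\<bar> powr q / B powr q) + (2 / q) * (\<bar>f e\<bar> powr q / a powr q)) + \<bar>f e\<bar> powr q)" for e
      have Hi: "integrable S H" unfolding H_def using Vi fi cross by auto
      have le: "\<bar>V e + f e\<bar> powr q \<le> H e" for e
      proof -
        have "\<bar>V e + f e\<bar> powr q \<le> \<bar>V e\<bar> powr q + q * sgn (V e) * \<bar>V e\<bar> powr (q - 1) * f e + C * (\<bar>V e\<bar> powr (q - 2) * (f e)\<^sup>2 + \<bar>f e\<bar> powr q)"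
          unfolding C_def by (rule abs_powr_add_le[OF q])
        also have "\<dots> \<le> H e" unfolding H_def
          by (intro add_left_mono mult_left_mono[OF _ C] add_right_mono Young2)
        finally show ?thesis .
      qed
      have int: "integrable S (\<lambda>e. \<bar>V e + f e\<bar> powr q)"
        by (rule Bochner_Integration.integrable_bound[OF Hi]) (use le in \<open>auto intro!: AE_I2 intro: order_trans[OF _ abs_ge_self]\<close>)
      have "(\<integral>e. \<bar>V e + f e\<bar> powr q \<partial>S) \<le> (\<integral>e. H e \<partial>S)"
        by (rule integral_mono[OF int Hi le])
      also have "\<dots> = (\<integral>e. \<bar>V e\<bar> powr q \<partial>S) + C * (B powr (q - 2) * a\<^sup>2 * ((1 - 2 / q) * ((\<integral>e. \<bar>V e\<bar> powr q \<partial>S) / B powr q) + (2 / q) * ((\<integral>e. \<bar>f e\<bar> powr q \<partial>S) / a powr q)) + (\<integral>e. \<bar>f e\<bar> powr q \<partial>S))"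
        unfolding H_def using Vi(1) fi(1) cross cross0 by simp
      also have "\<dots> \<le> B powr q + C * (B powr (q - 2) * a\<^sup>2 * ((1 - 2 / q) * (B powr q / B powr q) + (2 / q) * (a powr q / a powr q)) + a powr q)"
        using Vi(2) fi(2) C q by (intro add_mono mult_left_mono divide_right_mono) auto
      also have "\<dots> = B powr q + C * (B powr (q - 2) * a\<^sup>2 + a powr q)"
        using a B q by (simp add: field_simps)
      also have "\<dots> = a powr q * ((?L * real n) powr (q / 2) + C * ((?L * real n) powr (q / 2 - 1) + 1))"
      proof -
        have "B powr q = a powr q * (?L * real n) powr (q / 2)"
          using L a by (simp add: B_def powr_mult powr_half_sqrt[symmetric] powr_powr del: real_sqrt_mult)
        moreover have "B powr (q - 2) * a\<^sup>2 = a powr q * (?L * real n) powr (q / 2 - 1)"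
        proof -
          have "B powr (q - 2) = a powr (q - 2) * (?L * real n) powr (q / 2 - 1)"
            using L a by (simp add: B_def powr_mult powr_half_sqrt[symmetric] powr_powr diff_divide_distrib del: real_sqrt_mult)
          moreover have "a powr (q - 2) * a\<^sup>2 = a powr q" using a by (simp add: powr_diff)
          ultimately show ?thesis by (simp add: mult_ac)
        qed
        ultimately show ?thesis by (simp add: algebra_simps)
      qed
      also have "\<dots> \<le> a powr q * (?L * real (Suc n)) powr (q / 2)"
        using q L C False by (intro mult_left_mono powr_step_le) (auto simp: mart_const_def C_def)
      also have "\<dots> = (sqrt (?L * real (Suc n)) * a) powr q"
        using L a by (simp add: powr_mult powr_half_sqrt[symmetric] powr_powr del: real_sqrt_mult of_nat_Suc)
      finally show ?thesis
        unfolding sumSuc using int a L by (subst Lq_le_iff_integral) auto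
    qed
  qed
  show "Lq_le S q (\<lambda>e. \<Sum>s<n. f (shift s e)) (sqrt (?L * real n) * A + \<epsilon>)"
  proof (rule Lq_le_mono[OF main])
    have "sqrt (?L * real n) + 1 \<noteq> 0" using sp by linarith
    then have "(sqrt (?L * real n) + 1) * d = \<epsilon>" by (simp add: d_def)
    then have "sqrt (?L * real n) * d \<le> \<epsilon>" using d by (simp add: distrib_right)
    then show "sqrt (?L * real n) * a \<le> sqrt (?L * real n) * A + \<epsilon>" by (simp add: a_def distrib_left)
  qed (use q in simp)
qed (use f q mart_const_ge_1[of q] in \<open>auto simp: Lq_le_def intro!: mult_nonneg_nonneg\<close>)

end

section \<open>Innovations and the effect of resampling\<close>

context sequence_space
begin

interpretation SS: pair_sigma_finite S S ..

text \<open>What the newest coordinate of \<open>e\<close> adds to the prediction of \<open>h\<close> at \<open>i\<close> steps into the future.\<close>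

definition innov :: "nat \<Rightarrow> ((nat \<Rightarrow> 'a) \<Rightarrow> real) \<Rightarrow> (nat \<Rightarrow> 'a) \<Rightarrow> real" where
  "innov i h e = avg i h e - avg (Suc i) h (shift 1 e)"

lemma borel_measurable_innov [measurable]:
  assumes [measurable]: "h \<in> borel_measurable S"
  shows "innov i h \<in> borel_measurable S"
  unfolding innov_def by measurable

lemma avg_innov:
  assumes h: "integrable S h"
  shows "AE e in S. avg 1 (innov i h) e = 0"
proof -
  have "AE e in S. avg 1 (\<lambda>e. avg i h e - avg (Suc i) h (shift 1 e)) e =
      avg 1 (avg i h) e - avg 1 (\<lambda>e. avg (Suc i) h (shift 1 e)) e"
    by (intro avg_diff integrable_avg integrable_shift h)
  moreover have "avg 1 (\<lambda>e. avg (Suc i) h (shift 1 e)) e = avg (Suc i) h e" for e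
    using avg_mult_shift[of 1 "avg (Suc i) h" "\<lambda>_. 1" e] by (simp add: avg_def P.prob_space)
  moreover have "AE e in S. avg 1 (avg i h) e = avg (i + 1) h e" by (rule avg_avg[OF h])
  ultimately show ?thesis
    by (auto simp: innov_def[abs_def] elim!: eventually_elim2)
qed

lemma avg_telescope:
  "avg k h e = (\<Sum>i<I. innov (k + i) h (shift i e)) + avg (k + I) h (shift I e)"
  by (induction I) (simp_all add: innov_def)

lemma measurable_upd [measurable]: "(\<lambda>(x, y). x(i := y (0::nat))) \<in> S \<Otimes>\<^sub>M S \<rightarrow>\<^sub>M S"
proof (rule measurable_PiM_single')
  fix j :: nat
  show "(\<lambda>z. (case z of (x, y) \<Rightarrow> x(i := y (0::nat))) j) \<in> S \<Otimes>\<^sub>M S \<rightarrow>\<^sub>M M"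
    by (cases "j = i") (simp_all add: case_prod_beta')
qed (auto simp: space_PiM PiE_iff extensional_def space_pair_measure)

text \<open>Resampling coordinate \<open>i\<close> independently moves \<open>h\<close> by at most \<open>A\<close> in norm. For \<open>h = g\<close> this is the dependence
coefficient of the process at time \<open>i\<close>. The resampled value is taken from a whole independent sequence to
stay on products of the sequence space.\<close>

definition influence_le :: "real \<Rightarrow> ((nat \<Rightarrow> 'a) \<Rightarrow> real) \<Rightarrow> nat \<Rightarrow> real \<Rightarrow> bool" where
  "influence_le q h i A \<longleftrightarrow> Lq_le (S \<Otimes>\<^sub>M S) q (\<lambda>(x, y). h x - h (x(i := y 0))) A"

lemma upd_comb_seq: "(comb_seq i \<omega> e)(i := y 0) = comb_seq (Suc i) (comb_seq i \<omega> y) (shift 1 e)"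
  by (auto simp: comb_seq_def shift_def fun_eq_iff not_less Suc_le_eq Suc_diff_Suc)

lemma comb_seq_upd: "comb_seq k \<omega> (x(i := a)) = (comb_seq k \<omega> x)(k + i := a)"
  by (auto simp: comb_seq_def fun_eq_iff)

text \<open>Once the coordinates newer than \<open>i\<close> are split off, the resampled sequence is a concatenation of
independent pieces.\<close>

lemma distr_upd: "distr (S \<Otimes>\<^sub>M S) S (\<lambda>(x, y). x(i := y 0)) = S"
proof (rule measure_eqI)
  fix A assume "A \<in> sets (distr (S \<Otimes>\<^sub>M S) S (\<lambda>(x, y). x(i := y 0)))"
  then have A[measurable]: "A \<in> sets S" by simp
  let ?f = "indicator A :: _ \<Rightarrow> ennreal"
  have "emeasure (distr (S \<Otimes>\<^sub>M S) S (\<lambda>(x, y). x(i := y 0))) A = (\<integral>\<^sup>+z. ?f z \<partial>distr (S \<Otimes>\<^sub>M S) S (\<lambda>(x, y). x(i := y 0)))"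
    by simp
  also have "\<dots> = (\<integral>\<^sup>+z. ?f (case z of (x, y) \<Rightarrow> x(i := y 0)) \<partial>(S \<Otimes>\<^sub>M S))"
    by (rule nn_integral_distr) measurable
  also have "\<dots> = (\<integral>\<^sup>+y. \<integral>\<^sup>+x. ?f (x(i := y 0)) \<partial>S \<partial>S)"
    using SS.nn_integral_snd[of "\<lambda>z. ?f (case z of (x, y) \<Rightarrow> x(i := y 0))"] by simp
  also have "\<dots> = (\<integral>\<^sup>+y. \<integral>\<^sup>+e. \<integral>\<^sup>+\<omega>. ?f ((comb_seq i \<omega> e)(i := y 0)) \<partial>S \<partial>S \<partial>S)"
  proof (rule nn_integral_cong)
    fix y assume y: "y \<in> space S"
    have "(\<lambda>x. x(i := y 0)) \<in> S \<rightarrow>\<^sub>M S"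
      using measurable_Pair2'[of y S S] measurable_upd[of i] y measurable_compose[OF measurable_Pair1'[of y S S] measurable_upd[of i]] by simp
    then have "(\<lambda>x. ?f (x(i := y 0))) \<in> borel_measurable S" by measurable
    from nn_integral_comb[OF this, of i]
    show "(\<integral>\<^sup>+x. ?f (x(i := y 0)) \<partial>S) = (\<integral>\<^sup>+e. \<integral>\<^sup>+\<omega>. ?f ((comb_seq i \<omega> e)(i := y 0)) \<partial>S \<partial>S)" by simp
  qed
  also have "\<dots> = (\<integral>\<^sup>+y. \<integral>\<^sup>+e. \<integral>\<^sup>+\<omega>. ?f (comb_seq (Suc i) (comb_seq i \<omega> y) (shift 1 e)) \<partial>S \<partial>S \<partial>S)"
    by (simp only: upd_comb_seq)
  also have "\<dots> = (\<integral>\<^sup>+e. \<integral>\<^sup>+y. \<integral>\<^sup>+\<omega>. ?f (comb_seq (Suc i) (comb_seq i \<omega> y) (shift 1 e)) \<partial>S \<partial>S \<partial>S)"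
    by (rule SS.Fubini') measurable
  also have "\<dots> = (\<integral>\<^sup>+e. \<integral>\<^sup>+z. ?f (comb_seq (Suc i) z (shift 1 e)) \<partial>S \<partial>S)"
    by (intro nn_integral_cong nn_integral_comb[of "\<lambda>z. ?f (comb_seq (Suc i) z (shift 1 _))"]) measurable
  also have "\<dots> = (\<integral>\<^sup>+e. \<integral>\<^sup>+z. ?f (comb_seq (Suc i) z e) \<partial>S \<partial>S)"
    by (rule nn_integral_shift[of "\<lambda>e. \<integral>\<^sup>+z. ?f (comb_seq (Suc i) z e) \<partial>S"]) measurable
  also have "\<dots> = emeasure S A" by (subst nn_integral_comb) auto
  finally show "emeasure (distr (S \<Otimes>\<^sub>M S) S (\<lambda>(x, y). x(i := y 0))) A = emeasure S A" .
qed simp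

lemma AE_upd:
  assumes "AE x in S. Q x"
  shows "AE z in S \<Otimes>\<^sub>M S. Q ((fst z)(i := snd z 0))"
proof -
  from assms have "AE x in distr (S \<Otimes>\<^sub>M S) S (\<lambda>(x, y). x(i := y 0)). Q x" unfolding distr_upd .
  from AE_distrD[OF _ this] show ?thesis by (simp add: case_prod_beta')
qed

lemma AE_fst:
  assumes "AE x in S. Q x"
  shows "AE z in S \<Otimes>\<^sub>M S. Q (fst z)"
proof -
  from assms have "AE x in distr (S \<Otimes>\<^sub>M S) S fst. Q x" unfolding distr_fst_S .
  from AE_distrD[OF _ this] show ?thesis by simp
qed

text \<open>An innovation is the conditional expectation of the effect of resampling, because the second prediction
averages over the coordinate that the first one knows.\<close>

lemma Lq_le_innov:
  assumes h: "integrable S h" and infl: "influence_le q h i A" and q: "1 \<le> q"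
  shows "Lq_le S q (innov i h) A"
proof -
  have [measurable]: "h \<in> borel_measurable S" using h by auto
  let ?F = "\<lambda>e z. case z of (\<omega>, y) \<Rightarrow> h (comb_seq i \<omega> e) - h ((comb_seq i \<omega> e)(i := y 0))"
  have [measurable]: "(\<lambda>(e, z). ?F e z) \<in> borel_measurable (S \<Otimes>\<^sub>M (S \<Otimes>\<^sub>M S))"
    unfolding upd_comb_seq by measurable
  have PP: "prob_space (S \<Otimes>\<^sub>M S)"
    by (rule prob_space_pair) (rule P.prob_space_axioms)+
  have Gm[measurable]: "(\<lambda>(x, y). h x - h (x(i := y 0))) \<in> borel_measurable (S \<Otimes>\<^sub>M S)"
    using infl by (simp add: influence_le_def Lq_le_def)
  let ?G = "\<lambda>x y. ennreal (\<bar>h x - h (x(i := y 0))\<bar> powr q)"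
  have Gm2[measurable]: "(\<lambda>z. case z of (x, y) \<Rightarrow> ?G x y) \<in> borel_measurable (S \<Otimes>\<^sub>M S)"
    using measurable_compose[OF Gm, of "\<lambda>t. ennreal (\<bar>t\<bar> powr q)" borel] by (simp add: case_prod_beta')
  have "(\<integral>\<^sup>+w. ennreal (\<bar>case w of (e, z) \<Rightarrow> ?F e z\<bar> powr q) \<partial>(S \<Otimes>\<^sub>M (S \<Otimes>\<^sub>M S))) =
      (\<integral>\<^sup>+e. \<integral>\<^sup>+z. ennreal (\<bar>?F e z\<bar> powr q) \<partial>(S \<Otimes>\<^sub>M S) \<partial>S)"
    by (subst sigma_finite_measure.nn_integral_fst[OF prob_space_imp_sigma_finite[OF PP], symmetric]) auto
  also have "\<dots> = (\<integral>\<^sup>+e. \<integral>\<^sup>+\<omega>. \<integral>\<^sup>+y. ?G (comb_seq i \<omega> e) y \<partial>S \<partial>S \<partial>S)"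
  proof (rule nn_integral_cong)
    fix e assume [measurable]: "e \<in> space S"
    have "(\<lambda>z. ennreal (\<bar>?F e z\<bar> powr q)) \<in> borel_measurable (S \<Otimes>\<^sub>M S)"
      unfolding upd_comb_seq by measurable
    from P.nn_integral_fst[OF this]
    show "(\<integral>\<^sup>+z. ennreal (\<bar>?F e z\<bar> powr q) \<partial>(S \<Otimes>\<^sub>M S)) = (\<integral>\<^sup>+\<omega>. \<integral>\<^sup>+y. ?G (comb_seq i \<omega> e) y \<partial>S \<partial>S)"
      by simp
  qed
  also have "\<dots> = (\<integral>\<^sup>+x. \<integral>\<^sup>+y. ?G x y \<partial>S \<partial>S)"
    using P.borel_measurable_nn_integral_fst[OF Gm2]
    by (intro nn_integral_comb[of "\<lambda>x. \<integral>\<^sup>+y. ?G x y \<partial>S"]) simp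
  also have "\<dots> = (\<integral>\<^sup>+z. (case z of (x, y) \<Rightarrow> ?G x y) \<partial>(S \<Otimes>\<^sub>M S))"
    using P.nn_integral_fst[OF Gm2] by simp
  also have "\<dots> \<le> ennreal (A powr q)"
    using infl by (simp add: influence_le_def Lq_le_def case_prod_beta')
  finally have "Lq_le (S \<Otimes>\<^sub>M (S \<Otimes>\<^sub>M S)) q (\<lambda>(e, z). ?F e z) A"
    using infl by (simp add: influence_le_def Lq_le_def)
  from Lq_le_integral_snd[OF PP P.sigma_finite_measure_axioms this q]
  have L: "Lq_le S q (\<lambda>e. \<integral>z. ?F e z \<partial>(S \<Otimes>\<^sub>M S)) A" .
  show ?thesis
  proof (rule Lq_le_AE_cong[OF L])
    show "AE e in S. (\<integral>z. ?F e z \<partial>(S \<Otimes>\<^sub>M S)) = innov i h e"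
      using AE_integrable_comb[OF h, of i] AE_shift[OF AE_integrable_comb[OF h, of "Suc i"], of 1]
    proof eventually_elim
      case (elim e)
      let ?h1 = "\<lambda>\<omega>. h (comb_seq i \<omega> e)" and ?h2 = "\<lambda>z. h (comb_seq (Suc i) z (shift 1 e))"
      from elim(1) have i1: "integrable (distr (S \<Otimes>\<^sub>M S) S fst) ?h1" unfolding distr_fst_S .
      from elim(2) have i2: "integrable (distr (S \<Otimes>\<^sub>M S) S (\<lambda>(\<omega>, y). comb_seq i \<omega> y)) ?h2" unfolding PiM_comb_seq .
      have [measurable]: "?h1 \<in> borel_measurable S" "?h2 \<in> borel_measurable S" using elim by auto
      have "(\<integral>z. ?F e z \<partial>(S \<Otimes>\<^sub>M S)) = (\<integral>z. ?h1 (fst z) - ?h2 (case z of (\<omega>, y) \<Rightarrow> comb_seq i \<omega> y) \<partial>(S \<Otimes>\<^sub>M S))"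
        by (intro Bochner_Integration.integral_cong) (auto simp: upd_comb_seq)
      also have "\<dots> = (\<integral>z. ?h1 (fst z) \<partial>(S \<Otimes>\<^sub>M S)) - (\<integral>z. ?h2 (case z of (\<omega>, y) \<Rightarrow> comb_seq i \<omega> y) \<partial>(S \<Otimes>\<^sub>M S))"
        by (intro Bochner_Integration.integral_diff integrable_distr[OF _ i1] integrable_distr[OF _ i2]) measurable
      also have "(\<integral>z. ?h1 (fst z) \<partial>(S \<Otimes>\<^sub>M S)) = (\<integral>\<omega>. ?h1 \<omega> \<partial>distr (S \<Otimes>\<^sub>M S) S fst)"
        by (rule integral_distr[symmetric]) measurable
      also have "\<dots> = avg i h e" unfolding distr_fst_S by (simp add: avg_def)
      also have "(\<integral>z. ?h2 (case z of (\<omega>, y) \<Rightarrow> comb_seq i \<omega> y) \<partial>(S \<Otimes>\<^sub>M S)) = (\<integral>\<omega>. ?h2 \<omega> \<partial>distr (S \<Otimes>\<^sub>M S) S (\<lambda>(\<omega>, y). comb_seq i \<omega> y))"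
        by (rule integral_distr[symmetric]) measurable
      also have "\<dots> = avg (Suc i) h (shift 1 e)" unfolding PiM_comb_seq by (simp add: avg_def)
      finally show ?case unfolding innov_def .
    qed
  qed measurable
qed

text \<open>A prediction \<open>k\<close> steps ahead depends on coordinate \<open>i\<close> at most as much as its target depends on coordinate
\<open>k + i\<close>.\<close>

lemma influence_le_avg:
  assumes h: "integrable S h" and infl: "influence_le q h (k + i) A" and q: "1 \<le> q"
  shows "influence_le q (avg k h) i A"
proof -
  have [measurable]: "h \<in> borel_measurable S" using h by auto
  let ?F = "\<lambda>z \<omega>. h (comb_seq k \<omega> (fst z)) - h ((comb_seq k \<omega> (fst z))(k + i := snd z 0))"
  have Feq: "?F z \<omega> = h (comb_seq k \<omega> (fst z)) - h (comb_seq k \<omega> (case z of (x, y) \<Rightarrow> x(i := y 0)))" for z \<omega>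
    by (simp add: comb_seq_upd case_prod_beta')
  have PP: "prob_space (S \<Otimes>\<^sub>M S)"
    by (rule prob_space_pair) (rule P.prob_space_axioms)+
  have Fm[measurable]: "(\<lambda>(z, \<omega>). ?F z \<omega>) \<in> borel_measurable ((S \<Otimes>\<^sub>M S) \<Otimes>\<^sub>M S)"
    unfolding Feq by measurable
  let ?G = "\<lambda>x y. ennreal (\<bar>h x - h (x(k + i := y 0))\<bar> powr q)"
  have Gm[measurable]: "(\<lambda>(x, y). h x - h (x(k + i := y 0))) \<in> borel_measurable (S \<Otimes>\<^sub>M S)"
    using infl by (simp add: influence_le_def Lq_le_def)
  have Gm2[measurable]: "(\<lambda>z. case z of (x, y) \<Rightarrow> ?G x y) \<in> borel_measurable (S \<Otimes>\<^sub>M S)"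
    using measurable_compose[OF Gm, of "\<lambda>t. ennreal (\<bar>t\<bar> powr q)" borel] by (simp add: case_prod_beta')
  have Fm2: "(\<lambda>w. case w of (z, \<omega>) \<Rightarrow> ennreal (\<bar>?F z \<omega>\<bar> powr q)) \<in> borel_measurable ((S \<Otimes>\<^sub>M S) \<Otimes>\<^sub>M S)"
    using measurable_compose[OF Fm, of "\<lambda>t. ennreal (\<bar>t\<bar> powr q)" borel] by (simp add: case_prod_beta')
  have "(\<integral>\<^sup>+w. ennreal (\<bar>case w of (z, \<omega>) \<Rightarrow> ?F z \<omega>\<bar> powr q) \<partial>((S \<Otimes>\<^sub>M S) \<Otimes>\<^sub>M S)) =
      (\<integral>\<^sup>+z. \<integral>\<^sup>+\<omega>. ennreal (\<bar>?F z \<omega>\<bar> powr q) \<partial>S \<partial>(S \<Otimes>\<^sub>M S))"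
    using P.nn_integral_fst[OF Fm2] by (simp add: case_prod_beta')
  also have "\<dots> = (\<integral>\<^sup>+y. \<integral>\<^sup>+x. \<integral>\<^sup>+\<omega>. ?G (comb_seq k \<omega> x) y \<partial>S \<partial>S \<partial>S)"
    using SS.nn_integral_snd[OF P.borel_measurable_nn_integral_fst[OF Fm2]] by simp
  also have "\<dots> = (\<integral>\<^sup>+y. \<integral>\<^sup>+x. ?G x y \<partial>S \<partial>S)"
  proof (rule nn_integral_cong)
    fix y assume "y \<in> space S"
    then have "(\<lambda>x. ?G x y) \<in> borel_measurable S"
      using measurable_compose[OF measurable_Pair1'[of y S S] Gm2] by simp
    then show "(\<integral>\<^sup>+x. \<integral>\<^sup>+\<omega>. ?G (comb_seq k \<omega> x) y \<partial>S \<partial>S) = (\<integral>\<^sup>+x. ?G x y \<partial>S)"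
      by (rule nn_integral_comb)
  qed
  also have "\<dots> = (\<integral>\<^sup>+z. (case z of (x, y) \<Rightarrow> ?G x y) \<partial>(S \<Otimes>\<^sub>M S))"
    using SS.nn_integral_snd[OF Gm2] by simp
  also have "\<dots> \<le> ennreal (A powr q)"
    using infl by (simp add: influence_le_def Lq_le_def case_prod_beta')
  finally have "Lq_le ((S \<Otimes>\<^sub>M S) \<Otimes>\<^sub>M S) q (\<lambda>(z, \<omega>). ?F z \<omega>) A"
    using infl by (simp add: influence_le_def Lq_le_def)
  from Lq_le_integral_snd[OF P.prob_space_axioms prob_space_imp_sigma_finite[OF PP] this q]
  have L: "Lq_le (S \<Otimes>\<^sub>M S) q (\<lambda>z. \<integral>\<omega>. ?F z \<omega> \<partial>S) A" .
  show ?thesis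
    unfolding influence_le_def
  proof (rule Lq_le_AE_cong[OF L])
    show "AE z in S \<Otimes>\<^sub>M S. (\<integral>\<omega>. ?F z \<omega> \<partial>S) = (case z of (x, y) \<Rightarrow> avg k h x - avg k h (x(i := y 0)))"
      using AE_fst[OF AE_integrable_comb[OF h, of k]] AE_upd[OF AE_integrable_comb[OF h, of k], of i]
    proof eventually_elim
      case (elim z)
      then show ?case by (simp add: avg_def case_prod_beta' comb_seq_upd[symmetric])
    qed
    have "(\<lambda>z. avg k h (fst z) - avg k h (case z of (x, y) \<Rightarrow> x(i := y 0))) \<in> borel_measurable (S \<Otimes>\<^sub>M S)"
      by measurable
    then show "(\<lambda>(x, y). avg k h x - avg k h (x(i := y 0))) \<in> borel_measurable (S \<Otimes>\<^sub>M S)"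
      by (simp add: case_prod_beta')
  qed
qed

lemma influence_le_mult:
  assumes u: "Lq_le S (2 * q) u U" "influence_le (2 * q) u i a"
    and v: "Lq_le S (2 * q) v V" "influence_le (2 * q) v i b" and q: "1 \<le> q"
  shows "influence_le q (\<lambda>e. u e * v e) i (a * V + U * b)"
proof -
  have 1: "Lq_le (S \<Otimes>\<^sub>M S) (2 * q) (\<lambda>z. v (fst z)) V"
    by (rule Lq_le_distr[OF measurable_fst distr_fst_S v(1)])
  have 2: "Lq_le (S \<Otimes>\<^sub>M S) (2 * q) (\<lambda>z. u (case z of (x, y) \<Rightarrow> x(i := y 0))) U"
    by (rule Lq_le_distr[OF measurable_upd distr_upd u(1)])
  have "Lq_le (S \<Otimes>\<^sub>M S) q (\<lambda>z. (case z of (x, y) \<Rightarrow> u x - u (x(i := y 0))) * v (fst z) +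
      u (case z of (x, y) \<Rightarrow> x(i := y 0)) * (case z of (x, y) \<Rightarrow> v x - v (x(i := y 0)))) (a * V + U * b)"
    using 1 2 u v q unfolding influence_le_def by (intro Lq_le_add Lq_le_mult) auto
  then show ?thesis unfolding influence_le_def
    by (rule back_subst[where P = "\<lambda>f. Lq_le (S \<Otimes>\<^sub>M S) q f (a * V + U * b)"]) (auto simp: algebra_simps)
qed

lemma influence_le_diff_const: "influence_le q h i A \<Longrightarrow> influence_le q (\<lambda>e. h e - c) i A"
  by (simp add: influence_le_def)

end

section \<open>Decay of predictions and correlations\<close>

context sequence_space
begin

text \<open>A prediction is the sum of the innovations of the past, and by mixing the contribution of the remote past
vanishes.\<close>

lemma Lq_le_avg_of_innov:
  assumes h: "integrable S h" and mean: "(\<integral>e. h e \<partial>S) = 0"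
    and b: "\<And>i. Lq_le S q (innov i h) (b i)" and B: "\<And>I. (\<Sum>i<I. b (k + i)) \<le> B" and q: "1 \<le> q"
  shows "Lq_le S q (avg k h) B"
proof (rule Lq_le_L1_limit[where g = "\<lambda>I e. \<Sum>i<I. innov (k + i) h (shift i e)"])
  have [measurable]: "h \<in> borel_measurable S" using h by auto
  show "avg k h \<in> borel_measurable S" by measurable
  show "Lq_le S q (\<lambda>e. \<Sum>i<I. innov (k + i) h (shift i e)) B" for I
    by (rule Lq_le_mono[OF Lq_le_sum[OF Lq_le_shift[OF b] q] B]) (use q in simp)
  have eq: "avg k h e - (\<Sum>i<I. innov (k + i) h (shift i e)) = avg (k + I) h (shift I e)" for I e
    using avg_telescope[of k h e I] by simp
  show "integrable S (\<lambda>e. avg k h e - (\<Sum>i<I. innov (k + i) h (shift i e)))" for I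
    unfolding eq by (intro integrable_shift integrable_avg h)
  have "(\<integral>e. \<bar>avg (k + I) h (shift I e)\<bar> \<partial>S) = mixdev h (I + k)" for I
    using integral_shift[of "\<lambda>e. \<bar>avg (k + I) h e\<bar>" I] by (simp add: mixdev_def mean add.commute)
  then show "(\<lambda>I. \<integral>e. \<bar>avg k h e - (\<Sum>i<I. innov (k + i) h (shift i e))\<bar> \<partial>S) \<longlonglongrightarrow> 0"
    unfolding eq using LIMSEQ_ignore_initial_segment[OF mixdev_tendsto_0[OF h], of k] by simp
qed (use q in simp)

text \<open>For each \<open>i\<close> the innovations at distance \<open>i\<close> form a stationary martingale difference sequence, so the
moment inequality applies to each of them and the triangle inequality to their sum.\<close>

lemma Lq_le_sum_of_innov:
  assumes h: "integrable S h" and mean: "(\<integral>e. h e \<partial>S) = 0"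
    and b: "\<And>i. Lq_le S q (innov i h) (b i)" and B: "\<And>I. (\<Sum>i<I. b i) \<le> B" and q: "2 \<le> q"
  shows "Lq_le S q (\<lambda>e. \<Sum>s<n. h (shift s e)) (sqrt (mart_const q * real n) * B)"
proof (rule Lq_le_L1_limit[where g = "\<lambda>I e. \<Sum>i<I. \<Sum>s<n. innov i h (shift (i + s) e)"])
  let ?c = "sqrt (mart_const q * real n)"
  have [measurable]: "h \<in> borel_measurable S" using h by auto
  show "(\<lambda>e. \<Sum>s<n. h (shift s e)) \<in> borel_measurable S" by measurable
  have "Lq_le S q (\<lambda>e. \<Sum>s<n. innov i h (shift (i + s) e)) (?c * b i)" for i
    using Lq_le_shift[OF Lq_le_sum_martingale_difference[OF q b[of i] avg_innov[OF h], of n], of i] by simp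
  then have "Lq_le S q (\<lambda>e. \<Sum>i<I. \<Sum>s<n. innov i h (shift (i + s) e)) (\<Sum>i<I. ?c * b i)" for I
    using q by (intro Lq_le_sum) auto
  moreover have "(\<Sum>i<I. ?c * b i) \<le> ?c * B" for I
    unfolding sum_distrib_left[symmetric] using mart_const_ge_1[of q] by (intro mult_left_mono B) simp
  ultimately show "Lq_le S q (\<lambda>e. \<Sum>i<I. \<Sum>s<n. innov i h (shift (i + s) e)) (?c * B)" for I
    by (rule Lq_le_mono) (use q in simp)
  have eq: "(\<Sum>s<n. h (shift s e)) - (\<Sum>i<I. \<Sum>s<n. innov i h (shift (i + s) e)) = (\<Sum>s<n. avg I h (shift (s + I) e))" for I e
  proof -
    have "h (shift s e) = (\<Sum>i<I. innov i h (shift (i + s) e)) + avg I h (shift (s + I) e)" for s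
      using avg_telescope[of 0 h "shift s e" I] by (simp add: add.commute)
    then have "(\<Sum>s<n. h (shift s e)) = (\<Sum>s<n. \<Sum>i<I. innov i h (shift (i + s) e)) + (\<Sum>s<n. avg I h (shift (s + I) e))"
      by (simp add: sum.distrib)
    then show ?thesis by (subst sum.swap) simp
  qed
  have i: "integrable S (\<lambda>e. avg I h (shift (s + I) e))" for s I
    by (intro integrable_shift integrable_avg h)
  show "integrable S (\<lambda>e. (\<Sum>s<n. h (shift s e)) - (\<Sum>i<I. \<Sum>s<n. innov i h (shift (i + s) e)))" for I
    unfolding eq by (intro Bochner_Integration.integrable_sum i)
  have "(\<integral>e. \<bar>\<Sum>s<n. avg I h (shift (s + I) e)\<bar> \<partial>S) \<le> real n * mixdev h I" for I
  proof -
    have "(\<integral>e. \<bar>\<Sum>s<n. avg I h (shift (s + I) e)\<bar> \<partial>S) \<le> (\<integral>e. (\<Sum>s<n. \<bar>avg I h (shift (s + I) e)\<bar>) \<partial>S)"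
      by (intro integral_mono integrable_abs Bochner_Integration.integrable_sum i sum_abs)
    also have "\<dots> = (\<Sum>s<n. (\<integral>e. \<bar>avg I h (shift (s + I) e)\<bar> \<partial>S))"
      by (intro Bochner_Integration.integral_sum integrable_abs i)
    also have "\<dots> = (\<Sum>s<n. mixdev h I)"
      using integral_shift[of "\<lambda>e. \<bar>avg I h e\<bar>"] by (simp add: mixdev_def mean)
    finally show ?thesis by simp
  qed
  moreover have "(\<lambda>I. real n * mixdev h I) \<longlonglongrightarrow> 0"
    using tendsto_mult[OF tendsto_const mixdev_tendsto_0[OF h], of "real n"] by simp
  ultimately show "(\<lambda>I. \<integral>e. \<bar>(\<Sum>s<n. h (shift s e)) - (\<Sum>i<I. \<Sum>s<n. innov i h (shift (i + s) e))\<bar> \<partial>S) \<longlonglongrightarrow> 0"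
    unfolding eq by (rule tendsto_0_squeeze[rotated]) simp
qed (use q in simp)

lemma integral_mult_Lq_2:
  assumes "Lq_le S 2 u A" "Lq_le S 2 v B"
  shows "integrable S (\<lambda>e. u e * v e)" "\<bar>\<integral>e. u e * v e \<partial>S\<bar> \<le> A * B"
proof -
  have L: "Lq_le S 1 (\<lambda>e. u e * v e) (A * B)" using assms by (intro Lq_le_mult) auto
  show "integrable S (\<lambda>e. u e * v e)" by (rule Lq_le_integrable(1)[OF P.prob_space_axioms L]) simp
  show "\<bar>\<integral>e. u e * v e \<partial>S\<bar> \<le> A * B"
    by (rule order_trans[OF integral_abs_bound Lq_le_integrable(2)[OF P.prob_space_axioms L]]) simp
qed

definition acov :: "((nat \<Rightarrow> 'a) \<Rightarrow> real) \<Rightarrow> nat \<Rightarrow> real" where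
  "acov g k = (\<integral>e. g e * avg k g e \<partial>S)"

text \<open>Innovations at different times are orthogonal, so only products of innovations caused by the same
coordinate contribute to the correlation.\<close>

lemma autocovariance_bound:
  assumes h: "Lq_le S 2 h H" and mean: "(\<integral>e. h e \<partial>S) = 0"
    and b: "\<And>i. Lq_le S 2 (innov i h) (b i)" and sum: "summable b"
  shows "\<bar>acov h k\<bar> \<le> (\<Sum>i. b i * b (k + i))"
proof -
  have hi: "integrable S h" using h by (rule Lq_le_S_integrable) simp
  have [measurable]: "h \<in> borel_measurable S" using hi by auto
  have b0: "0 \<le> b i" for i using b[of i] by (simp add: Lq_le_def)
  have H0: "0 \<le> H" using h by (simp add: Lq_le_def)
  have avgL: "Lq_le S 2 (avg k h) H" by (rule Lq_le_avg[OF h]) simp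
  have inc: "\<bar>\<integral>e. innov i h (shift i e) * avg k h e \<partial>S\<bar> \<le> b i * b (k + i)" for i
  proof -
    have "(\<integral>e. innov i h (shift i e) * avg k h e \<partial>S) = (\<integral>e. innov i h e * avg i (avg k h) e \<partial>S)"
      by (intro integral_mult_shift integral_mult_Lq_2(1)[OF Lq_le_shift[OF b] avgL]) measurable
    also have "\<dots> = (\<integral>e. innov i h e * avg (k + i) h e \<partial>S)"
    proof (rule integral_cong_AE)
      show "AE e in S. innov i h e * avg i (avg k h) e = innov i h e * avg (k + i) h e"
        using avg_avg[OF hi, of i k] by eventually_elim simp
    qed measurable
    also have "\<dots> = (\<integral>e. innov i h e * innov (k + i) h e + avg (Suc (k + i)) h (shift 1 e) * innov i h e \<partial>S)"
      by (intro Bochner_Integration.integral_cong) (simp_all add: innov_def[of "k + i"] right_diff_distrib mult.commute)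
    also have "\<dots> = (\<integral>e. innov i h e * innov (k + i) h e \<partial>S) + (\<integral>e. avg (Suc (k + i)) h (shift 1 e) * innov i h e \<partial>S)"
      by (intro Bochner_Integration.integral_add integral_mult_Lq_2(1)[OF b b]
          integral_mult_Lq_2(1)[OF Lq_le_shift[OF Lq_le_avg[OF h]] b]) simp
    also have "(\<integral>e. avg (Suc (k + i)) h (shift 1 e) * innov i h e \<partial>S) = (\<integral>e. avg (Suc (k + i)) h e * avg 1 (innov i h) e \<partial>S)"
      by (intro integral_mult_shift integral_mult_Lq_2(1)[OF Lq_le_shift[OF Lq_le_avg[OF h]] b]) auto
    also have "\<dots> = (\<integral>e. 0 \<partial>S)"
    proof (rule integral_cong_AE)
      show "AE e in S. avg (Suc (k + i)) h e * avg 1 (innov i h) e = 0"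
        using avg_innov[OF hi, of i] by eventually_elim simp
    qed measurable
    finally show ?thesis using integral_mult_Lq_2(2)[OF b b, of i "k + i"] by simp
  qed
  have bk: "summable (\<lambda>i. b i * b (k + i))"
  proof (rule summable_comparison_test)
    have "b (k + i) \<le> suminf b" for i
      using sum_le_suminf[OF sum, of "{k + i}"] b0 by simp
    then show "\<exists>N. \<forall>n\<ge>N. norm (b n * b (k + n)) \<le> b n * suminf b"
      using b0 by (auto simp: abs_mult intro!: mult_left_mono)
    show "summable (\<lambda>n. b n * suminf b)" by (rule summable_mult2[OF sum])
  qed
  have main: "\<bar>\<integral>e. h e * avg k h e \<partial>S\<bar> \<le> (\<Sum>i. b i * b (k + i)) + (\<Sum>j. b (j + I)) * H" for I
  proof -
    have tail: "Lq_le S 2 (avg I h) (\<Sum>j. b (j + I))"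
    proof (rule Lq_le_avg_of_innov[OF hi mean b])
      fix J
      have "summable (\<lambda>j. b (j + I))" using sum by (rule summable_ignore_initial_segment)
      then show "(\<Sum>i<J. b (I + i)) \<le> (\<Sum>j. b (j + I))"
        using b0 sum_le_suminf[of "\<lambda>j. b (j + I)" "{..<J}"] by (simp add: add.commute)
    qed simp
    have i1: "integrable S (\<lambda>e. innov i h (shift i e) * avg k h e)" for i
      by (rule integral_mult_Lq_2(1)[OF Lq_le_shift[OF b] avgL])
    have i2: "integrable S (\<lambda>e. avg I h (shift I e) * avg k h e)"
      by (rule integral_mult_Lq_2(1)[OF Lq_le_shift[OF tail] avgL])
    have "(\<integral>e. h e * avg k h e \<partial>S) = (\<integral>e. (\<Sum>i<I. innov i h (shift i e) * avg k h e) + avg I h (shift I e) * avg k h e \<partial>S)"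
    proof (intro Bochner_Integration.integral_cong refl)
      fix e show "h e * avg k h e = (\<Sum>i<I. innov i h (shift i e) * avg k h e) + avg I h (shift I e) * avg k h e"
        using avg_telescope[of 0 h e I] by (simp add: sum_distrib_right distrib_right)
    qed
    also have "\<dots> = (\<Sum>i<I. (\<integral>e. innov i h (shift i e) * avg k h e \<partial>S)) + (\<integral>e. avg I h (shift I e) * avg k h e \<partial>S)"
      using i1 i2 by simp
    also have "\<bar>\<dots>\<bar> \<le> \<bar>\<Sum>i<I. (\<integral>e. innov i h (shift i e) * avg k h e \<partial>S)\<bar> + \<bar>\<integral>e. avg I h (shift I e) * avg k h e \<partial>S\<bar>"
      by (rule abs_triangle_ineq)
    also have "\<dots> \<le> (\<Sum>i<I. \<bar>\<integral>e. innov i h (shift i e) * avg k h e \<partial>S\<bar>) + (\<Sum>j. b (j + I)) * H"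
      by (intro add_mono sum_abs integral_mult_Lq_2(2)[OF Lq_le_shift[OF tail] avgL])
    also have "\<dots> \<le> (\<Sum>i<I. b i * b (k + i)) + (\<Sum>j. b (j + I)) * H"
      by (intro add_right_mono sum_mono inc)
    also have "(\<Sum>i<I. b i * b (k + i)) \<le> (\<Sum>i. b i * b (k + i))"
      by (rule sum_le_suminf[OF bk]) (auto simp: b0)
    finally show ?thesis by simp
  qed
  have "(\<lambda>I. (\<Sum>i. b i * b (k + i)) + (\<Sum>j. b (j + I)) * H) \<longlonglongrightarrow> (\<Sum>i. b i * b (k + i)) + 0 * H"
    by (intro tendsto_add tendsto_mult tendsto_const tail_suminf_tendsto_0 sum)
  from LIMSEQ_le_const[OF this] main show ?thesis by (auto simp: acov_def)
qed

lemma autocovariance_tail_bound: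
  assumes g: "Lq_le S 2 g G" and mean: "(\<integral>e. g e \<partial>S) = 0"
    and d: "\<And>i. influence_le 2 g i (d i)" "summable d"
  shows "(\<Sum>k\<in>{m..<n}. \<bar>acov g k\<bar>) \<le> suminf d * (\<Sum>j. d (m + j))"
proof -
  have gi: "integrable S g" using g by (rule Lq_le_S_integrable) simp
  have d0: "0 \<le> d i" for i using d(1)[of i] by (simp add: influence_le_def Lq_le_def)
  have inn: "Lq_le S 2 (innov i g) (d i)" for i by (rule Lq_le_innov[OF gi d(1)]) simp
  have dm: "summable (\<lambda>j. d (m + j))"
    using summable_ignore_initial_segment[OF d(2), of m] by (simp add: add.commute)
  have dk: "summable (\<lambda>i. d i * d (k + i))" for k
  proof (rule summable_comparison_test)
    show "\<exists>N. \<forall>i\<ge>N. norm (d i * d (k + i)) \<le> d i * suminf d"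
      using d0 sum_le_suminf[OF d(2), of "{k + i}" for i] by (auto simp: abs_mult intro!: mult_left_mono)
    show "summable (\<lambda>i. d i * suminf d)" by (rule summable_mult2[OF d(2)])
  qed
  have "(\<Sum>k\<in>{m..<n}. \<bar>acov g k\<bar>) \<le> (\<Sum>k\<in>{m..<n}. \<Sum>i. d i * d (k + i))"
    by (intro sum_mono autocovariance_bound[OF g mean inn d(2)])
  also have "\<dots> = (\<Sum>i. \<Sum>k\<in>{m..<n}. d i * d (k + i))"
    by (rule suminf_sum[symmetric]) (rule dk)
  also have "\<dots> \<le> (\<Sum>i. d i * (\<Sum>j. d (m + j)))"
  proof (rule suminf_le)
    fix i
    have "(\<Sum>k\<in>{m..<n}. d (k + i)) = (\<Sum>j\<in>{i..<n - m + i}. d (m + j))"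
      by (rule sum.reindex_bij_witness[of _ "\<lambda>j. m + j - i" "\<lambda>k. k + i - m"]) auto
    also have "\<dots> \<le> (\<Sum>j. d (m + j))" by (rule sum_le_suminf[OF dm]) (auto simp: d0)
    finally show "(\<Sum>k\<in>{m..<n}. d i * d (k + i)) \<le> d i * (\<Sum>j. d (m + j))"
      using d0 by (simp add: sum_distrib_left[symmetric] mult_left_mono)
  qed (intro summable_sum dk summable_mult2 d)+
  also have "\<dots> = suminf d * (\<Sum>j. d (m + j))" by (rule suminf_mult2[OF d(2), symmetric])
  finally show ?thesis .
qed

end

section \<open>The martingale part of the lag sums\<close>

lemma sum_diagonals:
  fixes \<phi> :: "nat \<Rightarrow> nat \<Rightarrow> 'b::comm_monoid_add"
  shows "(\<Sum>r<n + k. \<Sum>i\<in>{i. i < k \<and> i \<le> r \<and> r < i + n}. \<phi> r i) = (\<Sum>s<n. \<Sum>i<k. \<phi> (s + i) i)"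
proof -
  have "(\<Sum>r<n + k. \<Sum>i\<in>{i. i < k \<and> i \<le> r \<and> r < i + n}. \<phi> r i) =
      (\<Sum>(r, i)\<in>(SIGMA r:{..<n + k}. {i. i < k \<and> i \<le> r \<and> r < i + n}). \<phi> r i)"
    by (rule sum.Sigma) auto
  also have "\<dots> = (\<Sum>(s, i)\<in>{..<n} \<times> {..<k}. \<phi> (s + i) i)"
    by (rule sum.reindex_bij_witness[of _ "\<lambda>(s, i). (s + i, i)" "\<lambda>(r, i). (r - i, i)"]) auto
  also have "\<dots> = (\<Sum>s<n. \<Sum>i<k. \<phi> (s + i) i)" by (rule sum.cartesian_product[symmetric])
  finally show ?thesis .
qed

lemma weighted_Cauchy_Schwarz:
  fixes x a :: "'i \<Rightarrow> real"
  assumes a: "\<And>i. i \<in> I \<Longrightarrow> 0 < a i"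
  shows "(\<Sum>i\<in>I. x i)\<^sup>2 \<le> (\<Sum>i\<in>I. a i) * (\<Sum>i\<in>I. (x i)\<^sup>2 / a i)"
proof -
  have "(\<Sum>i\<in>I. x i)\<^sup>2 = (\<Sum>i\<in>I. sqrt (a i) * (x i / sqrt (a i)))\<^sup>2"
    using a by (intro arg_cong[where f = "\<lambda>t. t\<^sup>2"] sum.cong refl) (simp add: less_imp_neq[OF a, symmetric])
  also have "\<dots> \<le> (\<Sum>i\<in>I. (sqrt (a i))\<^sup>2) * (\<Sum>i\<in>I. (x i / sqrt (a i))\<^sup>2)"
    by (rule Cauchy_Schwarz_ineq_sum)
  also have "\<dots> = (\<Sum>i\<in>I. a i) * (\<Sum>i\<in>I. (x i)\<^sup>2 / a i)"
    using a by (intro arg_cong2[where f = "(*)"] sum.cong) (auto simp: power_divide less_imp_le)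
  finally show ?thesis .
qed

context sequence_space
begin

text \<open>With \<open>n + k\<close> observations, the products of variables at distance \<open>k\<close> are indexed by the distance \<open>s < n\<close> of
the newer factor from the present. Its innovation of order \<open>i\<close> happens \<open>r = s + i\<close> steps before the present,
and \<open>i < k\<close> means that the older factor is known by then; the sum collects all innovations at the same time.\<close>

definition lag_increment :: "((nat \<Rightarrow> 'a) \<Rightarrow> real) \<Rightarrow> nat \<Rightarrow> nat \<Rightarrow> nat \<Rightarrow> (nat \<Rightarrow> 'a) \<Rightarrow> real" where
  "lag_increment g n k r e = (\<Sum>i\<in>{i. i < k \<and> i \<le> r \<and> r < i + n}. g (shift (k - i) e) * innov i g e)"

lemma borel_measurable_lag_increment [measurable]:
  assumes [measurable]: "g \<in> borel_measurable S"
  shows "lag_increment g n k r \<in> borel_measurable S"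
  unfolding lag_increment_def by measurable

lemma lag_sum_martingale:
  "(\<Sum>r<n + k. lag_increment g n k r (shift r e)) =
   (\<Sum>s<n. g (shift (s + k) e) * (g (shift s e) - avg k g (shift (s + k) e)))"
proof -
  have "(\<Sum>r<n + k. lag_increment g n k r (shift r e)) =
     (\<Sum>s<n. \<Sum>i<k. g (shift (k - i) (shift (s + i) e)) * innov i g (shift (s + i) e))"
    unfolding lag_increment_def by (rule sum_diagonals)
  also have "\<dots> = (\<Sum>s<n. g (shift (s + k) e) * (\<Sum>i<k. innov i g (shift (s + i) e)))"
    by (simp add: sum_distrib_left)
  also have "(\<lambda>s. \<Sum>i<k. innov i g (shift (s + i) e)) = (\<lambda>s. g (shift s e) - avg k g (shift (s + k) e))"
    using avg_telescope[of 0 g "shift s e" k for s] by (simp add: fun_eq_iff)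
  finally show ?thesis by simp
qed

lemma lag_increment_martingale_difference:
  assumes g: "Lq_le S 4 g G" and inn: "\<And>i. Lq_le S 4 (innov i g) (a i)"
  shows "integrable S (lag_increment g n k r)" "integrable S (\<lambda>e. (lag_increment g n k r e)\<^sup>2)"
    "AE e in S. avg 1 (lag_increment g n k r) e = 0"
proof -
  let ?I = "{i. i < k \<and> i \<le> r \<and> r < i + n}"
  have gi: "integrable S g" using g by (intro Lq_le_S_integrable) auto
  have prodL: "Lq_le S 2 (\<lambda>e. g (shift j e) * innov i g e) (G * a i)" for i j
    using Lq_le_shift[OF g] inn by (intro Lq_le_mult) auto
  have L: "Lq_le S 2 (lag_increment g n k r) (\<Sum>i\<in>?I. G * a i)"
    unfolding lag_increment_def by (intro Lq_le_sum prodL) auto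
  show "integrable S (lag_increment g n k r)" using L by (rule Lq_le_S_integrable) simp
  show "integrable S (\<lambda>e. (lag_increment g n k r e)\<^sup>2)"
    using integral_mult_Lq_2(1)[OF L L] by (simp add: power2_eq_square)
  have fin: "finite ?I" by (rule finite_subset[of _ "{..<k}"]) auto
  have "AE e in S. avg 1 (lag_increment g n k r) e = (\<Sum>i\<in>?I. avg 1 (\<lambda>e. g (shift (k - i) e) * innov i g e) e)"
    unfolding lag_increment_def by (intro avg_sum Lq_le_S_integrable[OF prodL]) auto
  moreover have "AE e in S. \<forall>i\<in>?I. avg 1 (innov i g) e = 0"
    using fin by (intro AE_finite_allI avg_innov gi)
  ultimately show "AE e in S. avg 1 (lag_increment g n k r) e = 0"
  proof eventually_elim
    case (elim e)
    have "avg 1 (\<lambda>e. g (shift (k - i) e) * innov i g e) e = 0" if "i \<in> ?I" for i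
    proof -
      have "1 + (k - Suc i) = k - i" using that by auto
      then have "avg 1 (\<lambda>e. g (shift (k - i) e) * innov i g e) e = g (shift (k - Suc i) e) * avg 1 (innov i g) e"
        using avg_mult_shift[of 1 "\<lambda>e. g (shift (k - Suc i) e)" "innov i g" e] by simp
      then show ?thesis using elim that by simp
    qed
    then show ?case using elim by simp
  qed
qed

text \<open>Cauchy-Schwarz with weights \<open>a i\<close> splits the square of a martingale difference into the terms
\<open>(g (shift (k - i) e))\<^sup>2 * (innov i g e)\<^sup>2 / a i\<close>. Young's inequality separates the factor that depends on
the lag from the innovation, with fourth powers. Summed over time, the lag only shifts the index of the
first factor, so one function of the sequence serves all lags. The third powers of \<open>a i\<close> make its second
part summable in the mean, as the fourth moment of \<open>innov i g\<close> is at most \<open>a i ^ 4\<close>.\<close>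

lemma quadratic_variation_majorant:
  assumes g: "Lq_le S 4 g G" and G: "0 < G"
    and a: "\<And>i. Lq_le S 4 (innov i g) (a i)" "\<And>i. 0 < a i" "summable a"
  defines "\<Theta> \<equiv> suminf a"
  obtains h where "integrable S h" "(\<integral>e. h e \<partial>S) \<le> 2 * \<Theta>\<^sup>2 * G\<^sup>2" "\<And>e. 0 \<le> h e"
    "AE e in S. \<forall>n k. qvar (lag_increment g n k) (n + k) e \<le> (\<Sum>t<n + k. h (shift t e))"
proof -
  have gi: "integrable S g" using g by (rule Lq_le_S_integrable) simp
  have [measurable]: "g \<in> borel_measurable S" using gi by auto
  \<comment> \<open>balances the two terms of the mean of \<open>h\<close>, \<open>\<Theta>\<^sup>2 * \<kappa> * G ^ 4\<close> and \<open>\<Theta>\<^sup>2 / \<kappa>\<close>\<close>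
  define \<kappa> where "\<kappa> = 1 / G\<^sup>2"
  have \<kappa>: "0 < \<kappa>" using G by (simp add: \<kappa>_def)
  have \<Theta>: "0 < \<Theta>" unfolding \<Theta>_def by (rule suminf_pos[OF a(3)]) (rule a(2))
  have g4: "integrable S (\<lambda>e. g e ^ 4)" "(\<integral>e. g e ^ 4 \<partial>S) \<le> G ^ 4"
    using Lq_le_4[OF g] by auto
  have m4: "integrable S (\<lambda>e. innov i g e ^ 4)" "(\<integral>e. innov i g e ^ 4 \<partial>S) \<le> a i ^ 4" for i
    using Lq_le_4[OF a(1)] by auto
  define m where "m i e = innov i g e ^ 4" for i e
  have mi: "integrable S (m i)" for i using m4(1)[of i] by (simp add: m_def[abs_def])
  have [measurable]: "m i \<in> borel_measurable S" for i using mi by auto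
  define w where "w i e = (m i (shift i e) + avg 1 (m i) (shift (Suc i) e)) / a i ^ 3" for i e
  have [measurable]: "w i \<in> borel_measurable S" for i unfolding w_def by measurable
  have avgm0: "0 \<le> avg 1 (m i) e" for i e unfolding avg_def by (intro Bochner_Integration.integral_nonneg) (simp add: m_def)
  have w0: "0 \<le> w i e" for i e
    unfolding w_def using avgm0 a(2)[of i] by (intro divide_nonneg_nonneg add_nonneg_nonneg) (auto simp: m_def)
  have wi: "integrable S (w i)" for i
    unfolding w_def[abs_def] by (intro integrable_divide Bochner_Integration.integrable_add integrable_shift integrable_avg mi)
  have wint: "(\<integral>e. w i e \<partial>S) \<le> 2 * a i" for i
  proof -
    have "(\<integral>e. w i e \<partial>S) = ((\<integral>e. m i (shift i e) \<partial>S) + (\<integral>e. avg 1 (m i) (shift (Suc i) e) \<partial>S)) / a i ^ 3"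
      unfolding w_def using integrable_shift[OF mi] integrable_shift[OF integrable_avg[OF mi]] by simp
    also have "(\<integral>e. m i (shift i e) \<partial>S) = (\<integral>e. m i e \<partial>S)" by (rule integral_shift) measurable
    also have "(\<integral>e. avg 1 (m i) (shift (Suc i) e) \<partial>S) = (\<integral>e. avg 1 (m i) e \<partial>S)" by (rule integral_shift) measurable
    also have "\<dots> = (\<integral>e. m i e \<partial>S)" by (rule integral_avg[OF mi])
    also have "((\<integral>e. m i e \<partial>S) + (\<integral>e. m i e \<partial>S)) / a i ^ 3 \<le> (a i ^ 4 + a i ^ 4) / a i ^ 3"
      using m4(2)[of i] a(2)[of i] by (intro divide_right_mono add_mono) (auto simp: m_def)
    also have "\<dots> = 2 * a i" using a(2)[of i] by (simp add: power_eq_if)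
    finally show ?thesis .
  qed
  obtain u where u: "integrable S u" "(\<integral>e. u e \<partial>S) \<le> (\<Sum>i. 2 * a i)" "\<And>e. 0 \<le> u e"
    and u_ge: "AE e in S. \<forall>k. (\<Sum>i<k. w i e) \<le> u e"
    using nonneg_series_majorant[OF wi w0 wint summable_mult[OF a(3)]] by blast
  have ui: "integrable S u" by (rule u(1))
  have uint: "(\<integral>e. u e \<partial>S) \<le> 2 * \<Theta>"
    using u(2) unfolding \<Theta>_def by (simp add: suminf_mult[OF a(3)])
  have [measurable]: "u \<in> borel_measurable S" using ui by auto
  define h where "h e = \<Theta>\<^sup>2 * \<kappa> * g e ^ 4 + \<Theta> / (2 * \<kappa>) * u e" for e
  have hi: "integrable S h" unfolding h_def using g4 ui by auto
  have hint: "(\<integral>e. h e \<partial>S) \<le> 2 * \<Theta>\<^sup>2 * G\<^sup>2"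
  proof -
    have "(\<integral>e. h e \<partial>S) = \<Theta>\<^sup>2 * \<kappa> * (\<integral>e. g e ^ 4 \<partial>S) + \<Theta> / (2 * \<kappa>) * (\<integral>e. u e \<partial>S)"
      unfolding h_def using g4 ui by simp
    also have "\<dots> \<le> \<Theta>\<^sup>2 * \<kappa> * G ^ 4 + \<Theta> / (2 * \<kappa>) * (2 * \<Theta>)"
      using g4(2) uint \<kappa> \<Theta> by (intro add_mono mult_left_mono) auto
    also have "\<dots> = 2 * \<Theta>\<^sup>2 * G\<^sup>2"
      using G by (simp add: \<kappa>_def power2_eq_square power4_eq_xxxx)
    finally show ?thesis .
  qed
  have h0: "0 \<le> h e" for e unfolding h_def using \<kappa> \<Theta> by (auto simp: u)
  let ?I = "\<lambda>n k r. {i. i < k \<and> i \<le> r \<and> r < i + n}"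
  define f where "f = lag_increment g"
  have f: "f n k r e = (\<Sum>i\<in>?I n k r. g (shift (k - i) e) * innov i g e)" for n k r :: nat and e
    by (simp add: f_def lag_increment_def)
  \<comment> \<open>Young bounds of one term of the quadratic variation: \<open>Q\<close> of the realised, \<open>R\<close> of the predictable part\<close>
  define Q where "Q k i e = \<kappa> * a i / 2 * g (shift (k - i) e) ^ 4 + m i e / (2 * \<kappa> * a i ^ 3)" for k i :: nat and e
  have fin: "finite (?I n k r)" for n k r :: nat by (rule finite_subset[of _ "{..<k}"]) auto
  have Qi: "integrable S (Q k i)" for k i
    unfolding Q_def[abs_def] using integrable_shift[OF g4(1)] mi by auto
  have [measurable]: "f n k r \<in> borel_measurable S" for n k r unfolding f_def by measurable
  have fQ: "(f n k r e)\<^sup>2 \<le> \<Theta> * (\<Sum>i\<in>?I n k r. Q k i e)" for n k r e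
  proof -
    have "(f n k r e)\<^sup>2 \<le> (\<Sum>i\<in>?I n k r. a i) * (\<Sum>i\<in>?I n k r. (g (shift (k - i) e) * innov i g e)\<^sup>2 / a i)"
      unfolding f by (rule weighted_Cauchy_Schwarz) (rule a(2))
    also have "\<dots> \<le> \<Theta> * (\<Sum>i\<in>?I n k r. Q k i e)"
    proof (intro mult_mono sum_mono)
      show "sum a (?I n k r) \<le> \<Theta>" unfolding \<Theta>_def
        by (rule sum_le_suminf[OF a(3) fin]) (use a(2) in \<open>auto intro: less_imp_le\<close>)
      show "(g (shift (k - i) e) * innov i g e)\<^sup>2 / a i \<le> Q k i e" for i
      proof -
        define x y where "x = g (shift (k - i) e)" and "y = innov i g e"
        have ai: "0 < a i" by (rule a(2))
        have "2 * (\<kappa> * (a i)\<^sup>2 * x\<^sup>2) * y\<^sup>2 \<le> (\<kappa> * (a i)\<^sup>2 * x\<^sup>2)\<^sup>2 + (y\<^sup>2)\<^sup>2"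
          by (rule sum_squares_bound)
        then have "(2 * (\<kappa> * (a i)\<^sup>2 * x\<^sup>2) * y\<^sup>2) / (2 * \<kappa> * a i ^ 3) \<le> ((\<kappa> * (a i)\<^sup>2 * x\<^sup>2)\<^sup>2 + (y\<^sup>2)\<^sup>2) / (2 * \<kappa> * a i ^ 3)"
          using ai \<kappa> by (intro divide_right_mono) auto
        also have "(2 * (\<kappa> * (a i)\<^sup>2 * x\<^sup>2) * y\<^sup>2) / (2 * \<kappa> * a i ^ 3) = (x * y)\<^sup>2 / a i"
          using ai \<kappa> by (simp add: power_mult_distrib power_eq_if)
        also have "((\<kappa> * (a i)\<^sup>2 * x\<^sup>2)\<^sup>2 + (y\<^sup>2)\<^sup>2) / (2 * \<kappa> * a i ^ 3) = Q k i e"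
          using ai \<kappa> by (simp add: Q_def m_def x_def y_def add_divide_distrib power_mult_distrib power_eq_if mult_ac)
        finally show ?thesis by (simp add: x_def y_def)
      qed
    qed (use \<Theta> a(2) in \<open>auto intro!: sum_nonneg divide_nonneg_pos\<close>)
    finally show ?thesis .
  qed
  have Qsi: "integrable S (\<lambda>e. \<Theta> * (\<Sum>i\<in>?I n k r. Q k i e))" for n k r :: nat
    using Qi by auto
  have f2i: "integrable S (\<lambda>e. (f n k r e)\<^sup>2)" for n k r
    by (rule Bochner_Integration.integrable_bound[OF Qsi[of k r n]])
       (measurable, intro AE_I2, use fQ[of n k r] in \<open>auto intro: order_trans[OF _ abs_ge_self]\<close>)
  define R where "R k i e = \<kappa> * a i / 2 * g (shift (k - Suc i) e) ^ 4 + avg 1 (m i) e / (2 * \<kappa> * a i ^ 3)" for k i :: nat and e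
  have avgQ: "AE e in S. i < k \<longrightarrow> avg 1 (Q k i) e = R k i e" for k i
    using AE_integrable_comb[OF integrable_shift[OF g4(1), of "k - i"], of 1] AE_integrable_comb[OF mi, of i 1]
  proof eventually_elim
    case (elim e)
    show ?case
    proof
      assume "i < k"
      then have sh: "shift (k - i) (comb_seq 1 \<omega> e) = shift (k - Suc i) e" for \<omega>
        by (subst shift_comb_seq_ge) auto
      show "avg 1 (Q k i) e = R k i e"
        using elim unfolding avg_def Q_def R_def sh by (simp add: P.prob_space)
    qed
  qed
  have avgf: "AE e in S. avg 1 (\<lambda>e. (f n k r e)\<^sup>2) e \<le> \<Theta> * (\<Sum>i\<in>?I n k r. R k i e)" for n k r
  proof -
    have "AE e in S. \<forall>i\<in>?I n k r. i < k \<longrightarrow> avg 1 (Q k i) e = R k i e"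
      using fin avgQ by (intro AE_finite_allI) auto
    moreover have "AE e in S. \<forall>i\<in>?I n k r. integrable S (\<lambda>\<omega>. Q k i (comb_seq 1 \<omega> e))"
      using fin Qi by (intro AE_finite_allI AE_integrable_comb) auto
    ultimately show ?thesis
      using AE_integrable_comb[OF f2i[of n k r], of 1]
    proof eventually_elim
      case (elim e)
      have "avg 1 (\<lambda>e. (f n k r e)\<^sup>2) e \<le> (\<integral>\<omega>. \<Theta> * (\<Sum>i\<in>?I n k r. Q k i (comb_seq 1 \<omega> e)) \<partial>S)"
        unfolding avg_def using elim fQ by (intro integral_mono) auto
      also have "\<dots> = \<Theta> * (\<Sum>i\<in>?I n k r. avg 1 (Q k i) e)"
        unfolding avg_def using elim by simp
      also have "(\<Sum>i\<in>?I n k r. avg 1 (Q k i) e) = (\<Sum>i\<in>?I n k r. R k i e)"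
        using elim by (intro sum.cong) auto
      finally show ?case .
    qed
  qed
  have "AE e in S. \<forall>n k. (\<Sum>r<n + k. (f n k r (shift r e))\<^sup>2 + avg 1 (\<lambda>e. (f n k r e)\<^sup>2) (shift (Suc r) e))
      \<le> (\<Sum>t<n + k. h (shift t e))"
  proof -
    have "AE e in S. \<forall>n k r. avg 1 (\<lambda>e. (f n k r e)\<^sup>2) (shift (Suc r) e) \<le> \<Theta> * (\<Sum>i\<in>?I n k r. R k i (shift (Suc r) e))"
      unfolding AE_all_countable using AE_shift[OF avgf] by blast
    moreover have "AE e in S. \<forall>s k. (\<Sum>i<k. w i (shift s e)) \<le> u (shift s e)"
      unfolding AE_all_countable using AE_shift[OF u_ge[unfolded AE_all_countable, rule_format]] by blast
    ultimately show ?thesis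
    proof eventually_elim
      case (elim e)
      show ?case
      proof (intro allI)
        fix n k
        have "(\<Sum>r<n + k. (f n k r (shift r e))\<^sup>2 + avg 1 (\<lambda>e. (f n k r e)\<^sup>2) (shift (Suc r) e))
          \<le> (\<Sum>r<n + k. \<Theta> * (\<Sum>i\<in>?I n k r. Q k i (shift r e)) + \<Theta> * (\<Sum>i\<in>?I n k r. R k i (shift (Suc r) e)))"
          using elim by (intro sum_mono add_mono fQ) auto
        also have "\<dots> = \<Theta> * (\<Sum>r<n + k. \<Sum>i\<in>?I n k r. Q k i (shift r e) + R k i (shift (Suc r) e))"
          by (simp add: sum.distrib sum_distrib_left distrib_left)
        also have "\<dots> = \<Theta> * (\<Sum>s<n. \<Sum>i<k. Q k i (shift (s + i) e) + R k i (shift (Suc (s + i)) e))"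
          by (subst sum_diagonals) simp
        also have "\<dots> = \<Theta> * (\<Sum>s<n. (\<Sum>i<k. a i) * (\<kappa> * g (shift (s + k) e) ^ 4) + (\<Sum>i<k. w i (shift s e)) / (2 * \<kappa>))"
        proof -
          have "(\<Sum>i<k. Q k i (shift (s + i) e) + R k i (shift (Suc (s + i)) e)) =
             (\<Sum>i<k. a i * (\<kappa> * g (shift (s + k) e) ^ 4) + w i (shift s e) / (2 * \<kappa>))" for s
          proof (rule sum.cong[OF refl])
            fix i assume "i \<in> {..<k}"
            then have "i < k" by simp
            then have sh: "shift (k - i) (shift (s + i) e) = shift (s + k) e"
              "shift (k - Suc i) (shift (Suc (s + i)) e) = shift (s + k) e" by simp_all
            show "Q k i (shift (s + i) e) + R k i (shift (Suc (s + i)) e) = a i * (\<kappa> * g (shift (s + k) e) ^ 4) + w i (shift s e) / (2 * \<kappa>)"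
              unfolding Q_def R_def w_def sh using \<kappa> a(2)[of i]
              by (simp add: add_divide_distrib mult_ac)
          qed
          then show ?thesis by (simp add: sum.distrib sum_distrib_right sum_divide_distrib)
        qed
        also have "\<dots> \<le> \<Theta> * (\<Sum>s<n. \<Theta> * (\<kappa> * g (shift (s + k) e) ^ 4) + u (shift s e) / (2 * \<kappa>))"
        proof (intro mult_left_mono sum_mono add_mono mult_right_mono divide_right_mono)
          show "sum a {..<k} \<le> \<Theta>" unfolding \<Theta>_def
            by (rule sum_le_suminf[OF a(3)]) (use a(2) in \<open>auto intro: less_imp_le\<close>)
        qed (use \<kappa> \<Theta> elim in auto)
        also have "\<dots> = (\<Sum>s<n. \<Theta>\<^sup>2 * \<kappa> * g (shift (s + k) e) ^ 4) + (\<Sum>s<n. \<Theta> / (2 * \<kappa>) * u (shift s e))"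
          by (simp add: sum.distrib sum_distrib_left distrib_left power2_eq_square mult_ac)
        also have "\<dots> \<le> (\<Sum>t<n + k. \<Theta>\<^sup>2 * \<kappa> * g (shift t e) ^ 4) + (\<Sum>t<n + k. \<Theta> / (2 * \<kappa>) * u (shift t e))"
        proof (rule add_mono)
          have "(\<Sum>s<n. \<Theta>\<^sup>2 * \<kappa> * g (shift (s + k) e) ^ 4) = (\<Sum>t\<in>{k..<n + k}. \<Theta>\<^sup>2 * \<kappa> * g (shift t e) ^ 4)"
            by (rule sum.reindex_bij_witness[of _ "\<lambda>t. t - k" "\<lambda>s. s + k"]) auto
          also have "\<dots> \<le> (\<Sum>t<n + k. \<Theta>\<^sup>2 * \<kappa> * g (shift t e) ^ 4)"
            using \<kappa> by (intro sum_mono2) auto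
          finally show "(\<Sum>s<n. \<Theta>\<^sup>2 * \<kappa> * g (shift (s + k) e) ^ 4) \<le> (\<Sum>t<n + k. \<Theta>\<^sup>2 * \<kappa> * g (shift t e) ^ 4)" .
          show "(\<Sum>s<n. \<Theta> / (2 * \<kappa>) * u (shift s e)) \<le> (\<Sum>t<n + k. \<Theta> / (2 * \<kappa>) * u (shift t e))"
            using \<kappa> \<Theta> by (intro sum_mono2) (auto simp: u)
        qed
        also have "\<dots> = (\<Sum>t<n + k. h (shift t e))" by (simp add: h_def sum.distrib)
        finally show "(\<Sum>r<n + k. (f n k r (shift r e))\<^sup>2 + avg 1 (\<lambda>e. (f n k r e)\<^sup>2) (shift (Suc r) e)) \<le> (\<Sum>t<n + k. h (shift t e))" .
      qed
    qed
  qed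
  then show ?thesis
    using that[OF hi hint h0] unfolding f_def qvar_def by blast
qed

end

section \<open>Uniform deviations of the lag sums\<close>

context sequence_space
begin

text \<open>The centred sum of the products \<open>X\<^sub>t\<^sub>-\<^sub>k * X\<^sub>t\<close> that \<open>n + k\<close> observations provide.\<close>

definition lag_sum :: "((nat \<Rightarrow> 'a) \<Rightarrow> real) \<Rightarrow> nat \<Rightarrow> nat \<Rightarrow> (nat \<Rightarrow> 'a) \<Rightarrow> real" where
  "lag_sum g n k e = (\<Sum>s<n. g (shift s e) * g (shift (s + k) e) - acov g k)"

lemma borel_measurable_lag_sum [measurable]:
  assumes [measurable]: "g \<in> borel_measurable S"
  shows "lag_sum g n k \<in> borel_measurable S"
  unfolding lag_sum_def by measurable

text \<open>The newer factor is replaced by its prediction from the time of the older one and the error of this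
prediction.\<close>

lemma lag_sum_split:
  "lag_sum g n k e = (\<Sum>s<n. g (shift (s + k) e) * (g (shift s e) - avg k g (shift (s + k) e))) +
     (\<Sum>s<n. g (shift (s + k) e) * avg k g (shift (s + k) e) - acov g k)"
  by (simp add: lag_sum_def sum.distrib[symmetric] sum_subtractf algebra_simps)

text \<open>The product of \<open>g\<close> with its prediction is influenced by coordinate \<open>i\<close> through either factor, by at most
\<open>d i\<close> times the norm of the prediction plus \<open>d (k + i)\<close> times the norm of \<open>g\<close>; both sum to a multiple of the
tail of \<open>d\<close> beyond \<open>k\<close>.\<close>

lemma Lq_le_lag_remainder:
  assumes p: "4 \<le> p" and g: "Lq_le S p g G" and mean: "(\<integral>e. g e \<partial>S) = 0"
    and d: "\<And>i. influence_le p g i (d i)" "summable d"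
  shows "Lq_le S (p / 2) (\<lambda>e. \<Sum>s<n. g (shift (s + k) e) * avg k g (shift (s + k) e) - acov g k)
     (sqrt (mart_const (p / 2) * real n) * ((suminf d + G) * (\<Sum>j. d (j + k))))"
proof -
  have gi: "integrable S g" using g p by (intro Lq_le_S_integrable) auto
  have [measurable]: "g \<in> borel_measurable S" using gi by auto
  have d0: "0 \<le> d i" for i using d(1)[of i] by (simp add: influence_le_def Lq_le_def)
  have G0: "0 \<le> G" using g by (simp add: Lq_le_def)
  let ?B = "\<Sum>j. d (j + k)"
  have dk: "summable (\<lambda>j. d (j + k))" using d(2) by (rule summable_ignore_initial_segment)
  have B0: "0 \<le> ?B" using d0 by (intro suminf_nonneg dk)
  have tail: "(\<Sum>i<I. d (k + i)) \<le> ?B" for I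
    using d0 sum_le_suminf[OF dk, of "{..<I}"] by (simp add: add.commute)
  have inn: "Lq_le S p (innov i g) (d i)" for i
    using p by (intro Lq_le_innov gi d) auto
  have A: "Lq_le S p (avg k g) ?B"
    using p tail by (intro Lq_le_avg_of_innov[OF gi mean inn]) auto
  have infA: "influence_le p (avg k g) i (d (k + i))" for i
    using p by (intro influence_le_avg gi d) auto
  define z where "z e = g e * avg k g e - acov g k" for e
  have "Lq_le S (p / 2) (\<lambda>e. g e * avg k g e) (G * ?B)" using g A p by (intro Lq_le_mult) auto
  then have prodi: "integrable S (\<lambda>e. g e * avg k g e)" using p by (intro Lq_le_S_integrable) auto
  have zi: "integrable S z" unfolding z_def using prodi by auto
  have zm: "(\<integral>e. z e \<partial>S) = 0" unfolding z_def using prodi by (simp add: P.prob_space acov_def)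
  have "influence_le (p / 2) (\<lambda>e. g e * avg k g e) i (d i * ?B + G * d (k + i))" for i
    using p g A d infA by (intro influence_le_mult) auto
  then have "influence_le (p / 2) z i (d i * ?B + G * d (k + i))" for i
    unfolding z_def by (rule influence_le_diff_const)
  then have zinn: "Lq_le S (p / 2) (innov i z) (d i * ?B + G * d (k + i))" for i
    using p by (intro Lq_le_innov zi) auto
  have bound: "(\<Sum>i<I. d i * ?B + G * d (k + i)) \<le> (suminf d + G) * ?B" for I
  proof -
    have "(\<Sum>i<I. d i * ?B + G * d (k + i)) = (\<Sum>i<I. d i) * ?B + G * (\<Sum>i<I. d (k + i))"
      by (simp add: sum.distrib sum_distrib_left sum_distrib_right)
    also have "\<dots> \<le> suminf d * ?B + G * ?B"
      using tail[of I] d0 G0 B0 by (intro add_mono mult_right_mono mult_left_mono sum_le_suminf d) auto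
    finally show ?thesis by (simp add: distrib_right)
  qed
  have "Lq_le S (p / 2) (\<lambda>e. \<Sum>s<n. z (shift s e)) (sqrt (mart_const (p / 2) * real n) * ((suminf d + G) * ?B))"
    using p by (intro Lq_le_sum_of_innov[OF zi zm zinn bound]) auto
  from Lq_le_shift[OF this, of k] show ?thesis by (simp add: z_def add.commute)
qed

text \<open>Each half of the lag sum gets half of the deviation. The martingale parts of all lags share one exceptional
event, that the common majorant of their quadratic variations exceeds a multiple of its mean; outside it each
of them is large with probability at most \<open>2 / T\<^sup>2\<close>.\<close>

lemma uniform_lag_deviation_nondegenerate:
  assumes p: "4 \<le> p" and g: "Lq_le S p g Gp" and mean: "(\<integral>e. g e \<partial>S) = 0"
    and d: "\<And>i. influence_le p g i (d i)" "summable d"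
    and g4: "Lq_le S 4 g G" and d4: "\<And>i. influence_le 4 g i (d4 i)" "summable d4"
    and tails: "summable (\<lambda>k. (\<Sum>j. d (j + k)) powr (p / 2))"
    and pos: "0 < G" "0 < suminf d4" and c: "64 * G * suminf d4 \<le> c"
  shows "(\<lambda>T. measure S {e \<in> space S. \<exists>k<T. c * sqrt (real T * ln (real T)) < \<bar>lag_sum g (T - k) k e\<bar>}) \<longlonglongrightarrow> 0"
proof -
  have gi: "integrable S g" using g4 by (intro Lq_le_S_integrable) auto
  have [measurable]: "g \<in> borel_measurable S" using gi by auto
  define \<Theta> where "\<Theta> = suminf d4"
  have \<Theta>: "0 < \<Theta>" using pos by (simp add: \<Theta>_def)
  have c0: "0 < c" using mult_pos_pos[OF pos] c by linarith
  have d40: "0 \<le> d4 i" for i using d4(1)[of i] by (simp add: influence_le_def Lq_le_def)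
  have d0: "0 \<le> d i" for i using d(1)[of i] by (simp add: influence_le_def Lq_le_def)
  \<comment> \<open>the geometric term makes all weights positive and at most doubles their sum\<close>
  define a where "a i = d4 i + \<Theta> * (1 / 2) ^ Suc i" for i
  have geo: "(\<lambda>i. \<Theta> * (1 / 2) ^ Suc i) sums (\<Theta> * 1)" by (intro sums_mult power_half_series)
  have a_sums: "a sums (\<Theta> + \<Theta> * 1)"
    unfolding a_def[abs_def] using summable_sums[OF d4(2)] geo unfolding \<Theta>_def by (rule sums_add)
  then have a_sum: "summable a" "suminf a = 2 * \<Theta>" by (auto simp: sums_iff)
  have a0: "0 < a i" for i using d40[of i] \<Theta> by (simp add: a_def add_nonneg_pos)
  have inn: "Lq_le S 4 (innov i g) (a i)" for i
  proof (rule Lq_le_mono)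
    show "Lq_le S 4 (innov i g) (d4 i)" by (intro Lq_le_innov gi d4) auto
  qed (use \<Theta> in \<open>auto simp: a_def\<close>)
  obtain h where h: "integrable S h" "(\<integral>e. h e \<partial>S) \<le> 2 * (2 * \<Theta>)\<^sup>2 * G\<^sup>2" "\<And>e. 0 \<le> h e"
    and maj: "AE e in S. \<forall>n k. qvar (lag_increment g n k) (n + k) e \<le> (\<Sum>t<n + k. h (shift t e))"
    using quadratic_variation_majorant[OF g4 pos(1) inn a0 a_sum(1)] unfolding a_sum(2) by blast
  have [measurable]: "h \<in> borel_measurable S" using h by auto
  \<comment> \<open>strictly above the mean \<open>8 * \<Theta>\<^sup>2 * G\<^sup>2\<close> of the majorant\<close>
  define v where "v = 9 * \<Theta>\<^sup>2 * G\<^sup>2"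
  have v0: "0 < v" using \<Theta> pos by (simp add: v_def)
  have hv: "(\<integral>e. h e \<partial>S) < v"
  proof -
    have "2 * (2 * \<Theta>)\<^sup>2 * G\<^sup>2 = 8 * (\<Theta>\<^sup>2 * G\<^sup>2)" by (simp add: power_mult_distrib)
    moreover have "0 < \<Theta>\<^sup>2 * G\<^sup>2" using \<Theta> pos by simp
    ultimately show ?thesis using h(2) unfolding v_def by linarith
  qed
  define Mt where "Mt n k e = (\<Sum>s<n. g (shift (s + k) e) * (g (shift s e) - avg k g (shift (s + k) e)))" for n k e
  define Zt where "Zt n k e = (\<Sum>s<n. g (shift (s + k) e) * avg k g (shift (s + k) e) - acov g k)" for n k e
  have [measurable]: "Mt n k \<in> borel_measurable S" "Zt n k \<in> borel_measurable S" for n k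
    unfolding Mt_def Zt_def by measurable
  define y where "y T = c / 2 * sqrt (real T * ln (real T))" for T :: nat
  define q where "q = p / 2"
  define K where "K = (sqrt (mart_const q) * (suminf d + Gp) * 2 / c) powr q"
  define B where "B k = (\<Sum>j. d (j + k))" for k
  have B0: "0 \<le> B k" for k unfolding B_def
    by (rule suminf_nonneg[OF summable_ignore_initial_segment[OF d(2)] d0])
  have Gp0: "0 \<le> Gp" using g by (simp add: Lq_le_def)
  have D0: "0 \<le> suminf d" by (rule suminf_nonneg[OF d(2) d0])
  let ?N = "\<lambda>T. {e \<in> space S. real T * v < (\<Sum>t<T. h (shift t e))}"
  \<comment> \<open>the martingale part: \<open>c\<close> is so large that the exponent is at least \<open>2 * ln T\<close>\<close>
  have E1: "measure S {e \<in> space S. y T \<le> \<bar>Mt (T - k) k e\<bar> \<and> (\<Sum>t<T. h (shift t e)) \<le> real T * v} \<le> 2 * (1 / real T)\<^sup>2"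
    if T: "3 \<le> T" and k: "k < T" for T k
  proof -
    have lnT: "0 < ln (real T)" using T by simp
    have Teq: "T - k + k = T" using k by simp
    have y0: "0 \<le> y T" using c0 lnT by (simp add: y_def)
    let ?f = "lag_increment g (T - k) k"
    let ?E = "{e \<in> space S. y T \<le> \<bar>\<Sum>r<T. ?f r (shift r e)\<bar> \<and> qvar ?f T e \<le> real T * v}"
    have Mt_eq: "Mt (T - k) k e = (\<Sum>r<T. ?f r (shift r e))" for e
      using lag_sum_martingale[where k = k and n = "T - k" and g = g and e = e] unfolding Teq by (simp add: Mt_def)
    have Em: "?E \<in> sets S" by measurable
    have "AE e in S. qvar ?f T e \<le> (\<Sum>t<T. h (shift t e))"
      using maj by eventually_elim (metis Teq)
    then have "measure S {e \<in> space S. y T \<le> \<bar>Mt (T - k) k e\<bar> \<and> (\<Sum>t<T. h (shift t e)) \<le> real T * v} \<le> measure S ?E"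
      using Em by (intro P.finite_measure_mono_AE) (auto simp: Mt_eq elim!: eventually_mono)
    also have "\<dots> \<le> 2 * exp (- ((y T)\<^sup>2 / (2 * (real T * v))))"
      using T v0 y0 by (intro self_normalized_tail_abs lag_increment_martingale_difference[OF g4 inn]) auto
    also have "exp (- ((y T)\<^sup>2 / (2 * (real T * v)))) \<le> exp (- (2 * ln (real T)))"
    proof -
      have "(64 * G * \<Theta>)\<^sup>2 \<le> c\<^sup>2" using c pos \<Theta> by (intro power_mono) (auto simp: \<Theta>_def)
      then have "4096 * (\<Theta>\<^sup>2 * G\<^sup>2) \<le> c\<^sup>2" by (simp add: power_mult_distrib mult_ac)
      moreover have "0 \<le> \<Theta>\<^sup>2 * G\<^sup>2" by simp
      ultimately have "16 * v \<le> c\<^sup>2" unfolding v_def by linarith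
      then have "16 * v * (real T * ln (real T)) \<le> c\<^sup>2 * (real T * ln (real T))"
        using lnT by (intro mult_right_mono) auto
      moreover have "(y T)\<^sup>2 = c\<^sup>2 / 4 * (real T * ln (real T))"
        using lnT by (simp add: y_def power_mult_distrib power_divide)
      ultimately have "2 * ln (real T) * (2 * (real T * v)) \<le> (y T)\<^sup>2" by (simp add: mult_ac)
      then have "2 * ln (real T) \<le> (y T)\<^sup>2 / (2 * (real T * v))"
        using T v0 by (subst pos_le_divide_eq) auto
      then show ?thesis by simp
    qed
    also have "exp (- (2 * ln (real T))) = (1 / real T)\<^sup>2"
    proof -
      have "exp (- (2 * ln (real T))) = exp (- ln (real T)) ^ 2" by (simp add: exp_double[symmetric] flip: exp_of_nat_mult)
      also have "exp (- ln (real T)) = 1 / real T" using T by (simp add: exp_minus inverse_eq_divide)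
      finally show ?thesis .
    qed
    finally show ?thesis by simp
  qed
  \<comment> \<open>the remainder: the factor \<open>ln T\<close> in the deviation makes the sum over the lags vanish\<close>
  have E2: "measure S {e \<in> space S. y T \<le> \<bar>Zt (T - k) k e\<bar>} \<le> K * B k powr q * ln (real T) powr (- (q / 2))"
    if T: "3 \<le> T" and k: "k < T" for T k
  proof -
    have lnT: "0 < ln (real T)" using T by simp
    have y0: "0 < y T" using c0 lnT T by (simp add: y_def)
    let ?C = "mart_const q"
    have C1: "1 \<le> ?C" by (rule mart_const_ge_1)
    have "Lq_le S q (Zt (T - k) k) (sqrt (?C * real (T - k)) * ((suminf d + Gp) * B k))"
      unfolding Zt_def[abs_def] q_def B_def by (rule Lq_le_lag_remainder[OF p g mean d])
    then have "Lq_le S q (Zt (T - k) k) (sqrt (?C * real T) * ((suminf d + Gp) * B k))"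
    proof (rule Lq_le_mono)
      show "sqrt (?C * real (T - k)) * ((suminf d + Gp) * B k) \<le> sqrt (?C * real T) * ((suminf d + Gp) * B k)"
        using C1 D0 Gp0 B0[of k] by (intro mult_right_mono real_sqrt_le_mono mult_left_mono) auto
    qed (use p in \<open>simp add: q_def\<close>)
    then have "measure S {e \<in> space S. y T \<le> \<bar>Zt (T - k) k e\<bar>} \<le> (sqrt (?C * real T) * ((suminf d + Gp) * B k) / y T) powr q"
      using p y0 by (intro Lq_le_Markov[OF P.prob_space_axioms]) (auto simp: q_def)
    also have "sqrt (?C * real T) * ((suminf d + Gp) * B k) / y T =
        (sqrt ?C * (suminf d + Gp) * 2 / c) * B k * (1 / sqrt (ln (real T)))"
      using T c0 lnT by (simp add: y_def real_sqrt_mult field_simps)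
    also have "\<dots> powr q = K * B k powr q * (1 / sqrt (ln (real T))) powr q"
    proof -
      have powr3: "(X * b * w) powr q = X powr q * b powr q * w powr q" if "0 \<le> X" "0 \<le> b" "0 \<le> w" for X b w :: real
        using that by (simp add: powr_mult)
      show ?thesis unfolding K_def
        using C1 D0 Gp0 c0 lnT by (intro powr3 B0 divide_nonneg_nonneg mult_nonneg_nonneg) auto
    qed
    also have "(1 / sqrt (ln (real T))) powr q = ln (real T) powr (- (q / 2))"
      using lnT by (simp add: powr_divide powr_minus_divide powr_half_sqrt[symmetric] powr_powr)
    finally show ?thesis .
  qed
  let ?P = "\<lambda>T. measure S {e \<in> space S. \<exists>k<T. c * sqrt (real T * ln (real T)) < \<bar>lag_sum g (T - k) k e\<bar>}"
  have bound: "?P T \<le> measure S (?N T) + 2 / real T + K * (\<Sum>k. B k powr q) * ln (real T) powr (- (q / 2))" if T: "3 \<le> T" for T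
  proof -
    let ?E1 = "\<lambda>k. {e \<in> space S. y T \<le> \<bar>Mt (T - k) k e\<bar> \<and> (\<Sum>t<T. h (shift t e)) \<le> real T * v}"
    let ?E2 = "\<lambda>k. {e \<in> space S. y T \<le> \<bar>Zt (T - k) k e\<bar>}"
    have m[measurable]: "?N T \<in> sets S" "?E1 k \<in> sets S" "?E2 k \<in> sets S" for k by measurable
    have split: "lag_sum g n k e = Mt n k e + Zt n k e" for n k e
      unfolding Mt_def Zt_def by (rule lag_sum_split)
    have y2: "c * sqrt (real T * ln (real T)) = y T + y T" by (simp add: y_def)
    have "?P T \<le> measure S (?N T \<union> ((\<Union>k<T. ?E1 k) \<union> (\<Union>k<T. ?E2 k)))"
    proof (rule P.finite_measure_mono)
      show "{e \<in> space S. \<exists>k<T. c * sqrt (real T * ln (real T)) < \<bar>lag_sum g (T - k) k e\<bar>} \<subseteq> ?N T \<union> ((\<Union>k<T. ?E1 k) \<union> (\<Union>k<T. ?E2 k))"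
      proof
        fix e assume "e \<in> {e \<in> space S. \<exists>k<T. c * sqrt (real T * ln (real T)) < \<bar>lag_sum g (T - k) k e\<bar>}"
        then obtain k where e: "e \<in> space S" and k: "k < T" and gt: "y T + y T < \<bar>Mt (T - k) k e + Zt (T - k) k e\<bar>"
          unfolding y2 split by auto
        then have "y T \<le> \<bar>Mt (T - k) k e\<bar> \<or> y T \<le> \<bar>Zt (T - k) k e\<bar>" by linarith
        then show "e \<in> ?N T \<union> ((\<Union>k<T. ?E1 k) \<union> (\<Union>k<T. ?E2 k))" using e k by (auto simp: not_less)
      qed
    qed (intro sets.Un sets.finite_UN m finite_lessThan)
    also have "\<dots> \<le> measure S (?N T) + (measure S (\<Union>k<T. ?E1 k) + measure S (\<Union>k<T. ?E2 k))"
      by (intro order_trans[OF measure_Un_le] add_left_mono measure_Un_le sets.Un sets.finite_UN m finite_lessThan)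
    also have "measure S (\<Union>k<T. ?E1 k) \<le> (\<Sum>k<T. measure S (?E1 k))"
      by (intro measure_UNION_le m) auto
    also have "\<dots> \<le> (\<Sum>k<T. 2 * (1 / real T)\<^sup>2)" by (intro sum_mono E1 T) auto
    also have "\<dots> = 2 / real T" using T by (simp add: power2_eq_square)
    also have "measure S (\<Union>k<T. ?E2 k) \<le> (\<Sum>k<T. measure S (?E2 k))"
      by (intro measure_UNION_le m) auto
    also have "\<dots> \<le> (\<Sum>k<T. K * B k powr q * ln (real T) powr (- (q / 2)))" by (intro sum_mono E2 T) auto
    also have "\<dots> = K * (\<Sum>k<T. B k powr q) * ln (real T) powr (- (q / 2))"
      by (simp add: sum_distrib_left sum_distrib_right mult.assoc)
    also have "\<dots> \<le> K * (\<Sum>k. B k powr q) * ln (real T) powr (- (q / 2))"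
      using tails unfolding B_def q_def by (intro mult_right_mono mult_left_mono sum_le_suminf) (auto simp: K_def)
    finally show ?thesis by (simp add: add.assoc)
  qed
  have "(\<lambda>T. measure S (?N T) + 2 / real T + K * (\<Sum>k. B k powr q) * ln (real T) powr (- (q / 2))) \<longlonglongrightarrow> 0 + 0 + K * (\<Sum>k. B k powr q) * 0"
  proof (intro tendsto_add tendsto_mult tendsto_const weak_law_upper h hv)
    show "(\<lambda>T. 2 / real T) \<longlonglongrightarrow> 0" by real_asymp
    have "- (q / 2) < 0" using p by (simp add: q_def)
    then show "(\<lambda>T. ln (real T) powr (- (q / 2))) \<longlonglongrightarrow> 0"
      by (rule tendsto_neg_powr) real_asymp
  qed
  then have lim: "(\<lambda>T. measure S (?N T) + 2 / real T + K * (\<Sum>k. B k powr q) * ln (real T) powr (- (q / 2))) \<longlonglongrightarrow> 0" by simp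
  show ?thesis
  proof (rule tendsto_sandwich[OF _ _ tendsto_const lim])
    show "eventually (\<lambda>T. ?P T \<le> measure S (?N T) + 2 / real T + K * (\<Sum>k. B k powr q) * ln (real T) powr (- (q / 2))) sequentially"
      using bound unfolding eventually_sequentially by blast
  qed simp
qed

text \<open>If \<open>G\<close> or the sum of the coefficients is 0 then so is the process, almost surely.\<close>

lemma uniform_lag_deviation:
  assumes p: "4 \<le> p" and g: "Lq_le S p g Gp" and mean: "(\<integral>e. g e \<partial>S) = 0"
    and d: "\<And>i. influence_le p g i (d i)" "summable d"
    and g4: "Lq_le S 4 g G" and d4: "\<And>i. influence_le 4 g i (d4 i)" "summable d4"
    and tails: "summable (\<lambda>k. (\<Sum>j. d (j + k)) powr (p / 2))"
    and c: "64 * G * suminf d4 \<le> c"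
  shows "(\<lambda>T. measure S {e \<in> space S. \<exists>k<T. c * sqrt (real T * ln (real T)) < \<bar>lag_sum g (T - k) k e\<bar>}) \<longlonglongrightarrow> 0"
proof (cases "0 < G \<and> 0 < suminf d4")
  case True
  then show ?thesis by (intro uniform_lag_deviation_nondegenerate[OF p g mean d g4 d4 tails _ _ c]) auto
next
  case False
  have gi: "integrable S g" using g4 by (intro Lq_le_S_integrable) auto
  have [measurable]: "g \<in> borel_measurable S" using gi by auto
  have G0: "0 \<le> G" using g4 by (simp add: Lq_le_def)
  have d40: "0 \<le> d4 i" for i using d4(1)[of i] by (simp add: influence_le_def Lq_le_def)
  have D0: "0 \<le> suminf d4" by (rule suminf_nonneg[OF d4(2) d40])
  have c0: "0 \<le> c" using c mult_nonneg_nonneg[OF G0 D0] by linarith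
  have "Lq_le S 4 g 0"
  proof (cases "G = 0")
    case True
    then show ?thesis using g4 by simp
  next
    case False
    then have "suminf d4 = 0" using \<open>\<not> (0 < G \<and> 0 < suminf d4)\<close> G0 D0 by auto
    then have "d4 i = 0" for i using suminf_eq_zero_iff[OF d4(2) d40] by simp
    then have inn: "Lq_le S 4 (innov i g) 0" for i
      using Lq_le_innov[OF gi d4(1)[of i]] by simp
    have "Lq_le S 4 (avg 0 g) 0" by (rule Lq_le_avg_of_innov[OF gi mean inn]) auto
    moreover have "avg 0 g = g" by (rule ext) simp
    ultimately show ?thesis by metis
  qed
  then have g0: "AE e in S. g e = 0" by (rule Lq_le_0_AE) simp
  have cov: "acov g k = 0" for k
  proof -
    have "acov g k = (\<integral>e. 0 \<partial>S)"
      unfolding acov_def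
    proof (rule integral_cong_AE)
      show "AE e in S. g e * avg k g e = 0" using g0 by eventually_elim simp
    qed measurable
    then show ?thesis by simp
  qed
  have "AE e in S. \<forall>s. g (shift s e) = 0" unfolding AE_all_countable using AE_shift[OF g0] by blast
  then have lag0: "AE e in S. \<forall>n k. lag_sum g n k e = 0"
    by eventually_elim (simp add: lag_sum_def cov)
  have "measure S {e \<in> space S. \<exists>k<T. c * sqrt (real T * ln (real T)) < \<bar>lag_sum g (T - k) k e\<bar>} = 0" for T
  proof -
    have "measure S {e \<in> space S. \<exists>k<T. c * sqrt (real T * ln (real T)) < \<bar>lag_sum g (T - k) k e\<bar>} \<le> measure S {}"
    proof (rule P.finite_measure_mono_AE)
      show "AE e in S. e \<in> {e \<in> space S. \<exists>k<T. c * sqrt (real T * ln (real T)) < \<bar>lag_sum g (T - k) k e\<bar>} \<longrightarrow> e \<in> {}"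
        using lag0
      proof eventually_elim
        case (elim e)
        have "0 \<le> c * sqrt (real T * ln (real T))" if "0 < T"
          using c0 that by (intro mult_nonneg_nonneg) auto
        then show ?case using elim by fastforce
      qed
    qed simp
    then show ?thesis using measure_nonneg[of S] by (simp add: order.antisym)
  qed
  then show ?thesis by simp
qed

end

section \<open>Operator norms of Toeplitz matrices and thresholding\<close>

lemma euclidean_norm_eq_L2_set: "euclidean_norm v = L2_set (vec_index v) {..<dim_vec v}"
  by (simp add: euclidean_norm_def L2_set_def scalar_prod_def power2_eq_square lessThan_atLeast0)

lemma euclidean_norm_mat_mult_vec:
  assumes "x \<in> carrier_vec T"
  shows "euclidean_norm (Matrix.mat T T a *\<^sub>v x) = L2_set (\<lambda>s. \<Sum>t<T. a (s, t) * vec_index x t) {..<T}"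
  unfolding euclidean_norm_eq_L2_set using assms
  by (intro L2_set_cong) (auto simp: scalar_prod_def lessThan_atLeast0 intro!: sum.cong)

text \<open>Cauchy-Schwarz with weights \<open>\<bar>a (s, t)\<bar>\<close>, followed by summation over the columns.\<close>

lemma Schur_test:
  fixes a :: "nat \<times> nat \<Rightarrow> real" and x :: "nat \<Rightarrow> real"
  assumes row: "\<And>s. s < T \<Longrightarrow> (\<Sum>t<T. \<bar>a (s, t)\<bar>) \<le> R" and col: "\<And>t. t < T \<Longrightarrow> (\<Sum>s<T. \<bar>a (s, t)\<bar>) \<le> R"
    and R: "0 \<le> R"
  shows "L2_set (\<lambda>s. \<Sum>t<T. a (s, t) * x t) {..<T} \<le> R * L2_set x {..<T}"
proof -
  have cs: "(\<Sum>t<T. a (s, t) * x t)\<^sup>2 \<le> R * (\<Sum>t<T. \<bar>a (s, t)\<bar> * (x t)\<^sup>2)" if s: "s < T" for s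
  proof -
    have "(\<Sum>t<T. a (s, t) * x t)\<^sup>2 = (\<Sum>t<T. sqrt \<bar>a (s, t)\<bar> * (sgn (a (s, t)) * sqrt \<bar>a (s, t)\<bar> * x t))\<^sup>2"
    proof (intro arg_cong[where f = "\<lambda>z. z\<^sup>2"] sum.cong refl)
      fix t
      have "sqrt \<bar>a (s, t)\<bar> * (sgn (a (s, t)) * sqrt \<bar>a (s, t)\<bar> * x t) = sgn (a (s, t)) * (sqrt \<bar>a (s, t)\<bar> * sqrt \<bar>a (s, t)\<bar>) * x t"
        by (simp only: mult_ac)
      also have "\<dots> = a (s, t) * x t" by (simp add: sgn_mult_abs)
      finally show "a (s, t) * x t = sqrt \<bar>a (s, t)\<bar> * (sgn (a (s, t)) * sqrt \<bar>a (s, t)\<bar> * x t)" ..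
    qed
    also have "\<dots> \<le> (\<Sum>t<T. (sqrt \<bar>a (s, t)\<bar>)\<^sup>2) * (\<Sum>t<T. (sgn (a (s, t)) * sqrt \<bar>a (s, t)\<bar> * x t)\<^sup>2)"
      by (rule Cauchy_Schwarz_ineq_sum)
    also have "\<dots> = (\<Sum>t<T. \<bar>a (s, t)\<bar>) * (\<Sum>t<T. \<bar>a (s, t)\<bar> * (x t)\<^sup>2)"
      by (intro arg_cong2[where f = "(*)"] sum.cong) (auto simp: power_mult_distrib sgn_if)
    also have "\<dots> \<le> R * (\<Sum>t<T. \<bar>a (s, t)\<bar> * (x t)\<^sup>2)"
      using row[OF s] by (intro mult_right_mono sum_nonneg) auto
    finally show ?thesis .
  qed
  have "(\<Sum>s<T. (\<Sum>t<T. a (s, t) * x t)\<^sup>2) \<le> (\<Sum>s<T. R * (\<Sum>t<T. \<bar>a (s, t)\<bar> * (x t)\<^sup>2))"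
    by (intro sum_mono cs) auto
  also have "\<dots> = R * (\<Sum>t<T. (x t)\<^sup>2 * (\<Sum>s<T. \<bar>a (s, t)\<bar>))"
    by (subst sum_distrib_left[symmetric], subst sum.swap) (simp add: sum_distrib_left mult.commute)
  also have "\<dots> \<le> R * (\<Sum>t<T. (x t)\<^sup>2 * R)"
    using R col by (intro mult_left_mono sum_mono) auto
  also have "\<dots> = R\<^sup>2 * (\<Sum>t<T. (x t)\<^sup>2)" by (simp add: power2_eq_square sum_distrib_left mult_ac)
  finally have "sqrt (\<Sum>s<T. (\<Sum>t<T. a (s, t) * x t)\<^sup>2) \<le> sqrt (R\<^sup>2 * (\<Sum>t<T. (x t)\<^sup>2))" by (rule real_sqrt_le_mono)
  then show ?thesis using R by (simp add: L2_set_def real_sqrt_mult)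
qed

lemma operator_norm_mat_eq:
  "operator_norm (Matrix.mat T T a) =
     (SUP x\<in>{x \<in> carrier_vec T. euclidean_norm x = 1}. L2_set (\<lambda>s. \<Sum>t<T. a (s, t) * vec_index x t) {..<T})"
  unfolding operator_norm_def by (intro SUP_cong) (auto simp: euclidean_norm_mat_mult_vec)

lemma unit_sphere_nonempty:
  assumes "0 < T"
  shows "{x \<in> carrier_vec T. euclidean_norm x = 1} \<noteq> {}"
proof -
  have "euclidean_norm (unit_vec T 0) = 1"
    using assms by (simp add: euclidean_norm_def)
  then show ?thesis using unit_vec_carrier[of T 0] by blast
qed

lemma image_le_of_Schur:
  fixes a :: "nat \<times> nat \<Rightarrow> real"
  assumes row: "\<And>s. s < T \<Longrightarrow> (\<Sum>t<T. \<bar>a (s, t)\<bar>) \<le> R" and col: "\<And>t. t < T \<Longrightarrow> (\<Sum>s<T. \<bar>a (s, t)\<bar>) \<le> R"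
    and R: "0 \<le> R" and x: "x \<in> {x \<in> carrier_vec T. euclidean_norm x = 1}"
  shows "L2_set (\<lambda>s. \<Sum>t<T. a (s, t) * vec_index x t) {..<T} \<le> R"
proof -
  from x have "dim_vec x = T" "euclidean_norm x = 1" by auto
  then show ?thesis using Schur_test[of T a R "vec_index x", OF row col R] by (simp add: euclidean_norm_eq_L2_set)
qed

lemma operator_norm_le_Schur:
  fixes a :: "nat \<times> nat \<Rightarrow> real"
  assumes T: "0 < T"
    and row: "\<And>s. s < T \<Longrightarrow> (\<Sum>t<T. \<bar>a (s, t)\<bar>) \<le> R" and col: "\<And>t. t < T \<Longrightarrow> (\<Sum>s<T. \<bar>a (s, t)\<bar>) \<le> R"
    and R: "0 \<le> R"
  shows "\<bar>operator_norm (Matrix.mat T T a)\<bar> \<le> R"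
proof -
  let ?U = "{x \<in> carrier_vec T. euclidean_norm x = 1}"
  let ?F = "\<lambda>x. L2_set (\<lambda>s. \<Sum>t<T. a (s, t) * vec_index x t) {..<T}"
  have ne: "?U \<noteq> {}" by (rule unit_sphere_nonempty[OF T])
  have le: "?F x \<le> R" if "x \<in> ?U" for x by (rule image_le_of_Schur[OF row col R that])
  have "(SUP x\<in>?U. ?F x) \<le> R" by (rule cSUP_least[OF ne le])
  moreover from ne obtain x where x: "x \<in> ?U" by blast
  have "bdd_above (?F ` ?U)" by (rule bdd_aboveI2[OF le])
  from cSUP_upper[OF x this] have "0 \<le> (SUP x\<in>?U. ?F x)" using L2_set_nonneg order_trans by blast
  ultimately show ?thesis unfolding operator_norm_mat_eq by simp
qed

lemma operator_norm_diff_le: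
  fixes a b :: "nat \<times> nat \<Rightarrow> real"
  shows "operator_norm (Matrix.mat T T a) \<le> operator_norm (Matrix.mat T T b) + (\<Sum>s<T. \<Sum>t<T. \<bar>a (s, t) - b (s, t)\<bar>)"
proof (cases "T = 0")
  case True
  have "Matrix.mat 0 0 a = Matrix.mat 0 0 b" by (rule eq_matI) auto
  then show ?thesis using True by simp
next
  case False
  then have T: "0 < T" by simp
  let ?U = "{x \<in> carrier_vec T. euclidean_norm x = 1}"
  let ?F = "\<lambda>a x. L2_set (\<lambda>s. \<Sum>t<T. a (s, t) * vec_index x t) {..<T}"
  let ?R = "\<lambda>a. \<Sum>s<T. \<Sum>t<T. \<bar>a (s, t) :: real\<bar>"
  have le: "?F a x \<le> ?R a" if "x \<in> ?U" for x a
  proof (rule image_le_of_Schur[OF _ _ _ that])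
    show "(\<Sum>t<T. \<bar>a (s, t)\<bar>) \<le> ?R a" if "s < T" for s
      using that by (intro member_le_sum[of s "{..<T}" "\<lambda>s. \<Sum>t<T. \<bar>a (s, t)\<bar>"]) (auto intro: sum_nonneg)
    show "(\<Sum>s<T. \<bar>a (s, t)\<bar>) \<le> ?R a" if "t < T" for t
      using that by (subst sum.swap, intro member_le_sum[of t "{..<T}" "\<lambda>t. \<Sum>s<T. \<bar>a (s, t)\<bar>"]) (auto intro: sum_nonneg)
  qed (auto intro: sum_nonneg)
  have bdd: "bdd_above (?F b ` ?U)" by (rule bdd_aboveI2[OF le])
  have "?F a x \<le> (SUP x\<in>?U. ?F b x) + ?R (\<lambda>z. a z - b z)" if x: "x \<in> ?U" for x
  proof -
    have "?F a x = L2_set (\<lambda>s. (\<Sum>t<T. b (s, t) * vec_index x t) + (\<Sum>t<T. (a (s, t) - b (s, t)) * vec_index x t)) {..<T}"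
      by (intro L2_set_cong refl) (simp add: sum.distrib[symmetric] left_diff_distrib)
    also have "\<dots> \<le> ?F b x + ?F (\<lambda>z. a z - b z) x" by (rule L2_set_triangle_ineq)
    also have "\<dots> \<le> (SUP x\<in>?U. ?F b x) + ?R (\<lambda>z. a z - b z)"
      by (intro add_mono cSUP_upper[OF x bdd] le x)
    finally show ?thesis .
  qed
  then show ?thesis unfolding operator_norm_mat_eq by (intro cSUP_least unit_sphere_nonempty T) auto
qed

text \<open>The norm is a supremum over an uncountable set; it is measurable because it is a continuous function of
finitely many entries.\<close>

lemma borel_measurable_operator_norm:
  assumes "\<And>s t. (\<lambda>\<omega>. a \<omega> (s, t)) \<in> borel_measurable M"
  shows "(\<lambda>\<omega>. operator_norm (Matrix.mat T T (a \<omega>))) \<in> borel_measurable M"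
proof -
  let ?F = "\<lambda>b :: nat \<times> nat \<Rightarrow> real. operator_norm (Matrix.mat T T b)"
  let ?G = "\<lambda>b c :: nat \<times> nat \<Rightarrow> real. \<Sum>s<T. \<Sum>t<T. \<bar>c (s, t) - b (s, t)\<bar>"
  have "isCont ?F b" for b
    unfolding isCont_def
  proof (rule LIM_zero_cancel, rule Lim_null_comparison)
    have "continuous_on UNIV (?G b)"
      by (intro continuous_intros continuous_on_product_coordinates)
    then have "isCont (?G b) b" by (simp add: continuous_on_eq_continuous_at)
    then show "((?G b) \<longlongrightarrow> 0) (at b)" by (simp add: isCont_def)
    have "norm (?F c - ?F b) \<le> ?G b c" for c
      using operator_norm_diff_le[of T c b] operator_norm_diff_le[of T b c]
      by (simp add: abs_le_iff abs_minus_commute)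
    then show "\<forall>\<^sub>F c in at b. norm (?F c - ?F b) \<le> ?G b c" by simp
  qed
  then have "continuous_on UNIV ?F" by (simp add: continuous_on_eq_continuous_at)
  then have F: "?F \<in> borel_measurable borel" by (rule borel_measurable_continuous_onI)
  have "a \<in> borel_measurable M"
    using assms by (intro measurable_coordinatewise_then_product) (auto simp: split_paired_all)
  from measurable_compose[OF this F] show ?thesis .
qed

text \<open>Each lag occurs at most twice in a row.\<close>

lemma Toeplitz_row_sum_le:
  fixes b :: "nat \<Rightarrow> real"
  assumes b: "\<And>k. 0 \<le> b k" and s: "s < T"
  shows "(\<Sum>t<T. b (nat \<bar>int s - int t\<bar>)) \<le> 2 * (\<Sum>k<T. b k)"
proof -
  have idx: "nat \<bar>int s - int t\<bar> = (if t \<le> s then s - t else t - s)" for t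
    by (cases "t \<le> s") (simp_all add: abs_if nat_diff_distrib')
  have "(\<Sum>t<T. b (nat \<bar>int s - int t\<bar>)) = (\<Sum>t\<in>{..s} \<union> {s<..<T}. b (nat \<bar>int s - int t\<bar>))"
    using s by (intro sum.cong) auto
  also have "\<dots> = (\<Sum>t\<in>{..s}. b (nat \<bar>int s - int t\<bar>)) + (\<Sum>t\<in>{s<..<T}. b (nat \<bar>int s - int t\<bar>))"
    by (intro sum.union_disjoint) auto
  also have "(\<Sum>t\<in>{..s}. b (nat \<bar>int s - int t\<bar>)) = (\<Sum>k\<in>{..s}. b k)"
    by (rule sum.reindex_bij_witness[of _ "\<lambda>k. s - k" "\<lambda>t. s - t"]) (auto simp: idx nat_diff_distrib')
  also have "\<dots> \<le> (\<Sum>k<T. b k)" using s b by (intro sum_mono2) auto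
  also have "(\<Sum>t\<in>{s<..<T}. b (nat \<bar>int s - int t\<bar>)) = (\<Sum>k\<in>{0<..<T - s}. b k)"
    by (rule sum.reindex_bij_witness[of _ "\<lambda>k. s + k" "\<lambda>t. t - s"]) (auto simp: idx nat_diff_distrib')
  also have "\<dots> \<le> (\<Sum>k<T. b k)" using b by (intro sum_mono2) auto
  finally show ?thesis by simp
qed

text \<open>A kept value \<open>c\<close> is off by at most \<open>A / 2\<close> and then its mean has at least this size; a killed value has a mean
below \<open>3 / 2 * A\<close>, and the error is this mean. The weight \<open>w\<close> is the relative bias.\<close>

lemma threshold_entry_error:
  fixes c \<gamma> w A :: real
  assumes w: "0 \<le> w" "w \<le> 1" and dev: "\<bar>c - (1 - w) * \<gamma>\<bar> \<le> A / 2"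
  shows "\<bar>(if \<bar>c\<bar> \<ge> A then c else 0) - \<gamma>\<bar> \<le> 3 / 2 * A + w * \<bar>\<gamma>\<bar>"
    and "\<bar>(if \<bar>c\<bar> \<ge> A then c else 0) - \<gamma>\<bar> \<le> 2 * \<bar>\<gamma>\<bar>"
proof -
  let ?m = "(1 - w) * \<gamma>" and ?h = "if \<bar>c\<bar> \<ge> A then c else 0"
  have m\<gamma>: "\<bar>?m - \<gamma>\<bar> = w * \<bar>\<gamma>\<bar>" "\<bar>?m\<bar> = (1 - w) * \<bar>\<gamma>\<bar>"
  proof -
    have "?m - \<gamma> = - (w * \<gamma>)" by (simp add: left_diff_distrib)
    then show "\<bar>?m - \<gamma>\<bar> = w * \<bar>\<gamma>\<bar>" using w by (simp add: abs_mult)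
    show "\<bar>?m\<bar> = (1 - w) * \<bar>\<gamma>\<bar>" using w by (simp add: abs_mult)
  qed
  have w\<gamma>: "0 \<le> w * \<bar>\<gamma>\<bar>" "w * \<bar>\<gamma>\<bar> \<le> \<bar>\<gamma>\<bar>" using w by (auto simp: mult_left_le_one_le)
  have A: "0 \<le> A" using order_trans[OF abs_ge_zero dev] by simp
  have tri': "\<bar>?m\<bar> \<le> \<bar>c\<bar> + \<bar>c - ?m\<bar>" "\<bar>c\<bar> \<le> \<bar>?m\<bar> + \<bar>c - ?m\<bar>" by linarith+
  have 1: "\<bar>?h - ?m\<bar> \<le> 3 / 2 * A"
  proof (cases "A \<le> \<bar>c\<bar>")
    case True
    then show ?thesis using dev A by simp
  next
    case False
    then have "\<bar>?m\<bar> \<le> 3 / 2 * A" using tri'(1) dev by linarith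
    then show ?thesis using False by simp
  qed
  have 2: "\<bar>?h - ?m\<bar> \<le> \<bar>?m\<bar>"
  proof (cases "A \<le> \<bar>c\<bar>")
    case True
    then have "\<bar>c - ?m\<bar> \<le> \<bar>?m\<bar>" using tri'(2) dev by linarith
    then show ?thesis using True by simp
  qed simp
  have tri: "\<bar>?h - \<gamma>\<bar> \<le> \<bar>?h - ?m\<bar> + \<bar>?m - \<gamma>\<bar>" by linarith
  show "\<bar>?h - \<gamma>\<bar> \<le> 3 / 2 * A + w * \<bar>\<gamma>\<bar>" using tri 1 m\<gamma>(1) by linarith
  have "\<bar>?m\<bar> + \<bar>?m - \<gamma>\<bar> = \<bar>\<gamma>\<bar>" unfolding m\<gamma> by (simp add: left_diff_distrib)
  then show "\<bar>?h - \<gamma>\<bar> \<le> 2 * \<bar>\<gamma>\<bar>" using tri 2 by linarith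
qed

lemma threshold_total_error:
  fixes c \<gamma> :: "nat \<Rightarrow> real" and A :: real
  assumes T: "0 < T" and A: "0 \<le> A" and m: "1 \<le> m"
    and dev: "\<And>k. k < T \<Longrightarrow> \<bar>c k - (1 - real k / real T) * \<gamma> k\<bar> \<le> A / 2"
    and \<Gamma>: "(\<Sum>k<T. \<bar>\<gamma> k\<bar>) \<le> \<Gamma>" and tail: "(\<Sum>k\<in>{m..<T}. \<bar>\<gamma> k\<bar>) \<le> \<rho>"
  shows "(\<Sum>k<T. \<bar>(if k = 0 \<or> \<bar>c k\<bar> \<ge> A then c k else 0) - \<gamma> k\<bar>) \<le> 3 / 2 * (real m * A) + real m / real T * \<Gamma> + 2 * \<rho>"
proof -
  let ?e = "\<lambda>k. \<bar>(if k = 0 \<or> \<bar>c k\<bar> \<ge> A then c k else 0) - \<gamma> k\<bar>"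
  have near: "?e k \<le> 3 / 2 * A + real k / real T * \<bar>\<gamma> k\<bar>" if k: "k < T" for k
  proof (cases "k = 0")
    case True
    then show ?thesis using dev[OF k] A by simp
  next
    case False
    then show ?thesis using threshold_entry_error(1)[OF _ _ dev[OF k]] k by simp
  qed
  have far: "?e k \<le> 2 * \<bar>\<gamma> k\<bar>" if k: "k < T" "0 < k" for k
    using threshold_entry_error(2)[OF _ _ dev[OF k(1)]] k by simp
  have "(\<Sum>k<T. ?e k) = (\<Sum>k\<in>{..<min m T} \<union> {m..<T}. ?e k)" by (intro sum.cong) auto
  also have "\<dots> = (\<Sum>k<min m T. ?e k) + (\<Sum>k\<in>{m..<T}. ?e k)" by (intro sum.union_disjoint) auto
  also have "(\<Sum>k<min m T. ?e k) \<le> (\<Sum>k<min m T. 3 / 2 * A + real m / real T * \<bar>\<gamma> k\<bar>)"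
  proof (rule sum_mono)
    fix k assume k: "k \<in> {..<min m T}"
    then have "real k / real T * \<bar>\<gamma> k\<bar> \<le> real m / real T * \<bar>\<gamma> k\<bar>"
      by (intro mult_right_mono divide_right_mono) auto
    then show "?e k \<le> 3 / 2 * A + real m / real T * \<bar>\<gamma> k\<bar>" using near[of k] k by simp
  qed
  also have "\<dots> = real (min m T) * (3 / 2 * A) + real m / real T * (\<Sum>k<min m T. \<bar>\<gamma> k\<bar>)"
    by (simp add: sum.distrib sum_distrib_left)
  also have "\<dots> \<le> real m * (3 / 2 * A) + real m / real T * \<Gamma>"
  proof (intro add_mono mult_right_mono mult_left_mono)
    have "(\<Sum>k<min m T. \<bar>\<gamma> k\<bar>) \<le> (\<Sum>k<T. \<bar>\<gamma> k\<bar>)" by (intro sum_mono2) auto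
    then show "(\<Sum>k<min m T. \<bar>\<gamma> k\<bar>) \<le> \<Gamma>" using \<Gamma> by linarith
  qed (use A in auto)
  also have "(\<Sum>k\<in>{m..<T}. ?e k) \<le> (\<Sum>k\<in>{m..<T}. 2 * \<bar>\<gamma> k\<bar>)"
    using m by (intro sum_mono far) auto
  also have "\<dots> \<le> 2 * \<rho>" using tail by (simp add: sum_distrib_left[symmetric])
  finally show ?thesis by (simp add: algebra_simps)
qed

lemma cutoff_exists:
  fixes L \<alpha> :: real
  assumes L: "0 < L" "L \<le> 1" and \<alpha>: "0 < \<alpha>"
  defines "r \<equiv> L powr (\<alpha> / (2 * (1 + \<alpha>)))"
  obtains m :: nat where "1 \<le> m" "real m * sqrt L \<le> 2 * r" "real m * L \<le> 2 * r" "real m powr (- \<alpha>) \<le> r"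
proof -
  \<comment> \<open>\<open>m \<sim> L powr (- \<beta>)\<close>, where \<open>1 / 2 - \<beta> = \<alpha> * \<beta>\<close> equates the rates of the thresholding error and of the tail\<close>
  define \<beta> where "\<beta> = 1 / (2 * (1 + \<alpha>))"
  have \<beta>: "0 < \<beta>" "\<alpha> / (2 * (1 + \<alpha>)) = \<alpha> * \<beta>" "1 / 2 - \<beta> = \<alpha> * \<beta>"
    using \<alpha> by (simp_all add: \<beta>_def field_simps)
  let ?x = "L powr (- \<beta>)"
  have x1: "1 \<le> ?x" using L \<beta> by (simp add: powr_minus_divide powr_le1)
  define m where "m = nat \<lceil>?x\<rceil>"
  have mx: "?x \<le> real m" unfolding m_def by (rule real_nat_ceiling_ge)
  have m2: "real m \<le> 2 * ?x" using x1 unfolding m_def by linarith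
  have "1 \<le> m" using mx x1 by linarith
  moreover have sq: "real m * sqrt L \<le> 2 * r"
  proof -
    have "real m * sqrt L \<le> 2 * ?x * sqrt L" using m2 L by (intro mult_right_mono) auto
    also have "\<dots> = 2 * L powr (1 / 2 - \<beta>)"
      using L by (simp add: powr_half_sqrt[symmetric] powr_add[symmetric])
    finally show ?thesis unfolding r_def \<beta>(2) \<beta>(3) by simp
  qed
  moreover have "real m * L \<le> 2 * r"
  proof -
    have "L = sqrt L * sqrt L" using L by simp
    also have "\<dots> \<le> sqrt L * 1" using L by (intro mult_left_mono) auto
    finally have "real m * L \<le> real m * sqrt L" by (intro mult_left_mono) auto
    then show ?thesis using sq by linarith
  qed
  moreover have "real m powr (- \<alpha>) \<le> r"
  proof -
    have "real m powr (- \<alpha>) \<le> ?x powr (- \<alpha>)" using mx x1 \<alpha> by (intro powr_mono2') auto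
    also have "\<dots> = r" unfolding r_def \<beta>(2) by (simp add: powr_powr mult.commute)
    finally show ?thesis .
  qed
  ultimately show ?thesis using that by blast
qed

text \<open>The hypothesis \<open>3 \<le> T\<close> makes \<open>ln T\<close> at least 1, so that the bias \<open>m / T\<close> is at most \<open>m * L T\<close>; as
\<open>L T \<le> 1\<close> it does not exceed the order \<open>m * sqrt (L T)\<close> of the thresholding error.\<close>

lemma thresholded_Toeplitz_error:
  fixes ch \<gamma> :: "nat \<Rightarrow> real" and c \<alpha> :: real
  defines "L \<equiv> \<lambda>T. ln (real T) / real T"
  assumes T: "3 \<le> T" and \<alpha>: "0 < \<alpha>" and c: "0 \<le> c"
    and dev: "\<And>k. k < T \<Longrightarrow> \<bar>ch k - (1 - real k / real T) * \<gamma> k\<bar> \<le> c * sqrt (L T)"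
    and \<Gamma>: "(\<Sum>k<T. \<bar>\<gamma> k\<bar>) \<le> \<Gamma>" and \<rho>: "0 \<le> \<rho>" "\<And>m. 1 \<le> m \<Longrightarrow> (\<Sum>k\<in>{m..<T}. \<bar>\<gamma> k\<bar>) \<le> \<rho> * real m powr (- \<alpha>)"
  defines "E \<equiv> \<lambda>k. (if k = 0 \<or> \<bar>ch k\<bar> \<ge> 2 * c * sqrt (L T) then ch k else 0) - \<gamma> k"
  shows "\<bar>operator_norm (Matrix.mat T T (\<lambda>(s, t). E (nat \<bar>int s - int t\<bar>)))\<bar>
    \<le> (12 * c + 4 * \<Gamma> + 4 * \<rho>) * L T powr (\<alpha> / (2 * (1 + \<alpha>)))"
proof -
  have T0: "0 < T" using T by simp
  have ln1: "1 \<le> ln (real T)"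
  proof -
    have "exp 1 \<le> (3 :: real)" by (rule exp_le)
    also have "3 \<le> real T" using T by simp
    finally show ?thesis using T0 by (subst ln_ge_iff) auto
  qed
  have L: "0 < L T" "L T \<le> 1" "1 / real T \<le> L T"
    using ln1 T0 ln_le_minus_one[of "real T"] by (auto simp: L_def divide_right_mono)
  let ?r = "L T powr (\<alpha> / (2 * (1 + \<alpha>)))" and ?A = "2 * c * sqrt (L T)"
  obtain m where m: "1 \<le> m" "real m * sqrt (L T) \<le> 2 * ?r" "real m * L T \<le> 2 * ?r" "real m powr (- \<alpha>) \<le> ?r"
    using cutoff_exists[OF L(1,2) \<alpha>] by blast
  have A0: "0 \<le> ?A" using c L by simp
  have \<Gamma>0: "0 \<le> \<Gamma>" by (rule order_trans[OF sum_nonneg \<Gamma>]) simp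
  have dev': "\<bar>ch k - (1 - real k / real T) * \<gamma> k\<bar> \<le> ?A / 2" if "k < T" for k using dev[OF that] by simp
  have total: "(\<Sum>k<T. \<bar>E k\<bar>) \<le> 3 / 2 * (real m * ?A) + real m / real T * \<Gamma> + 2 * (\<rho> * real m powr (- \<alpha>))"
    unfolding E_def by (rule threshold_total_error[OF T0 A0 m(1) dev' \<Gamma> \<rho>(2)[OF m(1)]])
  let ?R = "2 * (\<Sum>k<T. \<bar>E k\<bar>)"
  have "\<bar>operator_norm (Matrix.mat T T (\<lambda>(s, t). E (nat \<bar>int s - int t\<bar>)))\<bar> \<le> ?R"
  proof (rule operator_norm_le_Schur[OF T0])
    show "(\<Sum>t<T. \<bar>case (s, t) of (s, t) \<Rightarrow> E (nat \<bar>int s - int t\<bar>)\<bar>) \<le> ?R" if "s < T" for s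
      using Toeplitz_row_sum_le[of "\<lambda>k. \<bar>E k\<bar>", OF _ that] by simp
    show "(\<Sum>s<T. \<bar>case (s, t) of (s, t) \<Rightarrow> E (nat \<bar>int s - int t\<bar>)\<bar>) \<le> ?R" if "t < T" for t
      using Toeplitz_row_sum_le[of "\<lambda>k. \<bar>E k\<bar>", OF _ that] by (simp add: abs_minus_commute[of "int t"])
  qed (auto intro: sum_nonneg)
  also have "\<dots> \<le> 2 * (3 / 2 * (4 * c * ?r) + 2 * ?r * \<Gamma> + 2 * (\<rho> * ?r))"
  proof -
    have "real m * ?A = 2 * c * (real m * sqrt (L T))" by simp
    also have "\<dots> \<le> 2 * c * (2 * ?r)" using m(2) c by (intro mult_left_mono) auto
    finally have 1: "real m * ?A \<le> 4 * c * ?r" by simp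
    have "real m / real T = real m * (1 / real T)" by simp
    also have "\<dots> \<le> real m * L T" using L(3) by (intro mult_left_mono) auto
    finally have "real m / real T \<le> 2 * ?r" using m(3) by linarith
    then have 2: "real m / real T * \<Gamma> \<le> 2 * ?r * \<Gamma>" using \<Gamma>0 by (rule mult_right_mono)
    have 3: "\<rho> * real m powr (- \<alpha>) \<le> \<rho> * ?r" using m(4) \<rho>(1) by (rule mult_left_mono)
    have "3 / 2 * (real m * ?A) + real m / real T * \<Gamma> + 2 * (\<rho> * real m powr (- \<alpha>))
      \<le> 3 / 2 * (4 * c * ?r) + 2 * ?r * \<Gamma> + 2 * (\<rho> * ?r)"
      by (intro add_mono mult_left_mono 1 2 3) auto
    from order_trans[OF total this] show ?thesis by (rule mult_left_mono) simp
  qed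
  also have "\<dots> = (12 * c + 4 * \<Gamma> + 4 * \<rho>) * ?r" by (simp add: algebra_simps)
  finally show ?thesis .
qed

section \<open>The process as a function of independent innovations\<close>

locale coupled_innovations = prob_space M for M :: "'a measure" +
  fixes eps eps' :: "int \<Rightarrow> 'a \<Rightarrow> real"
  assumes iid: "iid_with_copy M eps eps'"
begin

abbreviation N :: "real measure" where "N \<equiv> distr M borel (eps 0)"

lemma indep_all: "indep_vars (\<lambda>_. borel) (case_sum eps eps') UNIV"
  using iid by (simp add: iid_with_copy_def)

lemma rv_all [measurable]: "case_sum eps eps' j \<in> borel_measurable M"
  using indep_all by (simp add: indep_vars_def)

lemma rv_eps [measurable]: "eps t \<in> borel_measurable M" "eps' t \<in> borel_measurable M"
  using rv_all[of "Inl t"] rv_all[of "Inr t"] by simp_all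

lemma distr_all: "distr M borel (case_sum eps eps' j) = N"
  using iid by (cases j) (auto simp: iid_with_copy_def)

sublocale seq: sequence_space N
proof -
  have "prob_space N" by (rule prob_space_distr) measurable
  then show "sequence_space N"
    unfolding sequence_space_def by (intro product_prob_spaceI)
qed

lemma sets_S: "sets seq.S = sets (PiM UNIV (\<lambda>_. borel))"
  by (intro sets_PiM_cong) auto

lemma measurable_S_iff: "f \<in> borel_measurable (PiM UNIV (\<lambda>_. borel)) \<longleftrightarrow> f \<in> borel_measurable seq.S"
  using measurable_cong_sets[OF sets_S refl] by blast

lemma distr_iid_sequence:
  fixes \<tau> :: "nat \<Rightarrow> int + int"
  assumes "inj \<tau>"
  shows "distr M seq.S (\<lambda>\<omega> i. case_sum eps eps' (\<tau> i) \<omega>) = seq.S"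
proof -
  let ?\<Omega> = "PiM (UNIV :: (int + int) set) (\<lambda>_. N)"
  have sets_\<Omega>: "sets ?\<Omega> = sets (PiM UNIV (\<lambda>_. borel))" by (intro sets_PiM_cong) auto
  have "distr M (PiM UNIV (\<lambda>_. borel)) (\<lambda>\<omega>. \<lambda>j\<in>UNIV. case_sum eps eps' j \<omega>) =
      PiM UNIV (\<lambda>j. distr M borel (case_sum eps eps' j))"
    using indep_all by (subst (asm) indep_vars_iff_distr_eq_PiM) auto
  then have "distr M (PiM UNIV (\<lambda>_. borel)) (\<lambda>\<omega> j. case_sum eps eps' j \<omega>) = ?\<Omega>"
    by (simp only: distr_all restrict_def UNIV_I if_True)
  then have all: "distr M ?\<Omega> (\<lambda>\<omega> j. case_sum eps eps' j \<omega>) = ?\<Omega>"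
    using distr_cong[OF refl sets_\<Omega> refl, of M "\<lambda>\<omega> j. case_sum eps eps' j \<omega>"] by simp
  have m1: "(\<lambda>\<omega> j. case_sum eps eps' j \<omega>) \<in> M \<rightarrow>\<^sub>M ?\<Omega>"
    by (rule measurable_PiM_single') auto
  have m2: "(\<lambda>z n. z (\<tau> n)) \<in> ?\<Omega> \<rightarrow>\<^sub>M seq.S"
    by (rule measurable_PiM_single') (auto simp: space_PiM)
  have "distr M seq.S (\<lambda>\<omega> i. case_sum eps eps' (\<tau> i) \<omega>) =
      distr (distr M ?\<Omega> (\<lambda>\<omega> j. case_sum eps eps' j \<omega>)) seq.S (\<lambda>z n. z (\<tau> n))"
    by (subst distr_distr[OF m2 m1]) (simp add: comp_def)
  also have "\<dots> = distr ?\<Omega> seq.S (\<lambda>z. \<lambda>n\<in>UNIV. z (\<tau> n))" by (simp only: all restrict_UNIV)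
  also have "\<dots> = seq.S"
    using assms seq.prob_space by (intro distr_PiM_reindex) auto
  finally show ?thesis .
qed

definition past :: "int \<Rightarrow> 'a \<Rightarrow> nat \<Rightarrow> real" where
  "past t \<omega> = (\<lambda>i. eps (t - int i) \<omega>)"

lemma measurable_past [measurable]: "past t \<in> M \<rightarrow>\<^sub>M seq.S"
  unfolding past_def by (rule measurable_PiM_single') auto

lemma distr_past: "distr M seq.S (past t) = seq.S"
  using distr_iid_sequence[of "\<lambda>i. Inl (t - int i)"] by (simp add: past_def[abs_def] inj_def)

lemma shift_past: "shift s (past t \<omega>) = past (t - int s) \<omega>"
  by (simp add: shift_def past_def algebra_simps)

lemma causal_process_past: "causal_process g eps t \<omega> = g (past t \<omega>)"
  by (simp add: causal_process_def past_def)

lemma coupled_process_past: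
  "coupled_process g eps eps' (int t) \<omega> = g ((past (int t) \<omega>)(t := eps' 0 \<omega>))"
  unfolding coupled_process_def causal_process_def past_def
  by (intro arg_cong[where f = g]) auto

text \<open>The copy of the innovation at time 0 followed by the original past is one independent sequence, so its law
is known without describing a joint law on a product space.\<close>

lemma nn_integral_coupled:
  fixes t :: int
  assumes [measurable]: "\<Phi> \<in> borel_measurable (borel \<Otimes>\<^sub>M seq.S)"
  shows "(\<integral>\<^sup>+\<omega>. \<Phi> (eps' 0 \<omega>, past t \<omega>) \<partial>M) = (\<integral>\<^sup>+x. \<integral>\<^sup>+y. \<Phi> (y (0::nat), x) \<partial>seq.S \<partial>seq.S)"
proof -
  define \<tau> where "\<tau> = case_nat (Inr 0 :: int + int) (\<lambda>i. Inl (t - int i))"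
  have "inj \<tau>" by (auto simp: inj_def \<tau>_def split: nat.splits)
  have Z: "(\<lambda>i. case_sum eps eps' (\<tau> i) \<omega>) = case_nat (eps' 0 \<omega>) (past t \<omega>)" for \<omega>
    by (auto simp: fun_eq_iff \<tau>_def past_def split: nat.split)
  have dZ: "distr M seq.S (\<lambda>\<omega>. case_nat (eps' 0 \<omega>) (past t \<omega>)) = seq.S"
    using distr_iid_sequence[OF \<open>inj \<tau>\<close>] unfolding Z .
  have [measurable]: "(\<lambda>\<omega>. case_nat (eps' 0 \<omega>) (past t \<omega>)) \<in> M \<rightarrow>\<^sub>M seq.S"
    unfolding Z[symmetric] by (rule measurable_PiM_single') auto
  have c0[measurable]: "(\<lambda>z. z (0::nat)) \<in> seq.S \<rightarrow>\<^sub>M borel"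
    using measurable_component_singleton[of "0::nat" UNIV "\<lambda>_. N"] by simp
  have "(\<integral>\<^sup>+\<omega>. \<Phi> (eps' 0 \<omega>, past t \<omega>) \<partial>M) =
      (\<integral>\<^sup>+\<omega>. \<Phi> ((case_nat (eps' 0 \<omega>) (past t \<omega>)) 0, shift 1 (case_nat (eps' 0 \<omega>) (past t \<omega>))) \<partial>M)"
    by (simp add: shift_def)
  also have "\<dots> = (\<integral>\<^sup>+z. \<Phi> (z 0, shift 1 z) \<partial>distr M seq.S (\<lambda>\<omega>. case_nat (eps' 0 \<omega>) (past t \<omega>)))"
    by (subst nn_integral_distr) auto
  also have "\<dots> = (\<integral>\<^sup>+x. \<integral>\<^sup>+y. \<Phi> ((comb_seq 1 y x) 0, shift 1 (comb_seq 1 y x)) \<partial>seq.S \<partial>seq.S)"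
    unfolding dZ by (rule seq.nn_integral_comb[symmetric]) measurable
  also have "\<dots> = (\<integral>\<^sup>+x. \<integral>\<^sup>+y. \<Phi> (y 0, x) \<partial>seq.S \<partial>seq.S)"
    by (simp only: shift_comb_seq_same) (simp add: comb_seq_def)
  finally show ?thesis .
qed

lemma nn_integral_past:
  assumes [measurable]: "f \<in> borel_measurable seq.S"
  shows "(\<integral>\<^sup>+\<omega>. f (past t \<omega>) \<partial>M) = (\<integral>\<^sup>+e. f e \<partial>seq.S)"
  using nn_integral_distr[OF measurable_past[of t], of f] by (simp add: distr_past)

lemma integral_past:
  fixes f :: "_ \<Rightarrow> real"
  assumes [measurable]: "f \<in> borel_measurable seq.S"
  shows "(\<integral>\<omega>. f (past t \<omega>) \<partial>M) = (\<integral>e. f e \<partial>seq.S)"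
  using integral_distr[OF measurable_past[of t], of f] by (simp add: distr_past)

lemma Lq_le_past_iff:
  assumes [measurable]: "f \<in> borel_measurable seq.S"
  shows "Lq_le M q (\<lambda>\<omega>. f (past t \<omega>)) A \<longleftrightarrow> Lq_le seq.S q f A"
  using nn_integral_past[of "\<lambda>e. ennreal (\<bar>f e\<bar> powr q)" t] by (simp add: Lq_le_def)

lemma measurable_upd_real [measurable]: "(\<lambda>(a, x). x(t := a)) \<in> borel \<Otimes>\<^sub>M seq.S \<rightarrow>\<^sub>M seq.S"
proof (rule measurable_PiM_single')
  fix j :: nat
  show "(\<lambda>z. (case z of (a, x) \<Rightarrow> x(t := a)) j) \<in> borel \<Otimes>\<^sub>M seq.S \<rightarrow>\<^sub>M N"
    using measurable_component_singleton[of j UNIV "\<lambda>_. N"]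
    by (cases "j = t") (auto simp: case_prod_beta' intro: measurable_compose[OF measurable_snd])
qed (auto simp: space_PiM)

text \<open>Resampling preserves the law, so the difference has a finite norm by the triangle inequality; therefore
the coefficient is its norm and not the value 0 that a divergent integral has by convention.\<close>

lemma influence_dep_delta:
  assumes p: "1 \<le> p" and g: "Lq_le seq.S p g G"
  shows "seq.influence_le p g t (dep_delta M g eps eps' p t)"
    and "Lq_le M p (\<lambda>\<omega>. causal_process g eps (int t) \<omega> - coupled_process g eps eps' (int t) \<omega>) (dep_delta M g eps eps' p t)"
proof -
  have gm[measurable]: "g \<in> borel_measurable seq.S" using g by (simp add: Lq_le_def)
  let ?D = "\<lambda>\<omega>. causal_process g eps (int t) \<omega> - coupled_process g eps eps' (int t) \<omega>"
  let ?\<Phi> = "\<lambda>z. ennreal (\<bar>g (snd z) - g (case z of (a, x) \<Rightarrow> x(t := a))\<bar> powr p)"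
  have D: "?D \<omega> = g (past (int t) \<omega>) - g ((past (int t) \<omega>)(t := eps' 0 \<omega>))" for \<omega>
    by (simp add: causal_process_past coupled_process_past)
  have "(\<lambda>\<omega>. g (past (int t) \<omega>) - g (case (eps' 0 \<omega>, past (int t) \<omega>) of (a, x) \<Rightarrow> x(t := a))) \<in> borel_measurable M"
    by measurable
  then have Dm[measurable]: "?D \<in> borel_measurable M" unfolding D by simp
  have "Lq_le (seq.S \<Otimes>\<^sub>M seq.S) p (\<lambda>z. g (fst z) - g (case z of (x, y) \<Rightarrow> x(t := y 0))) (G + G)"
    by (intro Lq_le_diff Lq_le_distr[OF measurable_fst seq.distr_fst_S g] Lq_le_distr[OF seq.measurable_upd seq.distr_upd g] p)
  then have F: "Lq_le (seq.S \<Otimes>\<^sub>M seq.S) p (\<lambda>(x, y). g x - g (x(t := y 0))) (G + G)"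
    by (simp add: case_prod_beta')
  have Fm: "(\<lambda>z. ennreal (\<bar>case z of (x, y) \<Rightarrow> g x - g (x(t := y 0))\<bar> powr p)) \<in> borel_measurable (seq.S \<Otimes>\<^sub>M seq.S)"
    using F measurable_compose[of "\<lambda>(x, y). g x - g (x(t := y 0))" _ borel "\<lambda>r. ennreal (\<bar>r\<bar> powr p)"]
    by (auto simp: Lq_le_def)
  have "(\<integral>\<^sup>+\<omega>. ennreal (\<bar>?D \<omega>\<bar> powr p) \<partial>M) = (\<integral>\<^sup>+\<omega>. ?\<Phi> (eps' 0 \<omega>, past (int t) \<omega>) \<partial>M)"
    by (simp add: D)
  also have "\<dots> = (\<integral>\<^sup>+x. \<integral>\<^sup>+y. ?\<Phi> (y 0, x) \<partial>seq.S \<partial>seq.S)"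
    by (rule nn_integral_coupled) measurable
  also have "\<dots> = (\<integral>\<^sup>+z. ennreal (\<bar>case z of (x, y) \<Rightarrow> g x - g (x(t := y 0))\<bar> powr p) \<partial>(seq.S \<Otimes>\<^sub>M seq.S))"
    using seq.P.nn_integral_fst[OF Fm] by simp
  finally have eq: "(\<integral>\<^sup>+\<omega>. ennreal (\<bar>?D \<omega>\<bar> powr p) \<partial>M) =
      (\<integral>\<^sup>+z. ennreal (\<bar>case z of (x, y) \<Rightarrow> g x - g (x(t := y 0))\<bar> powr p) \<partial>(seq.S \<Otimes>\<^sub>M seq.S))" .
  have "Lq_le M p ?D (G + G)" using F Dm unfolding Lq_le_def eq by simp
  then have "integrable M (\<lambda>\<omega>. \<bar>?D \<omega>\<bar> powr p)" by (rule Lq_le_integrable_powr)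
  then show *: "Lq_le M p ?D (dep_delta M g eps eps' p t)"
    unfolding dep_delta_def using p by (intro Lq_le_Lp_norm Dm) auto
  show "seq.influence_le p g t (dep_delta M g eps eps' p t)"
    using * F unfolding seq.influence_le_def Lq_le_def eq by simp
qed

lemma autocov_causal_process:
  assumes g: "Lq_le seq.S 2 g G"
  shows "autocov M (causal_process g eps) k = seq.acov g (nat \<bar>k\<bar>)"
proof -
  have gm[measurable]: "g \<in> borel_measurable seq.S" using g by (simp add: Lq_le_def)
  have cov: "(\<integral>e. g (shift j e) * g e \<partial>seq.S) = seq.acov g j" for j
    unfolding seq.acov_def
    by (rule seq.integral_mult_shift[OF gm seq.integral_mult_Lq_2(1)[OF seq.Lq_le_shift[OF g] g]])
  have shifted: "(\<integral>\<omega>. g (shift j (past t \<omega>)) * g (past t \<omega>) \<partial>M) = seq.acov g j" for j t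
    using integral_past[of "\<lambda>e. g (shift j e) * g e" t] cov by simp
  show ?thesis
  proof (cases "0 \<le> k")
    case True
    define j where "j = nat k"
    have k: "k = int j" using True by (simp add: j_def)
    show ?thesis using shifted[of j "int j"] by (simp add: autocov_def causal_process_past shift_past k)
  next
    case False
    define j where "j = nat (- k)"
    have k: "k = - int j" using False by (simp add: j_def)
    show ?thesis using shifted[of j 0] by (simp add: autocov_def causal_process_past shift_past k mult.commute)
  qed
qed

lemma sample_autocov_causal_process:
  assumes k: "nat \<bar>k\<bar> < T"
  defines "j \<equiv> nat \<bar>k\<bar>"
  shows "sample_autocov (causal_process g eps) T k \<omega> =
    (seq.lag_sum g (T - j) j (past (int T) \<omega>) + real (T - j) * seq.acov g j) / real T"
proof -
  let ?X = "causal_process g eps"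
  have kj: "\<bar>k\<bar> = int j" by (simp add: j_def)
  have jT: "j < T" using k by (simp add: j_def)
  have "(\<Sum>t = \<bar>k\<bar> + 1..int T. ?X (t - \<bar>k\<bar>) \<omega> * ?X t \<omega>) =
      (\<Sum>s<T - j. ?X (int T - int (s + j)) \<omega> * ?X (int T - int s) \<omega>)"
    unfolding kj
    by (rule sum.reindex_bij_witness[of _ "\<lambda>s. int T - int s" "\<lambda>t. nat (int T - t)"]) (use jT in auto)
  also have "\<dots> = (\<Sum>s<T - j. g (shift s (past (int T) \<omega>)) * g (shift (s + j) (past (int T) \<omega>)))"
    by (simp add: causal_process_past shift_past mult.commute)
  also have "\<dots> = seq.lag_sum g (T - j) j (past (int T) \<omega>) + real (T - j) * seq.acov g j"
    by (simp add: seq.lag_sum_def sum_subtractf)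
  finally show ?thesis by (simp add: sample_autocov_def)
qed

end

section \<open>The rate of convergence\<close>

lemma bigo_powr_bound:
  fixes f :: "nat \<Rightarrow> real"
  assumes "f \<in> O(\<lambda>m. real m powr (- \<alpha>))"
  obtains C where "0 \<le> C" "\<And>m. 1 \<le> m \<Longrightarrow> \<bar>f m\<bar> \<le> C * real m powr (- \<alpha>)"
proof -
  obtain c where c: "0 < c" and "eventually (\<lambda>m. norm (f m) \<le> c * norm (real m powr (- \<alpha>))) sequentially"
    using assms by (rule landau_o.bigE)
  then obtain K where K: "\<And>m. K \<le> m \<Longrightarrow> \<bar>f m\<bar> \<le> c * real m powr (- \<alpha>)"
    by (auto simp: eventually_sequentially)
  define C where "C = c + (\<Sum>m<K. \<bar>f m\<bar> / real m powr (- \<alpha>))"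
  have nn: "0 \<le> (\<Sum>m<K. \<bar>f m\<bar> / real m powr (- \<alpha>))" by (intro sum_nonneg) auto
  show ?thesis
  proof (rule that[of C])
    show "0 \<le> C" using nn c by (simp add: C_def)
    fix m :: nat assume m: "1 \<le> m"
    show "\<bar>f m\<bar> \<le> C * real m powr (- \<alpha>)"
    proof (cases "K \<le> m")
      case True
      have "c * real m powr (- \<alpha>) \<le> C * real m powr (- \<alpha>)" using nn by (intro mult_right_mono) (auto simp: C_def)
      then show ?thesis using K[OF True] by linarith
    next
      case False
      then have "\<bar>f m\<bar> / real m powr (- \<alpha>) \<le> (\<Sum>m<K. \<bar>f m\<bar> / real m powr (- \<alpha>))"
        by (intro member_le_sum) auto
      also have "\<dots> \<le> C" using c by (simp add: C_def)
      finally show ?thesis using m by (simp add: field_simps)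
    qed
  qed
qed

theorem theorem5:
  fixes M :: "'a measure"
    and eps eps' :: "int \<Rightarrow> 'a \<Rightarrow> real"
    and g :: "(nat \<Rightarrow> real) \<Rightarrow> real"
    and X :: "int \<Rightarrow> 'a \<Rightarrow> real"
    and p \<alpha> \<alpha>' c :: real
    and A :: "nat \<Rightarrow> real"
  assumes "prob_space M"
    and "iid_with_copy M eps eps'"
    and "g \<in> borel_measurable (PiM UNIV (\<lambda>_. borel))"
    and X_def: "X = causal_process g eps"
    and "p > 4"
    and "\<And>t. in_Lp M p (X t)"
    and "\<And>t. (\<integral>\<omega>. X t \<omega> \<partial>M) = 0"
    and "summable (dep_delta M g eps eps' p)"
    and "\<alpha> \<ge> \<alpha>'" and "\<alpha>' > 0"
    and "dep_Theta M g eps eps' p \<in> O(\<lambda>m. real m powr (- \<alpha>))"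
    and "dep_Delta M g eps eps' p \<in> O(\<lambda>m. real m powr (- \<alpha>'))"
    and "\<alpha> > 1 / 2 \<or> \<alpha>' * p > 2"
    and c_def: "c = 6 * (p + 4) * exp (p / 4) * Lp_norm M 4 (X 0) * dep_Theta M g eps eps' 4 0"
    and A_def: "\<And>T. A T = 2 * c * sqrt (ln (real T) / real T)"
  shows "bounded_in_prob M
           (\<lambda>T \<omega>. operator_norm (thresholded_autocov_mat X T (A T) \<omega> - autocov_mat M X T))
           (\<lambda>T. (ln (real T) / real T) powr (\<alpha> / (2 * (1 + \<alpha>))))"
proof -
  interpret prob_space M by fact
  interpret coupled_innovations M eps eps'
    by unfold_locales fact
  note p = \<open>p > 4\<close>
  have \<alpha>: "0 < \<alpha>" using \<open>\<alpha> \<ge> \<alpha>'\<close> \<open>\<alpha>' > 0\<close> by linarith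
  have \<alpha>p: "2 < \<alpha> * p"
    using \<open>\<alpha> > 1 / 2 \<or> \<alpha>' * p > 2\<close>
  proof
    assume "\<alpha> > 1 / 2"
    then have "1 / 2 * 4 < \<alpha> * p" using p by (intro mult_strict_mono) auto
    then show ?thesis by simp
  next
    assume "\<alpha>' * p > 2"
    moreover have "\<alpha>' * p \<le> \<alpha> * p" using \<open>\<alpha> \<ge> \<alpha>'\<close> p by (intro mult_right_mono) auto
    ultimately show ?thesis by linarith
  qed
  have gm[measurable]: "g \<in> borel_measurable seq.S"
    using \<open>g \<in> borel_measurable (PiM UNIV (\<lambda>_. borel))\<close> by (simp add: measurable_S_iff)
  have X: "X t = (\<lambda>\<omega>. g (past t \<omega>))" for t
    by (simp add: X_def causal_process_past fun_eq_iff)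
  have Xm[measurable]: "X t \<in> borel_measurable M" for t unfolding X by measurable
  define G where "G = Lp_norm M 4 (X 0)"
  have XLp: "Lq_le M p (X 0) (Lp_norm M p (X 0))"
    using \<open>in_Lp M p (X 0)\<close> p by (intro Lq_le_Lp_norm) (auto simp: in_Lp_def)
  have gLp: "Lq_le seq.S p g (Lp_norm M p (X 0))"
    using XLp unfolding X by (simp add: Lq_le_past_iff)
  have "Lq_le M 4 (X 0) (Lp_norm M p (X 0))"
    using p by (intro Lq_le_exponent[OF prob_space_axioms XLp]) auto
  then have "integrable M (\<lambda>\<omega>. \<bar>X 0 \<omega>\<bar> powr 4)" by (rule Lq_le_integrable_powr)
  then have "Lq_le M 4 (X 0) G" unfolding G_def by (intro Lq_le_Lp_norm) auto
  then have gL4: "Lq_le seq.S 4 g G" unfolding X by (simp add: Lq_le_past_iff)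
  have gL2: "Lq_le seq.S 2 g G" by (rule Lq_le_exponent[OF seq.P.prob_space_axioms gL4]) auto
  have mean: "(\<integral>e. g e \<partial>seq.S) = 0"
    using \<open>(\<integral>\<omega>. X 0 \<omega> \<partial>M) = 0\<close> unfolding X by (simp add: integral_past)
  define d d4 where "d = dep_delta M g eps eps' p" and "d4 = dep_delta M g eps eps' 4"
  have infl: "seq.influence_le p g i (d i)" and dLp: "Lq_le M p (\<lambda>\<omega>. causal_process g eps (int i) \<omega> - coupled_process g eps eps' (int i) \<omega>) (d i)" for i
    unfolding d_def using influence_dep_delta[OF _ gLp, of i] p by auto
  have infl4: "seq.influence_le 4 g i (d4 i)" for i
    unfolding d4_def by (rule influence_dep_delta(1)[OF _ gL4]) simp
  have SS: "prob_space (seq.S \<Otimes>\<^sub>M seq.S)"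
    by (rule prob_space_pair) (rule seq.P.prob_space_axioms)+
  have infl2: "seq.influence_le 2 g i (d i)" for i
    using Lq_le_exponent[OF SS infl[of i, unfolded seq.influence_le_def], of 2] p
    unfolding seq.influence_le_def by simp
  have d0: "0 \<le> d i" for i using dLp[of i] by (simp add: Lq_le_def)
  have d40: "0 \<le> d4 i" for i using infl4[of i] by (simp add: seq.influence_le_def Lq_le_def)
  have sum_d: "summable d" unfolding d_def by fact
  have d4_le: "d4 i \<le> d i" for i
    unfolding d4_def dep_delta_def
    by (rule Lp_norm_le[OF Lq_le_exponent[OF prob_space_axioms dLp]]) (use p in auto)
  have sum_d4: "summable d4"
    by (rule summable_comparison_test'[OF sum_d, of 0]) (use d4_le d40 in auto)
  have Theta: "dep_Theta M g eps eps' p m = (\<Sum>j. d (m + j))" for m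
    by (simp add: dep_Theta_def d_def)
  obtain C where C: "0 \<le> C" "\<And>m. 1 \<le> m \<Longrightarrow> \<bar>\<Sum>j. d (m + j)\<bar> \<le> C * real m powr (- \<alpha>)"
    using bigo_powr_bound[OF \<open>dep_Theta M g eps eps' p \<in> O(\<lambda>m. real m powr (- \<alpha>))\<close>] unfolding Theta by blast
  have tail0: "0 \<le> (\<Sum>j. d (m + j))" for m
    using summable_ignore_initial_segment[OF sum_d, of m] d0 by (intro suminf_nonneg) (auto simp: add.commute)
  have tails: "summable (\<lambda>k. (\<Sum>j. d (j + k)) powr (p / 2))"
  proof (rule summable_comparison_test)
    have "summable (\<lambda>k. real k powr (- \<alpha> * (p / 2)))"
      using \<alpha>p by (subst summable_real_powr_iff) simp
    then show "summable (\<lambda>k. C powr (p / 2) * real k powr (- \<alpha> * (p / 2)))" by (rule summable_mult)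
    show "\<exists>K. \<forall>k\<ge>K. norm ((\<Sum>j. d (j + k)) powr (p / 2)) \<le> C powr (p / 2) * real k powr (- \<alpha> * (p / 2))"
    proof (intro exI[of _ 1] allI impI)
      fix k :: nat assume k: "1 \<le> k"
      have "(\<Sum>j. d (k + j)) powr (p / 2) \<le> (C * real k powr (- \<alpha>)) powr (p / 2)"
        using C(2)[OF k] tail0[of k] p by (intro powr_mono2) auto
      also have "\<dots> = C powr (p / 2) * real k powr (- \<alpha> * (p / 2))"
        using C(1) by (simp add: powr_mult powr_powr)
      finally show "norm ((\<Sum>j. d (j + k)) powr (p / 2)) \<le> C powr (p / 2) * real k powr (- \<alpha> * (p / 2))"
        by (simp add: add.commute)
    qed
  qed
  have G0: "0 \<le> G" using gL4 by (simp add: Lq_le_def)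
  have D40: "0 \<le> suminf d4" by (rule suminf_nonneg[OF sum_d4 d40])
  \<comment> \<open>the factor \<open>6 * (p + 4) * exp (p / 4)\<close> is at least \<open>6 * 8 * 2\<close>\<close>
  have c_ge: "64 * G * suminf d4 \<le> c"
  proof -
    have "2 \<le> exp (p / 4)" using exp_ge_add_one_self[of "p / 4"] p by linarith
    then have "8 * 2 \<le> (p + 4) * exp (p / 4)" using p by (intro mult_mono) auto
    then have "64 \<le> 6 * (p + 4) * exp (p / 4)" by linarith
    then have "64 * (G * suminf d4) \<le> 6 * (p + 4) * exp (p / 4) * (G * suminf d4)"
      using G0 D40 by (intro mult_right_mono) auto
    also have "\<dots> = c" unfolding c_def by (simp add: G_def dep_Theta_def d4_def)
    finally show ?thesis by (simp add: mult.assoc)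
  qed
  have c0: "0 \<le> c" using c_ge mult_nonneg_nonneg[OF G0 D40] by linarith
  \<comment> \<open>histories on which some lag deviates too much; the data of size \<open>T\<close> are a function of \<open>past T\<close>\<close>
  define Bad where "Bad T = {e \<in> space seq.S. \<exists>k<T. c * sqrt (real T * ln (real T)) < \<bar>seq.lag_sum g (T - k) k e\<bar>}" for T
  have Badm[measurable]: "Bad T \<in> sets seq.S" for T unfolding Bad_def by measurable
  have Bad0: "(\<lambda>T. measure seq.S (Bad T)) \<longlonglongrightarrow> 0"
    unfolding Bad_def using p
    by (intro seq.uniform_lag_deviation[OF _ gLp mean infl sum_d gL4 infl4 sum_d4 tails c_ge]) auto
  define \<gamma> where "\<gamma> = seq.acov g"
  have autocov: "autocov M X k = \<gamma> (nat \<bar>k\<bar>)" for k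
    unfolding X_def \<gamma>_def by (rule autocov_causal_process[OF gL2])
  define ch where "ch T k \<omega> = (seq.lag_sum g (T - k) k (past (int T) \<omega>) + real (T - k) * \<gamma> k) / real T" for T k \<omega>
  have sample: "sample_autocov X T k \<omega> = ch T (nat \<bar>k\<bar>) \<omega>" if k: "nat \<bar>k\<bar> < T" for T k \<omega>
    unfolding X_def ch_def \<gamma>_def by (rule sample_autocov_causal_process[OF k])
  define E where "E T k \<omega> = (if k = 0 \<or> \<bar>ch T k \<omega>\<bar> \<ge> A T then ch T k \<omega> else 0) - \<gamma> k" for T k \<omega>
  define Y where "Y T \<omega> = operator_norm (thresholded_autocov_mat X T (A T) \<omega> - autocov_mat M X T)" for T \<omega>
  have Y: "Y T \<omega> = operator_norm (Matrix.mat T T (\<lambda>(s, t). E T (nat \<bar>int s - int t\<bar>) \<omega>))" for T \<omega>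
    unfolding Y_def
  proof (intro arg_cong[where f = operator_norm] eq_matI)
    fix s t assume "s < dim_row (Matrix.mat T T (\<lambda>(s, t). E T (nat \<bar>int s - int t\<bar>) \<omega>))"
      and "t < dim_col (Matrix.mat T T (\<lambda>(s, t). E T (nat \<bar>int s - int t\<bar>) \<omega>))"
    then have st: "s < T" "t < T" by simp_all
    then have "nat \<bar>int s - int t\<bar> < T" by linarith
    then show "(thresholded_autocov_mat X T (A T) \<omega> - autocov_mat M X T) $$ (s, t) =
        Matrix.mat T T (\<lambda>(s, t). E T (nat \<bar>int s - int t\<bar>) \<omega>) $$ (s, t)"
      using st by (simp add: thresholded_autocov_mat_def autocov_mat_def sample autocov E_def Let_def)
  qed (simp_all add: thresholded_autocov_mat_def autocov_mat_def)
  have chm[measurable]: "ch T k \<in> borel_measurable M" for T k unfolding ch_def by measurable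
  have Em[measurable]: "E T k \<in> borel_measurable M" for T k unfolding E_def by measurable
  have Ym: "Y T \<in> borel_measurable M" for T
    unfolding Y by (rule borel_measurable_operator_norm) simp
  define r where "r T = (ln (real T) / real T) powr (\<alpha> / (2 * (1 + \<alpha>)))" for T :: nat
  define \<Gamma> where "\<Gamma> = suminf d * suminf d"
  \<comment> \<open>the additional 1 makes the constant positive\<close>
  define K where "K = 12 * c + 4 * \<Gamma> + 4 * (suminf d * C) + 1"
  have D0: "0 \<le> suminf d" by (rule suminf_nonneg[OF sum_d d0])
  have DC: "0 \<le> suminf d * C" by (rule mult_nonneg_nonneg[OF D0 C(1)])
  have K0: "0 < K" using c0 D0 DC by (simp add: K_def \<Gamma>_def add_nonneg_pos)
  have \<gamma>_tail: "(\<Sum>k\<in>{m..<n}. \<bar>\<gamma> k\<bar>) \<le> suminf d * (\<Sum>j. d (m + j))" for m n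
    unfolding \<gamma>_def by (rule seq.autocovariance_tail_bound[OF gL2 mean infl2 sum_d])
  have good: "\<bar>Y T \<omega>\<bar> \<le> K * r T"
    if T: "3 \<le> T" and \<omega>: "\<omega> \<in> space M" "past (int T) \<omega> \<notin> Bad T" for T \<omega>
  proof -
    let ?L = "ln (real T) / real T"
    have dev: "\<bar>ch T k \<omega> - (1 - real k / real T) * \<gamma> k\<bar> \<le> c * sqrt ?L" if k: "k < T" for k
    proof -
      have sp: "past (int T) \<omega> \<in> space seq.S" using measurable_space[OF measurable_past \<omega>(1)] .
      have lag: "\<bar>seq.lag_sum g (T - k) k (past (int T) \<omega>)\<bar> \<le> c * sqrt (real T * ln (real T))"
      proof (rule ccontr)
        assume "\<not> ?thesis"
        then have "past (int T) \<omega> \<in> Bad T" unfolding Bad_def using sp k by (auto simp: not_le)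
        with \<omega>(2) show False by contradiction
      qed
      have "ch T k \<omega> - (1 - real k / real T) * \<gamma> k = seq.lag_sum g (T - k) k (past (int T) \<omega>) / real T"
        using T k by (simp add: ch_def of_nat_diff field_simps)
      then have "\<bar>ch T k \<omega> - (1 - real k / real T) * \<gamma> k\<bar> = \<bar>seq.lag_sum g (T - k) k (past (int T) \<omega>)\<bar> / real T"
        by simp
      also have "\<dots> \<le> c * sqrt (real T * ln (real T)) / real T"
        using lag by (intro divide_right_mono) auto
      also have "\<dots> = c * sqrt ?L"
        using T by (simp add: real_sqrt_mult real_sqrt_divide field_simps)
      finally show ?thesis .
    qed
    have total: "(\<Sum>k<T. \<bar>\<gamma> k\<bar>) \<le> \<Gamma>" using \<gamma>_tail[of 0 T] by (simp add: \<Gamma>_def lessThan_atLeast0)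
    have tail: "(\<Sum>k\<in>{m..<T}. \<bar>\<gamma> k\<bar>) \<le> suminf d * C * real m powr (- \<alpha>)" if m: "1 \<le> m" for m
    proof -
      have "(\<Sum>j. d (m + j)) \<le> C * real m powr (- \<alpha>)" using C(2)[OF m] by simp
      then have "suminf d * (\<Sum>j. d (m + j)) \<le> suminf d * (C * real m powr (- \<alpha>))"
        using D0 by (rule mult_left_mono)
      then show ?thesis using \<gamma>_tail[of m T] by (simp add: mult.assoc)
    qed
    have "\<bar>Y T \<omega>\<bar> \<le> (12 * c + 4 * \<Gamma> + 4 * (suminf d * C)) * r T"
      unfolding Y E_def A_def r_def by (rule thresholded_Toeplitz_error[OF T \<alpha> c0 dev total DC tail])
    also have "\<dots> \<le> K * r T" by (intro mult_right_mono) (auto simp: K_def r_def)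
    finally show ?thesis .
  qed
  have prob: "measure M {\<omega> \<in> space M. K * r T < \<bar>Y T \<omega>\<bar>} \<le> measure seq.S (Bad T)" if T: "3 \<le> T" for T
  proof -
    have "measure M {\<omega> \<in> space M. K * r T < \<bar>Y T \<omega>\<bar>} \<le> measure M (past (int T) -` Bad T \<inter> space M)"
    proof (rule finite_measure_mono)
      show "{\<omega> \<in> space M. K * r T < \<bar>Y T \<omega>\<bar>} \<subseteq> past (int T) -` Bad T \<inter> space M"
        using good[OF T] by fastforce
    qed measurable
    also have "\<dots> = measure (distr M seq.S (past (int T))) (Bad T)"
      by (rule measure_distr[symmetric]) measurable
    finally show ?thesis by (simp add: distr_past)
  qed
  have "bounded_in_prob M Y r"
    unfolding bounded_in_prob_def
  proof (intro conjI allI impI)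
    show "Y T \<in> borel_measurable M" for T by (rule Ym)
    fix \<eta> :: real assume "0 < \<eta>"
    then have "eventually (\<lambda>T. measure seq.S (Bad T) < \<eta>) sequentially"
      using Bad0 by (intro order_tendstoD) auto
    then have "eventually (\<lambda>T. measure M {\<omega> \<in> space M. K * r T < \<bar>Y T \<omega>\<bar>} \<le> \<eta>) sequentially"
      using eventually_ge_at_top[of 3]
    proof eventually_elim
      case (elim T)
      then show ?case using prob[of T] by linarith
    qed
    then show "\<exists>C>0. eventually (\<lambda>T. measure M {\<omega> \<in> space M. C * r T < \<bar>Y T \<omega>\<bar>} \<le> \<eta>) sequentially"
      using K0 by blast
  qed
  then show ?thesis unfolding Y_def[abs_def] r_def[abs_def] .
qed

end
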